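(* For every noncommutative rational function $\mathbf{r}\in\mathbb{C}(\langle x\rangle)$ there exists a representative $r\in\mathbf{r}$ such that $\operatorname{hdom}\mathbf{r}=\operatorname{hdom} r$.
   Context: $M_n(\mathbb{C})$ denotes complex $n\times n$ matrices, $H_n(\mathbb{C})$ the hermitian ones. $x=(x_1,\dots,x_d)$ are freely noncommuting variables. A formal rational expression $r$ is a syntactically valid combination of complex scalars, the variables, the operations $+,\times,{}^{-1}$ and parentheses (an ordered rooted tree with leaves labeled by $\mathbb{C}\cup\{x_1,\dots,x_d\}$ and other nodes labeled $+$ or $\times$ with two children, or ${}^{-1}$ with one child). For $X\in M_n(\mathbb{C})^d$, $r(X)$ is defined if all inverses appearing in $r$ exist at $X$; the set of such $X$ is $\operatorname{dom}_n r$; $\operatorname{dom} r=\bigcup_{n\in\mathbb{N}}\operatorname{dom}_n r$ and $\operatorname{hdom} r=\bigcup_{n\in\mathbb{N}}(\operatorname{dom}_n r\cap H_n(\mathbb{C})^d)$. $r$ is non-degenerate if $\operatorname{dom} r\ne\emptyset$. On non-degenerate expressions put $r_1\sim r_2$ if $r_1(X)=r_2(X)$ for all $X\in\operatorname{dom} r_1\cap\operatorname{dom} r_2$. Equivalence classes $\mathbf{r}$ are noncommutative rational functions; they form the free skew field $\mathbb{C}(\langle x\rangle)$, the universal skew field of fractions of the free algebra $\mathbb{C}\langle x\rangle$. We write $r\in\mathbf{r}$ if the non-degenerate expression $r$ represents $\mathbf{r}$, and set $\operatorname{hdom}\mathbf{r}=\bigcup_{r\in\mathbf{r}}\operatorname{hdom}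 r$. *)

theory Defs
  imports "Jordan_Normal_Form.Schur_Decomposition"
begin

text \<open>
  The variables \<open>x\<^sub>1, \<dots>, x\<^sub>d\<close> are indexed by a finite type \<open>'d\<close>, so \<open>d = CARD('d)\<close>, and a
  \<open>d\<close>-tuple of matrices is a function of type \<open>'d \<Rightarrow> complex mat\<close>. All types are nonempty, hence a
  tuple determines the size of its matrices and the unions over \<open>n\<close> below are disjoint.
\<close>

datatype 'd rat_expr =
    Const complex
  | Var 'd
  | Add "'d rat_expr" "'d rat_expr"
  | Mult "'d rat_expr" "'d rat_expr"
  | Inv "'d rat_expr"

text \<open>
  The value \<open>r(X)\<close> at a tuple of \<open>n \<times> n\<close> matrices; \<open>None\<close> if some inverse occurring in \<open>r\<close> does not
  exist at \<open>X\<close>. The size \<open>n\<close> is needed to interpret scalars as scalar matrices.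
\<close>

primrec eval_expr :: "nat \<Rightarrow> ('d \<Rightarrow> complex mat) \<Rightarrow> 'd rat_expr \<Rightarrow> complex mat option" where
  "eval_expr n X (Const c) = Some (c \<cdot>\<^sub>m 1\<^sub>m n)"
| "eval_expr n X (Var i) = Some (X i)"
| "eval_expr n X (Add r s) =
     Option.bind (eval_expr n X r) (\<lambda>A. Option.bind (eval_expr n X s) (\<lambda>B. Some (A + B)))"
| "eval_expr n X (Mult r s) =
     Option.bind (eval_expr n X r) (\<lambda>A. Option.bind (eval_expr n X s) (\<lambda>B. Some (A * B)))"
| "eval_expr n X (Inv r) = Option.bind (eval_expr n X r) mat_inverse"

text \<open>\<^const>\<open>mat_inverse\<close> is given by Gauss--Jordan elimination; it is the two-sided inverse:\<close>

lemma mat_inverse_eq_Some_iff: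
  fixes A :: "'a :: field mat"
  assumes A: "A \<in> carrier_mat n n"
  shows "mat_inverse A = Some B \<longleftrightarrow> B \<in> carrier_mat n n \<and> A * B = 1\<^sub>m n \<and> B * A = 1\<^sub>m n"
proof
  assume "mat_inverse A = Some B"
  then show "B \<in> carrier_mat n n \<and> A * B = 1\<^sub>m n \<and> B * A = 1\<^sub>m n"
    using mat_inverse(2)[OF A] by blast
next
  assume B: "B \<in> carrier_mat n n \<and> A * B = 1\<^sub>m n \<and> B * A = 1\<^sub>m n"
  then have "A \<in> Units (ring_mat TYPE('a) n ())"
    using A unfolding Units_def ring_mat_def by auto
  then obtain C where C: "mat_inverse A = Some C"
    using mat_inverse(1)[OF A, where b = "()"] by (cases "mat_inverse A") auto
  then have C': "A * C = 1\<^sub>m n" "C \<in> carrier_mat n n"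
    using mat_inverse(2)[OF A] by auto
  have "B = B * (A * C)"
    using B C' right_mult_one_mat[of B n n] by simp
  also have "\<dots> = B * A * C"
    using A B C' by (metis assoc_mult_mat)
  also have "\<dots> = C"
    using B C' left_mult_one_mat[of C n n] by simp
  finally show "mat_inverse A = Some B"
    using C by simp
qed

lemma eval_expr_carrier:
  assumes "\<And>i. X i \<in> carrier_mat n n" "eval_expr n X r = Some A"
  shows "A \<in> carrier_mat n n"
  using assms(2)
proof (induction r arbitrary: A)
  case (Inv r)
  then show ?case
    by (auto simp: bind_eq_Some_conv mat_inverse_eq_Some_iff)
qed (use assms(1) in \<open>auto simp: bind_eq_Some_conv\<close>)

definition dom_n :: "nat \<Rightarrow> 'd rat_expr \<Rightarrow> ('d \<Rightarrow> complex mat) set" where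
  "dom_n n r = {X. (\<forall>i. X i \<in> carrier_mat n n) \<and> eval_expr n X r \<noteq> None}"

definition herm_tuples :: "nat \<Rightarrow> ('d \<Rightarrow> complex mat) set" where
  "herm_tuples n = {X. \<forall>i. X i \<in> carrier_mat n n \<and> mat_adjoint (X i) = X i}"

text \<open>
  Matrix sizes start at \<open>1\<close>: every \<open>0 \<times> 0\<close> matrix is invertible, so allowing size \<open>0\<close> would make
  all expressions non-degenerate.
\<close>

definition expr_dom :: "'d rat_expr \<Rightarrow> ('d \<Rightarrow> complex mat) set" where
  "expr_dom r = (\<Union>n\<in>{1..}. dom_n n r)"

definition expr_hdom :: "'d rat_expr \<Rightarrow> ('d \<Rightarrow> complex mat) set" where
  "expr_hdom r = (\<Union>n\<in>{1..}. dom_n n r \<inter> herm_tuples n)"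

definition nondegenerate :: "'d rat_expr \<Rightarrow> bool" where
  "nondegenerate r \<longleftrightarrow> expr_dom r \<noteq> {}"

definition rat_equiv :: "('d rat_expr \<times> 'd rat_expr) set" where
  "rat_equiv = {(r, s). nondegenerate r \<and> nondegenerate s \<and>
     (\<forall>n\<ge>1. \<forall>X\<in>dom_n n r \<inter> dom_n n s. eval_expr n X r = eval_expr n X s)}"

text \<open>
  The noncommutative rational functions, i.e. the underlying set of the free skew field, as
  equivalence classes of non-degenerate expressions.
\<close>

definition nc_rat_funs :: "'d rat_expr set set" where
  "nc_rat_funs = {r. nondegenerate r} // rat_equiv"

definition fun_hdom :: "'d rat_expr set \<Rightarrow> ('d \<Rightarrow> complex mat) set" where
  "fun_hdom R = (\<Union>r\<in>R. expr_hdom r)"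

end

theory Submission
  imports Defs "HOL-Library.Landau_Symbols"
begin

text \<open>
  An expression is realized by an affine linear pencil, \<open>r(X) = u Q(X)\<^sup>-\<^sup>1 v\<close>, with \<open>Q(X)\<close> invertible exactly
  on the domain of \<open>r\<close>. Among all realizations of a noncommutative rational function choose one of minimal
  size. Then the entries of \<open>u Q\<^sup>-\<^sup>1\<close> and those of \<open>Q\<^sup>-\<^sup>1 v\<close> are linearly independent: otherwise a row of \<open>Q\<close> can
  be removed after a change of basis, and since some entry of the corresponding column of \<open>Q\<^sup>-\<^sup>1\<close> is
  generically invertible (Amitsur), so can a column. Let \<open>X\<close> be in the domain of some representative \<open>s\<close>.
  The off-diagonal blocks of \<open>s\<close> at block triangular tuples built from \<open>X\<close> and generic points show that
  \<open>Q\<^sup>-\<^sup>1\<close> stays bounded along generic lines into \<open>X\<close>, so \<open>Q(X)\<close> is invertible. Hence the domain of the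
  minimal pencil contains the domain of every representative. On hermitian tuples \<open>Q\<^sup>-\<^sup>1 = (Q\<^sup>*Q)\<^sup>-\<^sup>1 Q\<^sup>*\<close>,
  and the positive definite \<open>Q\<^sup>*Q\<close> can be inverted by an expression that only inverts its pivots.
\<close>

section \<open>Kronecker products\<close>

text \<open>So the constant coefficient of the pencil is arbitrary, and independence is tested at
  points of all sizes. Points of sizes m and n meet only after amplification to size mn; there a
  line joins them, and the fact that a polynomial in the line parameter has finitely many roots
  replaces all density arguments. Removing a row leaves a nonsquare pencil. The column to be dropped
  with it is found from an entry of Q^-1 c that is invertible at some point; being nonzero does not
  suffice, since nonzero matrices may be singular. This is where division algebras enter. A matrix
  of expressions is inverted by pivoting, and a pivot may be singular where the whole matrix is not.
  For a positive definite matrix this never happens, whence the restriction to hermitian tuples. The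
  final expression is written with conjugated coefficients but the same variables; away from
  hermitian tuples it loses positivity, yet where it is defined it still represents the same
  function.\<close>

lemma sum_div_mod:
  fixes g :: "nat \<Rightarrow> nat \<Rightarrow> 'a :: comm_monoid_add"
  shows "(\<Sum>k = 0..<m * f. g (k div f) (k mod f)) = (\<Sum>a = 0..<m. \<Sum>b = 0..<f. g a b)"
proof (induction m)
  case (Suc m)
  have "(\<Sum>k = 0..<Suc m * f. g (k div f) (k mod f)) =
      (\<Sum>k = 0..<m * f. g (k div f) (k mod f)) + (\<Sum>k = m * f..<m * f + f. g (k div f) (k mod f))"
    by (subst sum.atLeastLessThan_concat) (auto simp: add.commute)
  also have "(\<Sum>k = m * f..<m * f + f. g (k div f) (k mod f)) = (\<Sum>b = 0..<f. g m b)"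
    using sum.shift_bounds_nat_ivl[of "\<lambda>k. g (k div f) (k mod f)" 0 "m * f" f]
    by (auto intro!: sum.cong simp: add.commute)
  finally show ?case using Suc by simp
qed simp

lemma div_less_of_less_mult: "i < n * e \<Longrightarrow> i div e < n" for i n e :: nat
  by (simp add: less_mult_imp_div_less)

lemma mod_less_of_less_mult: "i < n * e \<Longrightarrow> i mod e < e" for i n e :: nat
  by (cases "e = 0") auto

definition kron :: "'a :: comm_ring_1 mat \<Rightarrow> 'a mat \<Rightarrow> 'a mat" where
  "kron A B = mat (dim_row A * dim_row B) (dim_col A * dim_col B)
     (\<lambda>(i, j). A $$ (i div dim_row B, j div dim_col B) * B $$ (i mod dim_row B, j mod dim_col B))"

lemma kron_dim [simp]:
  "dim_row (kron A B) = dim_row A * dim_row B" "dim_col (kron A B) = dim_col A * dim_col B"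
  by (auto simp: kron_def)

lemma kron_carrier [simp, intro]:
  "A \<in> carrier_mat n m \<Longrightarrow> B \<in> carrier_mat e f \<Longrightarrow> kron A B \<in> carrier_mat (n * e) (m * f)"
  by (intro carrier_matI) auto

lemma kron_index:
  assumes "A \<in> carrier_mat n m" "B \<in> carrier_mat e f" "i < n * e" "j < m * f"
  shows "kron A B $$ (i, j) = A $$ (i div e, j div f) * B $$ (i mod e, j mod f)"
  using assms by (auto simp: kron_def)

lemma index_mult_mat_sum:
  "A \<in> carrier_mat n m \<Longrightarrow> B \<in> carrier_mat m p \<Longrightarrow> i < n \<Longrightarrow> j < p \<Longrightarrow>
    (A * B) $$ (i, j) = (\<Sum>k = 0..<m. A $$ (i, k) * B $$ (k, j))"
  by (auto simp: scalar_prod_def intro!: sum.cong)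

lemma kron_mult:
  assumes A: "A \<in> carrier_mat n m" and C: "C \<in> carrier_mat m p"
    and B: "B \<in> carrier_mat e f" and D: "D \<in> carrier_mat f g"
  shows "kron A B * kron C D = kron (A * C) (B * D)"
proof (rule eq_matI)
  fix i j
  assume "i < dim_row (kron (A * C) (B * D))" "j < dim_col (kron (A * C) (B * D))"
  then have ij: "i < n * e" "j < p * g" using assms by auto
  have "(kron A B * kron C D) $$ (i, j) =
      (\<Sum>k = 0..<m * f. kron A B $$ (i, k) * kron C D $$ (k, j))"
    using assms ij by (intro index_mult_mat_sum[where n = "n * e" and p = "p * g"]) auto
  also have "\<dots> = (\<Sum>k = 0..<m * f. (A $$ (i div e, k div f) * C $$ (k div f, j div g)) *
      (B $$ (i mod e, k mod f) * D $$ (k mod f, j mod g)))"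
    using ij by (intro sum.cong refl)
      (simp add: kron_index[OF A B] kron_index[OF C D] algebra_simps)
  also have "\<dots> = (\<Sum>a = 0..<m. \<Sum>b = 0..<f. (A $$ (i div e, a) * C $$ (a, j div g)) *
      (B $$ (i mod e, b) * D $$ (b, j mod g)))"
    by (rule sum_div_mod)
  also have "\<dots> = (A * C) $$ (i div e, j div g) * (B * D) $$ (i mod e, j mod g)"
    using ij by (simp add: index_mult_mat_sum[OF A C] index_mult_mat_sum[OF B D]
      div_less_of_less_mult mod_less_of_less_mult sum_product)
  also have "\<dots> = kron (A * C) (B * D) $$ (i, j)"
    by (rule sym, rule kron_index) (use assms ij in auto)
  finally show "(kron A B * kron C D) $$ (i, j) = kron (A * C) (B * D) $$ (i, j)" .
qed (use assms in auto)

lemma kron_one [simp]: "kron (1\<^sub>m n) (1\<^sub>m e) = 1\<^sub>m (n * e)"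
proof (rule eq_matI)
  fix i j assume "i < dim_row (1\<^sub>m (n * e))" "j < dim_col (1\<^sub>m (n * e))"
  then have ij: "i < n * e" "j < n * e" by auto
  have "(i div e = j div e \<and> i mod e = j mod e) \<longleftrightarrow> i = j"
    by (metis div_mult_mod_eq)
  then show "kron (1\<^sub>m n) (1\<^sub>m e) $$ (i, j) = 1\<^sub>m (n * e) $$ (i, j)"
    using ij by (auto simp: kron_index[of _ n n _ e e] div_less_of_less_mult mod_less_of_less_mult)
qed auto

lemma kron_assoc: "kron (kron A B) C = kron A (kron B C)"
proof (rule eq_matI)
  obtain n m where A: "A \<in> carrier_mat n m" by blast
  obtain n' m' where B: "B \<in> carrier_mat n' m'" by blast
  obtain n'' m'' where C: "C \<in> carrier_mat n'' m''" by blast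
  fix i j assume "i < dim_row (kron A (kron B C))" "j < dim_col (kron A (kron B C))"
  then have i: "i < n * n' * n''" "i < n * (n' * n'')" and j: "j < m * m' * m''" "j < m * (m' * m'')"
    using A B C by (auto simp: mult.assoc)
  have pos: "n'' > 0" "m'' > 0" using i j by (auto intro: gr0I)
  have "kron (kron A B) C $$ (i, j) = A $$ (i div n'' div n', j div m'' div m') *
      B $$ (i div n'' mod n', j div m'' mod m') * C $$ (i mod n'', j mod m'')"
    using i j A B C by (simp add: kron_index[where n = "n * n'" and m = "m * m'" and e = n'' and f = m'']
        kron_index[OF A B] div_less_of_less_mult)
  also have "\<dots> = A $$ (i div (n' * n''), j div (m' * m'')) *
      (B $$ (i mod (n' * n'') div n'', j mod (m' * m'') div m'') *
       C $$ (i mod (n' * n'') mod n'', j mod (m' * m'') mod m''))"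
    using pos by (simp add: div_mult2_eq mod_mult2_eq mult.commute[of n' n''] mult.commute[of m' m''] mult.assoc)
  also have "\<dots> = kron A (kron B C) $$ (i, j)"
    using i j A B C
    by (simp add: kron_index[where n = n and m = m and e = "n' * n''" and f = "m' * m''"]
        kron_index[OF B C] mod_less_of_less_mult)
  finally show "kron (kron A B) C $$ (i, j) = kron A (kron B C) $$ (i, j)" .
qed (auto simp: mult.assoc)

lemma kron_transpose: "transpose_mat (kron A B) = kron (transpose_mat A) (transpose_mat B)"
proof (rule eq_matI)
  obtain n m where A: "A \<in> carrier_mat n m" by blast
  obtain e f where B: "B \<in> carrier_mat e f" by blast
  fix i j assume "i < dim_row (kron A\<^sup>T B\<^sup>T)" "j < dim_col (kron A\<^sup>T B\<^sup>T)"
  then have ij: "i < m * f" "j < n * e" using A B by auto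
  then show "(kron A B)\<^sup>T $$ (i, j) = kron A\<^sup>T B\<^sup>T $$ (i, j)"
    using A B by (simp add: kron_index[OF A B] kron_index[of "A\<^sup>T" m n "B\<^sup>T" f e]
        div_less_of_less_mult mod_less_of_less_mult)
qed auto

lemma kron_add_left:
  assumes "A \<in> carrier_mat n m" "A' \<in> carrier_mat n m" "B \<in> carrier_mat e f"
  shows "kron (A + A') B = kron A B + kron A' B"
  using assms by (intro eq_matI)
    (auto simp: kron_index[where n = n and m = m and e = e and f = f] algebra_simps
       div_less_of_less_mult mod_less_of_less_mult)

lemma kron_add_right:
  assumes "A \<in> carrier_mat n m" "B \<in> carrier_mat e f" "B' \<in> carrier_mat e f"
  shows "kron A (B + B') = kron A B + kron A B'"
  using assms by (intro eq_matI)
    (auto simp: kron_index[where n = n and m = m and e = e and f = f] algebra_simps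
       div_less_of_less_mult mod_less_of_less_mult)

lemma kron_smult_left: "kron (c \<cdot>\<^sub>m A) B = c \<cdot>\<^sub>m kron A B"
proof -
  obtain n m where A: "A \<in> carrier_mat n m" by blast
  obtain e f where B: "B \<in> carrier_mat e f" by blast
  show ?thesis using A B by (intro eq_matI)
    (auto simp: kron_index[where n = n and m = m and e = e and f = f] algebra_simps
       div_less_of_less_mult mod_less_of_less_mult)
qed

lemma kron_smult_right: "kron A (c \<cdot>\<^sub>m B) = c \<cdot>\<^sub>m kron A B"
proof -
  obtain n m where A: "A \<in> carrier_mat n m" by blast
  obtain e f where B: "B \<in> carrier_mat e f" by blast
  show ?thesis using A B by (intro eq_matI)
    (auto simp: kron_index[where n = n and m = m and e = e and f = f] algebra_simps
       div_less_of_less_mult mod_less_of_less_mult)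
qed

lemma kron_one_one: "A \<in> carrier_mat n m \<Longrightarrow> B = 1\<^sub>m 1 \<Longrightarrow> kron A B = A"
  by (intro eq_matI) (auto simp: kron_index[of A n m _ 1 1])

lemma one_kron: "B \<in> carrier_mat e f \<Longrightarrow> kron (1\<^sub>m 1) B = B"
  by (intro eq_matI) (auto simp: kron_index[of _ 1 1 _ e f])

lemma kron_map:
  assumes "comm_ring_hom h"
  shows "map_mat h (kron A B) = kron (map_mat h A) (map_mat h B)"
proof -
  interpret comm_ring_hom h by fact
  obtain n m where A: "A \<in> carrier_mat n m" by blast
  obtain e f where B: "B \<in> carrier_mat e f" by blast
  show ?thesis using A B by (intro eq_matI)
    (auto simp: kron_index[where n = n and m = m and e = e and f = f] hom_mult
       div_less_of_less_mult mod_less_of_less_mult)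
qed

lemma sub_mult_div_eq: "(i - n * e) div e = i div e - n" if "e > 0" for i n e :: nat
proof (cases "n * e \<le> i")
  case True
  then obtain k where "i = n * e + k" by (metis le_Suc_ex)
  with that show ?thesis by simp
next
  case False
  then have "i div e < n" using that by (simp add: div_less_iff_less_mult)
  with False show ?thesis by simp
qed

lemma kron_four_block:
  assumes A: "A \<in> carrier_mat n1 m1" "B \<in> carrier_mat n1 m2" "C \<in> carrier_mat n2 m1"
    "D \<in> carrier_mat n2 m2" and Q: "Q \<in> carrier_mat e f"
  shows "kron (four_block_mat A B C D) Q =
    four_block_mat (kron A Q) (kron B Q) (kron C Q) (kron D Q)"
proof (rule eq_matI)
  fix i j
  assume "i < dim_row (four_block_mat (kron A Q) (kron B Q) (kron C Q) (kron D Q))"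
    "j < dim_col (four_block_mat (kron A Q) (kron B Q) (kron C Q) (kron D Q))"
  then have i: "i < (n1 + n2) * e" and j: "j < (m1 + m2) * f" using assms by (auto simp: algebra_simps)
  have F: "four_block_mat A B C D \<in> carrier_mat (n1 + n2) (m1 + m2)" using A by auto
  have e: "e > 0" "f > 0" using i j by (auto intro: gr0I)
  have *: "i div e < n1 \<longleftrightarrow> i < n1 * e" "j div f < m1 \<longleftrightarrow> j < m1 * f"
    using e by (simp_all add: div_less_iff_less_mult)
  have **: "(i - n1 * e) div e = i div e - n1" "(j - m1 * f) div f = j div f - m1"
    by (auto simp: sub_mult_div_eq[OF e(1)] sub_mult_div_eq[OF e(2)])
  have ***: "(i - n1 * e) mod e = i mod e" if "\<not> i < n1 * e"
    using that by (metis le_mod_geq mod_mult_self3 le_add_diff_inverse mult.commute not_less)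
  have ****: "(j - m1 * f) mod f = j mod f" if "\<not> j < m1 * f"
    using that by (metis le_mod_geq mod_mult_self3 le_add_diff_inverse mult.commute not_less)
  have 1: "i - n1 * e < n2 * e" if "\<not> i < n1 * e" using i that by (simp add: algebra_simps)
  have 2: "j - m1 * f < m2 * f" if "\<not> j < m1 * f" using j that by (simp add: algebra_simps)
  show "kron (four_block_mat A B C D) Q $$ (i, j) =
      four_block_mat (kron A Q) (kron B Q) (kron C Q) (kron D Q) $$ (i, j)"
    using A Q i j
    by (simp add: kron_index[OF F Q] div_less_of_less_mult * )
      (auto simp: distrib_right kron_index[OF A(1) Q] kron_index[OF A(2) Q]
        kron_index[OF A(3) Q] kron_index[OF A(4) Q] ** *** **** 1 2)
qed (use assms in \<open>auto simp: algebra_simps\<close>)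

section \<open>Inverses and pencils\<close>

text \<open>A total inverse by the adjugate formula. At a singular matrix the division by zero
  yields the zero matrix, still of the right size, so functions of a line parameter keep their size
  at every parameter. The formula also makes continuity visible entrywise.\<close>

definition minv :: "'a :: field mat \<Rightarrow> 'a mat" where
  "minv A = (1 / det A) \<cdot>\<^sub>m adj_mat A"

lemma minv_carrier [simp, intro]: "A \<in> carrier_mat n n \<Longrightarrow> minv A \<in> carrier_mat n n"
  by (auto simp: minv_def dest: adj_mat(1))

lemma minv_dim [simp]: "dim_row (minv A) = dim_row A" "dim_col (minv A) = dim_col A"
  by (auto simp: minv_def adj_mat_def)

lemma mat_mult_assoc:
  "dim_col A = dim_row B \<Longrightarrow> dim_col B = dim_row C \<Longrightarrow> A * B * C = A * (B * C)"
  for A :: "'a :: semiring_0 mat"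
  by (rule assoc_mult_mat) auto

lemma minv_inverse:
  assumes A: "A \<in> carrier_mat n n" and d: "det A \<noteq> 0"
  shows "A * minv A = 1\<^sub>m n" "minv A * A = 1\<^sub>m n"
proof -
  have "A * minv A = (1 / det A) \<cdot>\<^sub>m (A * adj_mat A)"
    unfolding minv_def by (rule mult_smult_distrib[OF A adj_mat(1)[OF A]])
  then show "A * minv A = 1\<^sub>m n" using d by (auto simp: adj_mat(2)[OF A] intro!: eq_matI)
  have "minv A * A = (1 / det A) \<cdot>\<^sub>m (adj_mat A * A)"
    unfolding minv_def by (rule mult_smult_assoc_mat[OF adj_mat(1)[OF A] A])
  then show "minv A * A = 1\<^sub>m n" using d by (auto simp: adj_mat(3)[OF A] intro!: eq_matI)
qed

lemma det_nonzeroI: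
  assumes "A \<in> carrier_mat n n" "B \<in> carrier_mat n n" "A * B = 1\<^sub>m n"
  shows "det A \<noteq> (0 :: 'a :: idom)" "det B \<noteq> 0"
  using det_mult[OF assms(1,2)] assms(3) by auto

lemma minv_eqI:
  assumes A: "A \<in> carrier_mat n n" and B: "B \<in> carrier_mat n n" and AB: "A * B = 1\<^sub>m n"
  shows "minv A = B"
proof -
  note i = minv_inverse[OF A det_nonzeroI(1)[OF assms]]
  have "minv A = minv A * (A * B)" using AB A by simp
  also have "\<dots> = (minv A * A) * B" using A B by (simp add: mat_mult_assoc)
  also have "\<dots> = B" using i B by simp
  finally show ?thesis .
qed

lemma minv_eqI':
  assumes A: "A \<in> carrier_mat n n" and B: "B \<in> carrier_mat n n" and AB: "B * A = 1\<^sub>m n"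
  shows "minv A = B"
proof -
  note i = minv_inverse[OF A det_nonzeroI(2)[OF B A AB]]
  have "minv A = (B * A) * minv A" using AB A by simp
  also have "\<dots> = B * (A * minv A)" using A B by (simp add: mat_mult_assoc)
  also have "\<dots> = B" using i B by simp
  finally show ?thesis .
qed

lemma minv_transpose:
  assumes A: "A \<in> carrier_mat n n" and d: "det A \<noteq> 0"
  shows "minv (A\<^sup>T) = (minv A)\<^sup>T"
proof (rule minv_eqI[where n = n])
  show "A\<^sup>T * (minv A)\<^sup>T = 1\<^sub>m n"
    using minv_inverse(2)[OF A d] transpose_mult[OF minv_carrier[OF A] A]
    by (metis transpose_one)
qed (use A in auto)

lemma kron_one_mult:
  assumes "A \<in> carrier_mat e f" "B \<in> carrier_mat f g"
  shows "kron (1\<^sub>m n) A * kron (1\<^sub>m n) B = kron (1\<^sub>m n) (A * B)"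
  using kron_mult[of "1\<^sub>m n" n n "1\<^sub>m n" n A e f B g] assms by simp

lemma kron_one_inverse:
  assumes A: "A \<in> carrier_mat e e" and d: "det A \<noteq> 0"
  shows "det (kron (1\<^sub>m n) A) \<noteq> 0" "minv (kron (1\<^sub>m n) A) = kron (1\<^sub>m n) (minv A)"
proof -
  have *: "kron (1\<^sub>m n) A * kron (1\<^sub>m n) (minv A) = 1\<^sub>m (n * e)"
    using kron_one_mult[OF A minv_carrier[OF A]] minv_inverse[OF A d] by simp
  show "det (kron (1\<^sub>m n) A) \<noteq> 0"
    by (rule det_nonzeroI(1)[OF _ _ *]) (use A in auto)
  show "minv (kron (1\<^sub>m n) A) = kron (1\<^sub>m n) (minv A)"
    by (rule minv_eqI[OF _ _ *]) (use A in auto)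
qed

lemma four_block_upper_inverse:
  assumes A: "A \<in> carrier_mat n n" and B: "B \<in> carrier_mat n m" and D: "D \<in> carrier_mat m m"
    and d: "det A \<noteq> 0" "det D \<noteq> 0"
  shows "minv (four_block_mat A B (0\<^sub>m m n) D) =
     four_block_mat (minv A) (- (minv A * B * minv D)) (0\<^sub>m m n) (minv D)"
proof (rule minv_eqI[where n = "n + m"])
  note i = minv_inverse[OF A d(1)] minv_inverse[OF D d(2)]
  have iA: "minv A \<in> carrier_mat n n" and iD: "minv D \<in> carrier_mat m m" using A D by auto
  have "A * (minv A * B * minv D) = (A * minv A) * B * minv D"
    using A B D by (simp add: mat_mult_assoc)
  then have *: "A * (minv A * B * minv D) = B * minv D" using i B by simp
  have z: "- 0\<^sub>m m m + 1\<^sub>m m = (1\<^sub>m m :: 'a mat)" by (auto intro!: eq_matI)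
  show "four_block_mat A B (0\<^sub>m m n) D * four_block_mat (minv A) (- (minv A * B * minv D)) (0\<^sub>m m n) (minv D)
     = 1\<^sub>m (n + m)"
    using A iA B D iD
    by (subst mult_four_block_mat[where ?nr1.0 = n and ?n1.0 = n and ?n2.0 = m and ?nr2.0 = m and ?nc1.0 = n and ?nc2.0 = m])
      (auto simp: i * z uminus_l_inv_mat[of _ n m])
qed (use assms in auto)

section \<open>Linear pencils evaluated at tuples of matrices\<close>

definition msum :: "nat \<Rightarrow> nat \<Rightarrow> ('i :: finite \<Rightarrow> 'a :: comm_ring_1 mat) \<Rightarrow> 'a mat" where
  "msum n m f = mat n m (\<lambda>ij. \<Sum>i\<in>UNIV. f i $$ ij)"

lemma msum_carrier [simp, intro]: "msum n m f \<in> carrier_mat n m"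
  by (auto simp: msum_def)

lemma msum_index: "r < n \<Longrightarrow> c < m \<Longrightarrow> msum n m f $$ (r, c) = (\<Sum>i\<in>UNIV. f i $$ (r, c))"
  by (auto simp: msum_def)

lemma msum_dim [simp]: "dim_row (msum n m f) = n" "dim_col (msum n m f) = m"
  by (auto simp: msum_def)

lemma mult_msum:
  assumes L: "L \<in> carrier_mat n' n" and f: "\<And>i. f i \<in> carrier_mat n m"
  shows "L * msum n m f = msum n' m (\<lambda>i. L * f i)"
proof (rule eq_matI)
  fix r c assume "r < dim_row (msum n' m (\<lambda>i. L * f i))" "c < dim_col (msum n' m (\<lambda>i. L * f i))"
  then have rc: "r < n'" "c < m" by auto
  have "(L * msum n m f) $$ (r, c) = (\<Sum>k = 0..<n. \<Sum>i\<in>UNIV. L $$ (r, k) * f i $$ (k, c))"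
    using rc by (subst index_mult_mat_sum[OF L msum_carrier]) (auto simp: msum_index sum_distrib_left)
  also have "\<dots> = msum n' m (\<lambda>i. L * f i) $$ (r, c)"
    using rc by (subst sum.swap) (auto simp: msum_index index_mult_mat_sum[OF L f])
  finally show "(L * msum n m f) $$ (r, c) = msum n' m (\<lambda>i. L * f i) $$ (r, c)" .
qed (use L in auto)

lemma msum_mult:
  assumes L: "L \<in> carrier_mat m m'" and f: "\<And>i. f i \<in> carrier_mat n m"
  shows "msum n m f * L = msum n m' (\<lambda>i. f i * L)"
proof (rule eq_matI)
  fix r c assume "r < dim_row (msum n m' (\<lambda>i. f i * L))" "c < dim_col (msum n m' (\<lambda>i. f i * L))"
  then have rc: "r < n" "c < m'" by auto
  have "(msum n m f * L) $$ (r, c) = (\<Sum>k = 0..<m. \<Sum>i\<in>UNIV. f i $$ (r, k) * L $$ (k, c))"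
    using rc by (subst index_mult_mat_sum[OF msum_carrier L]) (auto simp: msum_index sum_distrib_right)
  also have "\<dots> = msum n m' (\<lambda>i. f i * L) $$ (r, c)"
    using rc by (subst sum.swap) (auto simp: msum_index index_mult_mat_sum[OF f L])
  finally show "(msum n m f * L) $$ (r, c) = msum n m' (\<lambda>i. f i * L) $$ (r, c)" .
qed (use L in auto)

lemma msum_cong: "(\<And>i. f i = g i) \<Longrightarrow> msum n m f = msum n m g"
  by (auto simp: msum_def)

text \<open>The point stands in the left tensor factor, the coefficient in the right one. So a block
  tuple gives a block matrix, and a direct sum of copies of a point gives a block diagonal one.
  Rectangular points occur as the off-diagonal blocks of square ones.\<close>

definition pev :: "nat \<Rightarrow> nat \<Rightarrow> nat \<Rightarrow> ('i :: finite \<Rightarrow> 'a :: comm_ring_1 mat) \<Rightarrow> ('i \<Rightarrow> 'a mat) \<Rightarrow> 'a mat" where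
  "pev n m e Q Z = msum (n * e) (m * e) (\<lambda>i. kron (Z i) (Q i))"

lemma pev_carrier [simp, intro]: "pev n m e Q Z \<in> carrier_mat (n * e) (m * e)"
  by (auto simp: pev_def)

lemma pev_dim [simp]: "dim_row (pev n m e Q Z) = n * e" "dim_col (pev n m e Q Z) = m * e"
  by (auto simp: pev_def)

text \<open>Both symmetries of a pencil come from the mixed product rule: A and C act on the point,
  B and D on the coefficients. The two special cases below are compression of the pencil and
  conjugation of the tuple.\<close>

lemma pev_sandwich:
  assumes A: "A \<in> carrier_mat n' n" and C: "C \<in> carrier_mat m m'"
    and B: "B \<in> carrier_mat e' e" and D: "D \<in> carrier_mat e e'"
    and Z: "\<And>i. Z i \<in> carrier_mat n m" and Q: "\<And>i. Q i \<in> carrier_mat e e"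
  shows "kron A B * pev n m e Q Z * kron C D = pev n' m' e' (\<lambda>i. B * Q i * D) (\<lambda>i. A * Z i * C)"
proof -
  have AZ: "A * Z i \<in> carrier_mat n' m" "B * Q i \<in> carrier_mat e' e" for i using A Z B Q by auto
  have "kron A B * pev n m e Q Z = msum (n' * e') (m * e) (\<lambda>i. kron (A * Z i) (B * Q i))"
    unfolding pev_def using A B Z Q
    by (subst mult_msum[where n' = "n' * e'"]) (auto simp: kron_mult[OF A Z B Q])
  then show ?thesis
    unfolding pev_def using AZ C D
    by (simp add: msum_mult[where m' = "m' * e'"] kron_mult[OF AZ(1) C AZ(2) D])
qed

lemma pev_one_sandwich:
  assumes B: "B \<in> carrier_mat e' e" and D: "D \<in> carrier_mat e e'"
    and Z: "\<And>i. Z i \<in> carrier_mat n m" and Q: "\<And>i. Q i \<in> carrier_mat e e"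
  shows "kron (1\<^sub>m n) B * pev n m e Q Z * kron (1\<^sub>m m) D = pev n m e' (\<lambda>i. B * Q i * D) Z"
  using pev_sandwich[OF one_carrier_mat one_carrier_mat B D Z Q]
  by (simp add: left_mult_one_mat[OF Z] right_mult_one_mat[OF Z])

lemma pev_conj:
  assumes A: "A \<in> carrier_mat n' n" and C: "C \<in> carrier_mat m m'"
    and Z: "\<And>i. Z i \<in> carrier_mat n m" and Q: "\<And>i. Q i \<in> carrier_mat e e"
  shows "kron A (1\<^sub>m e) * pev n m e Q Z * kron C (1\<^sub>m e) = pev n' m' e Q (\<lambda>i. A * Z i * C)"
  using pev_sandwich[OF A C one_carrier_mat one_carrier_mat Z Q] Q
  by (simp add: left_mult_one_mat[OF Q] right_mult_one_mat[OF Q])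

lemma pev_add:
  assumes Z: "\<And>i. Z i \<in> carrier_mat n m" "\<And>i. W i \<in> carrier_mat n m" and Q: "\<And>i. Q i \<in> carrier_mat e e"
  shows "pev n m e Q (\<lambda>i. Z i + W i) = pev n m e Q Z + pev n m e Q W"
proof -
  have *: "kron (Z i + W i) (Q i) = kron (Z i) (Q i) + kron (W i) (Q i)" for i
    by (rule kron_add_left[OF Z Q])
  have **: "dim_row (kron (W i) (Q i)) = n * e" "dim_col (kron (W i) (Q i)) = m * e" for i
    using Z[of i] Q[of i] by auto
  show ?thesis
    by (intro eq_matI) (auto simp: pev_def msum_index * ** sum.distrib simp del: kron_dim)
qed

lemma pev_smult:
  assumes Z: "\<And>i. Z i \<in> carrier_mat n m" and Q: "\<And>i. Q i \<in> carrier_mat e e"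
  shows "pev n m e Q (\<lambda>i. c \<cdot>\<^sub>m Z i) = c \<cdot>\<^sub>m pev n m e Q Z"
proof -
  have **: "dim_row (kron (Z i) (Q i)) = n * e" "dim_col (kron (Z i) (Q i)) = m * e" for i
    using Z[of i] Q[of i] by auto
  show ?thesis
    by (intro eq_matI) (auto simp: pev_def msum_index kron_smult_left ** sum_distrib_left simp del: kron_dim)
qed

lemma pev_zero:
  assumes Q: "\<And>i. Q i \<in> carrier_mat e e"
  shows "pev n m e Q (\<lambda>i. 0\<^sub>m n m) = 0\<^sub>m (n * e) (m * e)"
proof -
  have "kron (0\<^sub>m n m) (Q i) = 0\<^sub>m (n * e) (m * e)" for i
    using Q[of i] by (intro eq_matI) (auto simp: kron_index[of _ n m _ e e] div_less_of_less_mult)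
  then show ?thesis by (intro eq_matI) (auto simp: pev_def msum_index)
qed

lemma pev_transpose:
  assumes Z: "\<And>i. Z i \<in> carrier_mat n m" and Q: "\<And>i. Q i \<in> carrier_mat e e"
  shows "(pev n m e Q Z)\<^sup>T = pev m n e (\<lambda>i. (Q i)\<^sup>T) (\<lambda>i. (Z i)\<^sup>T)"
proof -
  have **: "dim_row (kron (Z i) (Q i)) = n * e" "dim_col (kron (Z i) (Q i)) = m * e" for i
    using Z[of i] Q[of i] by auto
  show ?thesis
    by (intro eq_matI) (auto simp: pev_def msum_index kron_transpose[symmetric] ** simp del: kron_dim)
qed

lemma pev_inflate:
  assumes Z: "\<And>i. Z i \<in> carrier_mat n m" and Q: "\<And>i. Q i \<in> carrier_mat e e"
  shows "pev (k * n) (k * m) e Q (\<lambda>i. kron (1\<^sub>m k) (Z i)) = kron (1\<^sub>m k) (pev n m e Q Z)"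
proof (rule eq_matI)
  fix r c assume "r < dim_row (kron (1\<^sub>m k) (pev n m e Q Z))" "c < dim_col (kron (1\<^sub>m k) (pev n m e Q Z))"
  then have rc: "r < k * n * e" "c < k * m * e" "r < k * (n * e)" "c < k * (m * e)" by (auto simp: mult.assoc)
  have "pev (k * n) (k * m) e Q (\<lambda>i. kron (1\<^sub>m k) (Z i)) $$ (r, c) =
     (\<Sum>i\<in>UNIV. kron (1\<^sub>m k) (kron (Z i) (Q i)) $$ (r, c))"
    using rc by (simp add: pev_def msum_index kron_assoc)
  also have "\<dots> = (\<Sum>i\<in>UNIV. (1\<^sub>m k) $$ (r div (n * e), c div (m * e)) *
      kron (Z i) (Q i) $$ (r mod (n * e), c mod (m * e)))"
    using rc by (subst kron_index[OF one_carrier_mat kron_carrier[OF Z Q]]) auto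
  also have "\<dots> = kron (1\<^sub>m k) (pev n m e Q Z) $$ (r, c)"
    using rc by (subst kron_index[OF one_carrier_mat pev_carrier])
      (auto simp: pev_def msum_index sum_distrib_left mod_less_of_less_mult)
  finally show "pev (k * n) (k * m) e Q (\<lambda>i. kron (1\<^sub>m k) (Z i)) $$ (r, c) =
     kron (1\<^sub>m k) (pev n m e Q Z) $$ (r, c)" .
qed (auto simp: mult.assoc)

lemma pev_map:
  assumes h: "comm_ring_hom h" and Z: "\<And>i. Z i \<in> carrier_mat n m" and Q: "\<And>i. Q i \<in> carrier_mat e e"
  shows "map_mat h (pev n m e Q Z) = pev n m e (\<lambda>i. map_mat h (Q i)) (\<lambda>i. map_mat h (Z i))"
proof -
  interpret comm_ring_hom h by fact
  have **: "dim_row (kron (Z i) (Q i)) = n * e" "dim_col (kron (Z i) (Q i)) = m * e" for i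
    using Z[of i] Q[of i] by auto
  show ?thesis
    by (intro eq_matI) (auto simp: pev_def msum_index kron_map[OF h, symmetric] hom_sum ** simp del: kron_dim)
qed

lemma pev_four_block:
  assumes A: "\<And>i. A i \<in> carrier_mat n1 m1" "\<And>i. B i \<in> carrier_mat n1 m2" "\<And>i. C i \<in> carrier_mat n2 m1"
    "\<And>i. D i \<in> carrier_mat n2 m2" and Q: "\<And>i. Q i \<in> carrier_mat e e"
  shows "pev (n1 + n2) (m1 + m2) e Q (\<lambda>i. four_block_mat (A i) (B i) (C i) (D i)) =
    four_block_mat (pev n1 m1 e Q A) (pev n1 m2 e Q B) (pev n2 m1 e Q C) (pev n2 m2 e Q D)"
proof -
  note * = kron_carrier[OF A(1) Q] kron_carrier[OF A(2) Q] kron_carrier[OF A(3) Q] kron_carrier[OF A(4) Q]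
  have **: "dim_row (kron (A i) (Q i)) = n1 * e" "dim_col (kron (A i) (Q i)) = m1 * e"
    "dim_row (kron (D i) (Q i)) = n2 * e" "dim_col (kron (D i) (Q i)) = m2 * e" for i
    using A(1)[of i] A(4)[of i] Q[of i] by auto
  show ?thesis
    by (intro eq_matI) (auto simp: pev_def msum_index kron_four_block[OF A Q] ** algebra_simps simp del: kron_dim)
qed

section \<open>Limits along lines\<close>

text \<open>Boundedness is asked only near the limit, since the pencil may be singular at other
  parameters of a line. The size, in contrast, is prescribed at every parameter.\<close>

definition bounded_entries :: "nat \<Rightarrow> nat \<Rightarrow> 'b filter \<Rightarrow> ('b \<Rightarrow> complex mat) \<Rightarrow> bool" where
  "bounded_entries n m F A \<longleftrightarrow>
     (\<forall>t. A t \<in> carrier_mat n m) \<and> (\<forall>i<n. \<forall>j<m. (\<lambda>t. A t $$ (i, j)) \<in> O[F](\<lambda>_. 1))"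

definition entries_tendsto :: "nat \<Rightarrow> nat \<Rightarrow> 'b filter \<Rightarrow> ('b \<Rightarrow> complex mat) \<Rightarrow> complex mat \<Rightarrow> bool" where
  "entries_tendsto n m F A L \<longleftrightarrow> (\<forall>t. A t \<in> carrier_mat n m) \<and> L \<in> carrier_mat n m \<and>
     (\<forall>i<n. \<forall>j<m. ((\<lambda>t. A t $$ (i, j)) \<longlongrightarrow> L $$ (i, j)) F)"

lemma entries_tendsto_imp_bounded:
  "entries_tendsto n m F A L \<Longrightarrow> F \<noteq> bot \<Longrightarrow> bounded_entries n m F A"
  unfolding entries_tendsto_def bounded_entries_def
proof (intro conjI allI impI; elim conjE)
  fix i j assume "F \<noteq> bot" "i < n" "j < m" "\<forall>i<n. \<forall>j<m. ((\<lambda>t. A t $$ (i, j)) \<longlongrightarrow> L $$ (i, j)) F"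
  then show "(\<lambda>t. A t $$ (i, j)) \<in> O[F](\<lambda>_. 1)"
    by (intro bigoI_tendsto[where c = "L $$ (i, j)"]) auto
qed auto

lemma bounded_entries_mult:
  assumes "bounded_entries n m F A" "bounded_entries m p F B"
  shows "bounded_entries n p F (\<lambda>t. A t * B t)"
proof -
  have c: "A t \<in> carrier_mat n m" "B t \<in> carrier_mat m p" for t
    using assms by (auto simp: bounded_entries_def)
  have "(\<lambda>t. \<Sum>k = 0..<m. A t $$ (i, k) * B t $$ (k, j)) \<in> O[F](\<lambda>_. 1)" if "i < n" "j < p" for i j
  proof (rule big_sum_in_bigo)
    fix k assume "k \<in> {0..<m}"
    then have "(\<lambda>t. A t $$ (i, k) * B t $$ (k, j)) \<in> O[F](\<lambda>_. 1 * 1)"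
      using assms that by (intro landau_o.big.mult) (auto simp: bounded_entries_def)
    then show "(\<lambda>t. A t $$ (i, k) * B t $$ (k, j)) \<in> O[F](\<lambda>_. 1)" by simp
  qed
  then show ?thesis
    unfolding bounded_entries_def using c mult_carrier_mat[OF c] by (auto simp: index_mult_mat_sum[OF c])
qed

lemma bounded_entries_add:
  assumes "bounded_entries n m F A" "bounded_entries n m F B"
  shows "bounded_entries n m F (\<lambda>t. A t + B t)"
proof -
  have c: "A t \<in> carrier_mat n m" "B t \<in> carrier_mat n m" for t
    using assms by (auto simp: bounded_entries_def)
  have "dim_row (B t) = n" "dim_col (B t) = m" for t using c[of t] by auto
  then show ?thesis
    using assms unfolding bounded_entries_def by (auto intro!: sum_in_bigo)
qed

lemma bounded_entries_const: "A \<in> carrier_mat n m \<Longrightarrow> bounded_entries n m F (\<lambda>_. A)"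
  by (auto simp: bounded_entries_def)

lemma bounded_entries_smult:
  assumes "bounded_entries n m F A"
  shows "bounded_entries n m F (\<lambda>t. c \<cdot>\<^sub>m A t)"
proof -
  have "dim_row (A t) = n" "dim_col (A t) = m" for t using assms by (auto simp: bounded_entries_def)
  then show ?thesis using assms by (auto simp: bounded_entries_def)
qed

lemma bounded_entries_cong:
  assumes "bounded_entries n m F A" "\<And>t. B t \<in> carrier_mat n m" "\<forall>\<^sub>F t in F. A t = B t"
  shows "bounded_entries n m F B"
proof -
  have "(\<lambda>t. B t $$ (i, j)) \<in> O[F](\<lambda>_. 1)" if "i < n" "j < m" for i j
  proof -
    have "\<forall>\<^sub>F t in F. A t $$ (i, j) = B t $$ (i, j)"
      using assms(3) by eventually_elim simp
    then show ?thesis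
      using assms(1) that landau_o.big.in_cong[of "\<lambda>t. A t $$ (i, j)" "\<lambda>t. B t $$ (i, j)" F "\<lambda>_. 1"]
      by (auto simp: bounded_entries_def)
  qed
  with assms(2) show ?thesis by (auto simp: bounded_entries_def)
qed

lemma bounded_entries_transpose:
  assumes "bounded_entries n m F A"
  shows "bounded_entries m n F (\<lambda>t. (A t)\<^sup>T)"
proof -
  have "dim_row (A t) = n" "dim_col (A t) = m" for t using assms by (auto simp: bounded_entries_def)
  then show ?thesis using assms by (auto simp: bounded_entries_def)
qed

lemma bounded_entries_msum:
  assumes "\<And>i. bounded_entries n m F (\<lambda>t. A t i)"
  shows "bounded_entries n m F (\<lambda>t. msum n m (A t))"
  using assms by (auto simp: bounded_entries_def msum_index intro!: big_sum_in_bigo)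

lemma entries_tendsto_mult:
  assumes "entries_tendsto n m F A K" "entries_tendsto m p F B L"
  shows "entries_tendsto n p F (\<lambda>t. A t * B t) (K * L)"
proof -
  have c: "A t \<in> carrier_mat n m" "B t \<in> carrier_mat m p" "K \<in> carrier_mat n m" "L \<in> carrier_mat m p" for t
    using assms by (auto simp: entries_tendsto_def)
  show ?thesis
    unfolding entries_tendsto_def
    using assms mult_carrier_mat[OF c(1,2)] mult_carrier_mat[OF c(3,4)]
    by (auto simp: index_mult_mat_sum[OF c(1,2)] index_mult_mat_sum[OF c(3,4)] entries_tendsto_def
        intro!: tendsto_sum tendsto_mult)
qed

lemma entries_tendsto_const: "A \<in> carrier_mat n m \<Longrightarrow> entries_tendsto n m F (\<lambda>_. A) A"
  by (auto simp: entries_tendsto_def)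

lemma tendsto_det:
  assumes "entries_tendsto n n F A L"
  shows "((\<lambda>t. det (A t)) \<longlongrightarrow> det L) F"
proof -
  have c: "A t \<in> carrier_mat n n" "L \<in> carrier_mat n n" for t
    using assms by (auto simp: entries_tendsto_def)
  have p: "p i < n" if "p permutes {0..<n}" "i < n" for p i
    using that permutes_in_image[of p "{0..<n}" i] by auto
  show ?thesis unfolding det_def'[OF c(1)] det_def'[OF c(2)]
    using assms p by (auto simp: entries_tendsto_def intro!: tendsto_sum tendsto_mult tendsto_prod)
qed

text \<open>By the Leibniz formula the determinant is a finite sum of products of bounded
  entries.\<close>

lemma bounded_det:
  assumes "bounded_entries n n F A"
  shows "(\<lambda>t. det (A t)) \<in> O[F](\<lambda>_. 1)"
proof -
  have c: "A t \<in> carrier_mat n n" for t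
    using assms by (auto simp: bounded_entries_def)
  have p: "p i < n" if "p permutes {0..<n}" "i < n" for p i
    using that permutes_in_image[of p "{0..<n}" i] by auto
  have "(\<lambda>t. \<Prod>i = 0..<n. A t $$ (i, p i)) \<in> O[F](\<lambda>t. \<Prod>i = 0..<n. 1)" if "p permutes {0..<n}" for p
    by (rule landau_o.big_prod) (use assms p that in \<open>auto simp: bounded_entries_def\<close>)
  then show ?thesis unfolding det_def'[OF c]
    by (auto intro!: big_sum_in_bigo simp: sign_def)
qed

text \<open>The entries of the adjugate are determinants of minors up to sign, so continuity of the
  determinant suffices; the denominator has a nonzero limit.\<close>

lemma entries_tendsto_minv:
  assumes A: "entries_tendsto n n F A L" and d: "det L \<noteq> 0"
  shows "entries_tendsto n n F (\<lambda>t. minv (A t)) (minv L)"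
proof -
  have c: "A t \<in> carrier_mat n n" "L \<in> carrier_mat n n" for t
    using assms by (auto simp: entries_tendsto_def)
  have dims: "dim_row (A t) = n" "dim_col (A t) = n" "dim_row L = n" "dim_col L = n" for t
    using c(1)[of t] c(2) by auto
  have "entries_tendsto (n - 1) (n - 1) F (\<lambda>t. mat_delete (A t) i j) (mat_delete L i j)"
    if "i < n" "j < n" for i j
    using A c that unfolding entries_tendsto_def mat_delete_def dims by auto
  then have "((\<lambda>t. minv (A t) $$ (i, j)) \<longlongrightarrow> minv L $$ (i, j)) F" if "i < n" "j < n" for i j
    using that d tendsto_det[OF A]
    by (auto simp: minv_def adj_mat_def cofactor_def dims
        intro!: tendsto_mult tendsto_divide tendsto_det)
  then show ?thesis using c by (auto simp: entries_tendsto_def)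
qed

lemma entries_tendsto_unique:
  assumes "entries_tendsto n m F A L" "entries_tendsto n m F B K" "\<forall>\<^sub>F t in F. A t = B t" "F \<noteq> bot"
  shows "L = K"
proof (rule eq_matI)
  fix i j assume "i < dim_row K" "j < dim_col K"
  then have ij: "i < n" "j < m" using assms by (auto simp: entries_tendsto_def)
  have lim: "((\<lambda>t. A t $$ (i, j)) \<longlongrightarrow> L $$ (i, j)) F"
    using assms(1) ij by (simp add: entries_tendsto_def)
  have "\<forall>\<^sub>F t in F. A t $$ (i, j) = B t $$ (i, j)" using assms(3) by eventually_elim simp
  from Lim_transform_eventually[OF lim this] have "((\<lambda>t. B t $$ (i, j)) \<longlongrightarrow> L $$ (i, j)) F" .
  then show "L $$ (i, j) = K $$ (i, j)"
    using assms(2,4) ij tendsto_unique[of F "\<lambda>t. B t $$ (i, j)"] by (auto simp: entries_tendsto_def)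
qed (use assms in \<open>auto simp: entries_tendsto_def\<close>)

text \<open>The determinant is a polynomial in t. Being nonzero at a single parameter s, it has
  finitely many roots, so it is nonzero near every a, except perhaps at a itself. The parameters s
  and a are unrelated.\<close>

lemma eventually_det_line:
  fixes A B :: "complex mat"
  assumes A: "A \<in> carrier_mat n n" and B: "B \<in> carrier_mat n n" and d: "det (A + s \<cdot>\<^sub>m B) \<noteq> 0"
  shows "\<forall>\<^sub>F t in at a. det (A + t \<cdot>\<^sub>m B) \<noteq> 0"
proof -
  define M where "M = mat n n (\<lambda>ij. [:A $$ ij, B $$ ij:])"
  have *: "poly (det M) t = det (A + t \<cdot>\<^sub>m B)" for t
  proof -
    have h: "comm_ring_hom (\<lambda>p. poly p t)" by unfold_locales auto
    have "map_mat (\<lambda>p. poly p t) M = A + t \<cdot>\<^sub>m B"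
      using A B by (auto simp: M_def intro!: eq_matI)
    then show ?thesis using comm_ring_hom.hom_det[OF h, of M] by simp
  qed
  have "det M \<noteq> 0" using d * [of s] by auto
  then have "finite {t. poly (det M) t = 0}" by (rule poly_roots_finite)
  \<comment> \<open>The point a is removed from the set of roots to obtain a neighbourhood of a; the
    punctured filter excludes it again afterwards.\<close>
  then have "open (- ({t. poly (det M) t = 0} - {a}))"
    by (intro open_Compl finite_imp_closed) auto
  then have "\<forall>\<^sub>F t in at a. t \<notin> {t. poly (det M) t = 0} - {a}"
    by (intro eventually_at_in_open' [of "- ({t. poly (det M) t = 0} - {a})" a, THEN eventually_mono]) auto
  then have "\<forall>\<^sub>F t in at a. poly (det M) t \<noteq> 0"
    using eventually_neq_at_within[of a a UNIV] by eventually_elim auto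
  then show ?thesis by (simp add: *)
qed

section \<open>Affine pencils, their domains and their values\<close>

definition tuple :: "nat \<Rightarrow> ('d \<Rightarrow> 'a mat) \<Rightarrow> bool" where
  "tuple n X \<longleftrightarrow> (\<forall>i. X i \<in> carrier_mat n n)"

lemma tupleD [simp]: "tuple n X \<Longrightarrow> X i \<in> carrier_mat n n"
  by (auto simp: tuple_def)

lemma tuple_dim [simp]: "tuple n X \<Longrightarrow> dim_row (X i) = n" "tuple n X \<Longrightarrow> dim_col (X i) = n"
  using carrier_matD[OF tupleD, of n X i] by simp_all

text \<open>The index \<open>None\<close> carries the constant coefficient and is evaluated at the
  identity. An affine pencil thus becomes a linear one with one more variable, and the laws of
  \<open>pev\<close> apply.\<close>

definition aff_ext :: "nat \<Rightarrow> ('d \<Rightarrow> 'a :: comm_ring_1 mat) \<Rightarrow> 'd option \<Rightarrow> 'a mat" where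
  "aff_ext n X i = (case i of None \<Rightarrow> 1\<^sub>m n | Some k \<Rightarrow> X k)"

text \<open>The linear counterpart of \<open>aff_ext\<close>: a direction of movement, or an
  off-diagonal block of a tuple, has no constant component.\<close>

definition lin_ext :: "nat \<Rightarrow> nat \<Rightarrow> ('d \<Rightarrow> 'a :: comm_ring_1 mat) \<Rightarrow> 'd option \<Rightarrow> 'a mat" where
  "lin_ext n m X i = (case i of None \<Rightarrow> 0\<^sub>m n m | Some k \<Rightarrow> X k)"

lemma aff_ext_carrier [simp]: "tuple n X \<Longrightarrow> aff_ext n X i \<in> carrier_mat n n"
  by (auto simp: aff_ext_def split: option.splits)

lemma lin_ext_carrier [simp]: "(\<And>i. X i \<in> carrier_mat n m) \<Longrightarrow> lin_ext n m X i \<in> carrier_mat n m"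
  by (auto simp: lin_ext_def split: option.splits)

definition pencil :: "nat \<Rightarrow> nat \<Rightarrow> ('d :: finite option \<Rightarrow> 'a :: comm_ring_1 mat) \<Rightarrow> ('d \<Rightarrow> 'a mat) \<Rightarrow> 'a mat" where
  "pencil n e Q X = pev n n e Q (aff_ext n X)"

lemma pencil_carrier [simp, intro]: "pencil n e Q X \<in> carrier_mat (n * e) (n * e)"
  by (auto simp: pencil_def)

lemma pencil_dim [simp]: "dim_row (pencil n e Q X) = n * e" "dim_col (pencil n e Q X) = n * e"
  by (auto simp: pencil_def)

definition pdom :: "nat \<Rightarrow> nat \<Rightarrow> ('d :: finite option \<Rightarrow> complex mat) \<Rightarrow> ('d \<Rightarrow> complex mat) set" where
  "pdom n e Q = {X. tuple n X \<and> det (pencil n e Q X) \<noteq> 0}"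

definition pval :: "nat \<Rightarrow> nat \<Rightarrow> complex mat \<Rightarrow> ('d :: finite option \<Rightarrow> complex mat) \<Rightarrow> complex mat \<Rightarrow>
    ('d \<Rightarrow> complex mat) \<Rightarrow> complex mat" where
  "pval n e u Q v X = kron (1\<^sub>m n) u * minv (pencil n e Q X) * kron (1\<^sub>m n) v"

lemma pencil_line:
  assumes "tuple n X" "tuple n Z" "tuple e Q"
  shows "pencil n e Q (\<lambda>i. X i + t \<cdot>\<^sub>m Z i) = pencil n e Q X + t \<cdot>\<^sub>m pev n n e Q (lin_ext n n Z)"
proof -
  have "aff_ext n (\<lambda>i. X i + t \<cdot>\<^sub>m Z i) = (\<lambda>i. aff_ext n X i + t \<cdot>\<^sub>m lin_ext n n Z i)"
    by (auto simp: aff_ext_def lin_ext_def fun_eq_iff split: option.splits intro!: eq_matI)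
  then show ?thesis
    using assms by (simp add: pencil_def pev_add[of _ n n "\<lambda>i. t \<cdot>\<^sub>m lin_ext n n Z i"] pev_smult)
qed

lemma tuple_line: "tuple n X \<Longrightarrow> tuple n Z \<Longrightarrow> tuple n (\<lambda>i. X i + t \<cdot>\<^sub>m Z i)"
  by (auto simp: tuple_def)

lemma eventually_pdom_line:
  assumes X: "tuple n X" and Z: "tuple n Z" and Q: "tuple e Q"
    and s: "(\<lambda>i. X i + s \<cdot>\<^sub>m Z i) \<in> pdom n e Q"
  shows "\<forall>\<^sub>F t in at a. (\<lambda>i. X i + t \<cdot>\<^sub>m Z i) \<in> pdom n e Q"
proof -
  have "\<forall>\<^sub>F t in at a. det (pencil n e Q X + t \<cdot>\<^sub>m pev n n e Q (lin_ext n n Z)) \<noteq> 0"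
    by (rule eventually_det_line[where s = s and n = "n * e"])
      (use s in \<open>auto simp: pdom_def pencil_line[OF X Z Q]\<close>)
  then show ?thesis
    by eventually_elim (simp add: pdom_def pencil_line[OF X Z Q] tuple_line[OF X Z])
qed

lemma entries_tendsto_line:
  assumes A: "A \<in> carrier_mat n m" "B \<in> carrier_mat n m"
  shows "entries_tendsto n m (at 0) (\<lambda>t. A + t \<cdot>\<^sub>m B) A"
proof -
  have "((\<lambda>t. A $$ (i, j) + t * B $$ (i, j)) \<longlongrightarrow> A $$ (i, j) + 0 * B $$ (i, j)) (at 0)" for i j
    by (intro tendsto_intros)
  then show ?thesis using A by (auto simp: entries_tendsto_def)
qed

lemma pencil_tendsto:
  assumes "tuple n X" "tuple n Z" "tuple e Q"
  shows "entries_tendsto (n * e) (n * e) (at 0) (\<lambda>t. pencil n e Q (\<lambda>i. X i + t \<cdot>\<^sub>m Z i)) (pencil n e Q X)"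
  unfolding pencil_line[OF assms] by (rule entries_tendsto_line) auto

lemma pval_tendsto:
  assumes X: "X \<in> pdom n e Q" and Z: "tuple n Z" and Q: "tuple e Q"
    and u: "u \<in> carrier_mat a e" and v: "v \<in> carrier_mat e b"
  shows "entries_tendsto (n * a) (n * b) (at 0) (\<lambda>t. pval n e u Q v (\<lambda>i. X i + t \<cdot>\<^sub>m Z i)) (pval n e u Q v X)"
proof -
  have X': "tuple n X" and d: "det (pencil n e Q X) \<noteq> 0" using X by (auto simp: pdom_def)
  show ?thesis unfolding pval_def
    using entries_tendsto_minv[OF pencil_tendsto[OF X' Z Q] d] u v
    by (auto intro!: entries_tendsto_mult[where m = "n * e"] entries_tendsto_const)
qed

text \<open>The direct sum of m copies of a point. Points of different sizes are amplified to a
  common size before they are joined by a line; \<open>pval_inflate\<close> and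
  \<open>kron_one_inj\<close> lead back to the original size.\<close>

definition inflate :: "nat \<Rightarrow> ('d \<Rightarrow> 'a :: comm_ring_1 mat) \<Rightarrow> 'd \<Rightarrow> 'a mat" where
  "inflate m X = (\<lambda>i. kron (1\<^sub>m m) (X i))"

lemma tuple_inflate [simp]: "tuple n X \<Longrightarrow> tuple (m * n) (inflate m X)"
  by (auto simp: tuple_def inflate_def)

lemma pencil_inflate:
  assumes "tuple n X" "tuple e Q"
  shows "pencil (m * n) e Q (inflate m X) = kron (1\<^sub>m m) (pencil n e Q X)"
proof -
  have "aff_ext (m * n) (inflate m X) = (\<lambda>i. kron (1\<^sub>m m) (aff_ext n X i))"
    by (auto simp: aff_ext_def inflate_def fun_eq_iff split: option.splits)
  then show ?thesis using assms by (simp add: pencil_def pev_inflate)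
qed

lemma inflate_pdom: "X \<in> pdom n e Q \<Longrightarrow> tuple e Q \<Longrightarrow> inflate m X \<in> pdom (m * n) e Q"
  using kron_one_inverse(1)[OF pencil_carrier, of n e Q X m] by (auto simp: pdom_def pencil_inflate)

lemma pval_inflate:
  assumes X: "X \<in> pdom n e Q" and Q: "tuple e Q"
    and u: "u \<in> carrier_mat a e" and v: "v \<in> carrier_mat e b"
  shows "pval (m * n) e u Q v (inflate m X) = kron (1\<^sub>m m) (pval n e u Q v X)"
proof -
  have X': "tuple n X" and d: "det (pencil n e Q X) \<noteq> 0" using X by (auto simp: pdom_def)
  have k: "kron (1\<^sub>m (m * n)) w = kron (1\<^sub>m m) (kron (1\<^sub>m n) w)" for w :: "complex mat"
    by (metis kron_assoc kron_one)
  have c: "kron (1\<^sub>m n) u \<in> carrier_mat (n * a) (n * e)" "kron (1\<^sub>m n) v \<in> carrier_mat (n * e) (n * b)"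
    "minv (pencil n e Q X) \<in> carrier_mat (n * e) (n * e)"
    using u v by auto
  show ?thesis
    unfolding pval_def k pencil_inflate[OF X' Q] kron_one_inverse(2)[OF pencil_carrier d]
    using kron_one_mult[OF c(1) c(3), of m] kron_one_mult[OF mult_carrier_mat[OF c(1,3)] c(2), of m]
    by simp
qed

lemma kron_one_inj:
  assumes "A \<in> carrier_mat n m" "B \<in> carrier_mat n m" "k \<ge> 1" "kron (1\<^sub>m k) A = kron (1\<^sub>m k) B"
  shows "A = B"
proof (rule eq_matI)
  fix i j assume "i < dim_row B" "j < dim_col B"
  then have ij: "i < n" "j < m" using assms by auto
  moreover have "n \<le> k * n" "m \<le> k * m" using assms(3) by auto
  ultimately have "i < k * n" "j < k * m" by linarith+
  then show "A $$ (i, j) = B $$ (i, j)"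
    using assms ij kron_index[of "1\<^sub>m k :: 'a mat" k k A n m i j] kron_index[of "1\<^sub>m k :: 'a mat" k k B n m i j]
    by auto
qed (use assms in auto)

definition pnondeg :: "nat \<Rightarrow> ('d :: finite option \<Rightarrow> complex mat) \<Rightarrow> bool" where
  "pnondeg e Q \<longleftrightarrow> (\<exists>n\<ge>1. pdom n e Q \<noteq> {})"

definition pequiv where
  "pequiv e u Q v e' u' Q' v' \<longleftrightarrow>
     (\<forall>n\<ge>1. \<forall>X\<in>pdom n e Q \<inter> pdom n e' Q'. pval n e u Q v X = pval n e' u' Q' v' X)"

text \<open>Equality where a further nondegenerate pencil T is invertible extends to the whole
  common domain. X and a point of the domain of T, both amplified, are joined by a line. Near X the
  punctured line lies in all three domains, and both values are continuous at X.\<close>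

lemma pequivI_generic:
  assumes Q: "tuple e Q" "u \<in> carrier_mat 1 e" "v \<in> carrier_mat e 1"
    and Q': "tuple e' Q'" "u' \<in> carrier_mat 1 e'" "v' \<in> carrier_mat e' 1"
    and T: "tuple f T" "pnondeg f T"
    and eq: "\<And>n X. n \<ge> 1 \<Longrightarrow> X \<in> pdom n e Q \<Longrightarrow> X \<in> pdom n e' Q' \<Longrightarrow> X \<in> pdom n f T \<Longrightarrow>
       pval n e u Q v X = pval n e' u' Q' v' X"
  shows "pequiv e u Q v e' u' Q' v'"
  unfolding pequiv_def
proof (intro allI impI ballI)
  fix n X assume n: "n \<ge> (1 :: nat)" and "X \<in> pdom n e Q \<inter> pdom n e' Q'"
  then have X: "X \<in> pdom n e Q" "X \<in> pdom n e' Q'" and tX: "tuple n X" by (auto simp: pdom_def)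
  obtain m Y where m: "m \<ge> 1" and Y: "Y \<in> pdom m f T" using T(2) by (auto simp: pnondeg_def)
  then have tY: "tuple m Y" by (auto simp: pdom_def)
  define X' where "X' = inflate m X"
  define Y' where "Y' = inflate n Y"
  have X': "X' \<in> pdom (m * n) e Q" "X' \<in> pdom (m * n) e' Q'"
    and Y': "Y' \<in> pdom (m * n) f T" and t: "tuple (m * n) X'" "tuple (m * n) Y'"
    using inflate_pdom[OF X(1) Q(1)] inflate_pdom[OF X(2) Q'(1)] inflate_pdom[OF Y T(1), of n]
      tuple_inflate[OF tX] tuple_inflate[OF tY, of n]
    by (auto simp: X'_def Y'_def mult.commute)
  define Z where "Z = (\<lambda>i. Y' i - X' i)"
  have Z: "tuple (m * n) Z" using t by (auto simp: Z_def tuple_def)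
  have "(\<lambda>i. X' i + 1 \<cdot>\<^sub>m Z i) = Y'" "(\<lambda>i. X' i + 0 \<cdot>\<^sub>m Z i) = X'" using t
    by (auto simp: fun_eq_iff Z_def intro!: eq_matI)
  then have "\<forall>\<^sub>F t in at 0. (\<lambda>i. X' i + t \<cdot>\<^sub>m Z i) \<in> pdom (m * n) f T"
    "\<forall>\<^sub>F t in at 0. (\<lambda>i. X' i + t \<cdot>\<^sub>m Z i) \<in> pdom (m * n) e Q"
    "\<forall>\<^sub>F t in at 0. (\<lambda>i. X' i + t \<cdot>\<^sub>m Z i) \<in> pdom (m * n) e' Q'"
    using eventually_pdom_line[OF t(1) Z T(1), of 1] eventually_pdom_line[OF t(1) Z Q(1), of 0]
      eventually_pdom_line[OF t(1) Z Q'(1), of 0] Y' X' by auto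
  then have "\<forall>\<^sub>F t in at 0. pval (m * n) e u Q v (\<lambda>i. X' i + t \<cdot>\<^sub>m Z i) =
      pval (m * n) e' u' Q' v' (\<lambda>i. X' i + t \<cdot>\<^sub>m Z i)"
    by eventually_elim (use m n in \<open>auto intro!: eq\<close>)
  then have "pval (m * n) e u Q v X' = pval (m * n) e' u' Q' v' X'"
    by (intro entries_tendsto_unique[OF pval_tendsto[OF X'(1) Z Q(1-3)] pval_tendsto[OF X'(2) Z Q'(1-3)]]) auto
  then have "kron (1\<^sub>m m) (pval n e u Q v X) = kron (1\<^sub>m m) (pval n e' u' Q' v' X)"
    unfolding X'_def pval_inflate[OF X(1) Q] pval_inflate[OF X(2) Q'] .
  then show "pval n e u Q v X = pval n e' u' Q' v' X"
    by (rule kron_one_inj[rotated 3, where n = n and m = n])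
      (use m Q Q' in \<open>auto simp: pval_def\<close>)
qed

section \<open>Generic invertibility of entries\<close>

lemma smult_mat_cancel:
  fixes A B :: "'a :: idom mat"
  assumes "A \<in> carrier_mat n m" "B \<in> carrier_mat n m" "c \<noteq> 0" "c \<cdot>\<^sub>m A = c \<cdot>\<^sub>m B"
  shows "A = B"
proof (rule eq_matI)
  fix i j assume ij: "i < dim_row B" "j < dim_col B"
  then have "c * A $$ (i, j) = c * B $$ (i, j)"
    using arg_cong[OF assms(4), of "\<lambda>M. M $$ (i, j)"] assms(1,2) by simp
  then show "A $$ (i, j) = B $$ (i, j)" using assms(3) by simp
qed (use assms in auto)

text \<open>Over an integral domain M need not have an inverse. It is cancelled by multiplying with
  its adjugate and then cancelling the scalar \<open>det M\<close>.\<close>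

lemma mult_right_cancel_det:
  fixes A B M :: "'a :: idom mat"
  assumes A: "A \<in> carrier_mat n m" and B: "B \<in> carrier_mat n m" and M: "M \<in> carrier_mat m m"
    and d: "det M \<noteq> 0" and eq: "A * M = B * M"
  shows "A = B"
proof (rule smult_mat_cancel[OF A B d])
  have *: "C * M * adj_mat M = det M \<cdot>\<^sub>m C" if "C \<in> carrier_mat n m" for C
    using that M adj_mat(1)[OF M]
    by (simp add: assoc_mult_mat[OF that M adj_mat(1)[OF M]] adj_mat(2)[OF M] mult_smult_distrib[OF that one_carrier_mat])
  show "det M \<cdot>\<^sub>m A = det M \<cdot>\<^sub>m B" using *[OF A] *[OF B] eq by simp
qed

text \<open>Conjugation preserves the determinant, so h fixes \<open>det M\<close>. Hence both
  sides, multiplied by \<open>map_mat h M\<close>, give \<open>det M\<close> times the identity, and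
  this factor cancels. The adjugate replaces the inverse in order to stay inside a polynomial
  ring.\<close>

lemma adj_mat_hom_conj:
  fixes M :: "'a :: idom mat"
  assumes h: "comm_ring_hom h" and M: "M \<in> carrier_mat n n" and d: "det M \<noteq> 0"
    and P: "P \<in> carrier_mat n n" "P' \<in> carrier_mat n n" "P * P' = 1\<^sub>m n" "P' * P = 1\<^sub>m n"
    and hM: "map_mat h M = P * M * P'"
  shows "map_mat h (adj_mat M) = P * adj_mat M * P'"
proof (rule mult_right_cancel_det)
  interpret comm_ring_hom h by fact
  note a = adj_mat[OF M]
  have dP: "det P * det P' = 1" using det_mult[OF P(1,2)] P(3) by simp
  have "det (P * M * P') = det M * (det P * det P')"
    using P(1,2) M by (simp add: det_mult[of _ n])
  then have hd: "h (det M) = det M" using hM dP by (metis hom_det mult.right_neutral)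
  show "det (map_mat h M) \<noteq> 0" using hd d by simp
  have "map_mat h (adj_mat M) * map_mat h M = map_mat h (adj_mat M * M)"
    using mat_hom_mult[OF a(1) M] by simp
  also have "\<dots> = det M \<cdot>\<^sub>m 1\<^sub>m n"
    unfolding a(3) using hd by (auto intro!: eq_matI)
  finally have 1: "map_mat h (adj_mat M) * map_mat h M = det M \<cdot>\<^sub>m 1\<^sub>m n" .
  have "P * adj_mat M * P' * (P * M * P') = P * (adj_mat M * ((P' * P) * (M * P')))"
    using P(1,2) M a(1) by (simp add: mat_mult_assoc)
  also have "\<dots> = P * ((adj_mat M * M) * P')" using P(1,2) M a(1)
    by (simp add: P(4) mat_mult_assoc)
  also have "\<dots> = det M \<cdot>\<^sub>m 1\<^sub>m n"
    unfolding a(3) using P by (simp add: mult_smult_assoc_mat[OF one_carrier_mat P(2)] mult_smult_distrib[OF P(1,2)])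
  finally show "map_mat h (adj_mat M) * map_mat h M = P * adj_mat M * P' * map_mat h M"
    using 1 hM by simp
qed (use adj_mat(1)[OF M] M P in auto)

text \<open>Factor out the largest power x^k dividing all entries. What remains has at 0 the k-th
  coefficient matrix as its value, and \<open>det N\<close> is a power of x times the remaining
  determinant, whose nonvanishing can be tested at 0.\<close>

lemma det_lowest_coeff:
  fixes N :: "'a :: idom poly mat"
  assumes N: "N \<in> carrier_mat n n" and "N \<noteq> 0\<^sub>m n n"
  shows "\<exists>k. map_mat (\<lambda>p. coeff p k) N \<noteq> 0\<^sub>m n n \<and> (det (map_mat (\<lambda>p. coeff p k) N) \<noteq> 0 \<longrightarrow> det N \<noteq> 0)"
proof -
  define C where "C k = map_mat (\<lambda>p. coeff p k) N" for k
  have "\<exists>k. C k \<noteq> 0\<^sub>m n n"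
  proof (rule ccontr)
    assume *: "\<not> ?thesis"
    have "N = 0\<^sub>m n n"
    proof (rule eq_matI)
      fix i j assume ij: "i < dim_row (0\<^sub>m n n)" "j < dim_col (0\<^sub>m n n)"
      have "coeff (N $$ (i, j)) k = 0" for k
        using * ij N unfolding C_def by (metis (no_types, lifting) carrier_matD index_map_mat(1) index_zero_mat)
      then show "N $$ (i, j) = 0\<^sub>m n n $$ (i, j)" using ij by (simp add: poly_eq_iff)
    qed (use N in auto)
    with assms show False by simp
  qed
  define k where "k = (LEAST k. C k \<noteq> 0\<^sub>m n n)"
  have k: "C k \<noteq> 0\<^sub>m n n" unfolding k_def by (rule LeastI_ex) fact
  have k': "C l = 0\<^sub>m n n" if "l < k" for l using not_less_Least that unfolding k_def by blast
  have "monom 1 k dvd N $$ (i, j)" if "i < n" "j < n" for i j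
    unfolding monom_1_dvd_iff'
  proof (intro allI impI)
    fix l assume "l < k"
    from k'[OF this] have "C l $$ (i, j) = 0" using that by simp
    then show "coeff (N $$ (i, j)) l = 0" using N that by (simp add: C_def)
  qed
  then have "\<exists>q. N $$ (i, j) = monom 1 k * q" if "i < n" "j < n" for i j
    using that by (meson dvdE)
  then obtain q where q: "N $$ (i, j) = monom 1 k * q i j" if "i < n" "j < n" for i j by metis
  define N' where "N' = mat n n (\<lambda>(i, j). q i j)"
  have NN': "N = monom 1 k \<cdot>\<^sub>m N'" using N q by (intro eq_matI) (auto simp: N'_def)
  have h: "comm_ring_hom (\<lambda>p :: 'a poly. poly p 0)" by unfold_locales auto
  have "map_mat (\<lambda>p. poly p 0) N' = C k"
    using N by (intro eq_matI) (auto simp: C_def N'_def q coeff_monom_mult poly_0_coeff_0)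
  then have "poly (det N') 0 = det (C k)" using comm_ring_hom.hom_det[OF h, of N'] by simp
  moreover have "det N = monom 1 k ^ n * det N'"
    unfolding NN' by (simp add: N'_def)
  ultimately have "det (C k) \<noteq> 0 \<longrightarrow> det N \<noteq> 0" by auto
  with k show ?thesis unfolding C_def by blast
qed

text \<open>Newton interpolation: g vanishes exactly at the old nodes, so a multiple of it corrects
  the value at the new one.\<close>

lemma poly_interpolation:
  fixes y :: "'a :: field \<Rightarrow> 'a"
  assumes "finite S"
  shows "\<exists>f. \<forall>x\<in>S. poly f x = y x"
  using assms
proof (induction S)
  case (insert x S)
  then obtain f where f: "\<forall>x\<in>S. poly f x = y x" by blast
  define g where "g = (\<Prod>z\<in>S. [:- z, 1:])"
  have g: "poly g z = 0 \<longleftrightarrow> z \<in> S" for z using insert.hyps(1) by (auto simp: g_def poly_prod)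
  have "\<forall>z\<in>insert x S. poly (f + smult ((y x - poly f x) / poly g x) g) z = y z"
    using f g insert.hyps(2) by auto
  then show ?case by blast
qed simp

lemma root_of_unity_exists:
  assumes "n \<ge> 1"
  obtains \<omega> :: complex where "\<omega> ^ n = 1" "inj_on (\<lambda>k. \<omega> ^ k) {..<n}"
proof -
  define \<omega> where "\<omega> = cis (2 * pi / real n)"
  have p: "\<omega> ^ k = cis (2 * pi * real k / real n)" for k
    by (simp add: \<omega>_def DeMoivre mult_ac)
  have "bij_betw (\<lambda>k. \<omega> ^ k) {..<n} {z. z ^ n = 1}"
    unfolding p using bij_betw_roots_unity[of n] assms by simp
  moreover have "\<omega> ^ n = 1" using assms by (simp add: p)
  ultimately show ?thesis using that by (auto simp: bij_betw_def)
qed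

text \<open>
  By the clock relation a row has at most one nonzero entry; by the shift relation the nonzero entries
  fill a cyclic diagonal.
\<close>

lemma det_clock_shift_nonzero:
  fixes N :: "complex mat"
  assumes N: "N \<in> carrier_mat n n" and N0: "N \<noteq> 0\<^sub>m n n" and w: "inj_on (\<lambda>k. \<omega> ^ k) {..<n}"
    and wn: "\<omega> ^ n = 1" and l: "\<nu> \<noteq> 0"
    and shift: "\<And>a b. a < n \<Longrightarrow> b < n \<Longrightarrow> N $$ (Suc a mod n, Suc b mod n) = \<nu> * N $$ (a, b)"
    and clock: "\<And>a b. a < n \<Longrightarrow> b < n \<Longrightarrow> \<omega> ^ (n + a - b) * N $$ (a, b) = \<mu> * N $$ (a, b)"
  shows "det N \<noteq> 0"
proof
  assume "det N = 0"
  then obtain x where x: "x \<in> carrier_vec n" "x \<noteq> 0\<^sub>v n" "N *\<^sub>v x = 0\<^sub>v n"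
    using det_0_iff_vec_prod_zero[OF N] by blast
  obtain a0 b0 where ab: "a0 < n" "b0 < n" "N $$ (a0, b0) \<noteq> 0"
    using N0 N by (metis carrier_matD eq_matI index_zero_mat)
  have *: "N $$ ((a0 + k) mod n, (b0 + k) mod n) \<noteq> 0" for k
  proof (induction k)
    case (Suc k)
    have "N $$ (Suc ((a0 + k) mod n) mod n, Suc ((b0 + k) mod n) mod n) \<noteq> 0"
      using Suc ab l by (subst shift) auto
    then show ?case by (simp add: mod_Suc_eq)
  qed (use ab in simp)
  have "x $ b = 0" if b: "b < n" for b
  proof -
    \<comment> \<open>The row in which the cyclic diagonal through the known nonzero entry meets
      column b.\<close>
    define a where "a = (a0 + (n - b0 + b)) mod n"
    have "(b0 + (n - b0 + b)) mod n = b" using ab b by simp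
    then have Nab: "N $$ (a, b) \<noteq> 0" and a: "a < n" using *[of "n - b0 + b"] ab by (auto simp: a_def)
    have "N $$ (a, b') = 0" if "b' < n" "b' \<noteq> b" for b'
    proof (rule ccontr)
      assume "N $$ (a, b') \<noteq> 0"
      then have "\<omega> ^ (n + a - b') = \<omega> ^ (n + a - b)" using clock[of a b] clock[of a b'] Nab a b that by auto
      \<comment> \<open>This factor clears the subtractions in the exponents, where n was added only
        to stay within the natural numbers.\<close>
      then have "\<omega> ^ (n + a - b') * \<omega> ^ (b' + b) = \<omega> ^ (n + a - b) * \<omega> ^ (b' + b)" by simp
      moreover have "\<omega> ^ (n + a - b') * \<omega> ^ (b' + b) = \<omega> ^ n * \<omega> ^ a * \<omega> ^ b"
        "\<omega> ^ (n + a - b) * \<omega> ^ (b' + b) = \<omega> ^ n * \<omega> ^ a * \<omega> ^ b'"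
        using that b a by (simp_all add: add.assoc flip: power_add)
      moreover have "\<omega> \<noteq> 0" using wn b by (auto simp: power_0_left)
      ultimately have "\<omega> ^ b = \<omega> ^ b'" using wn by simp
      with w that b show False by (auto simp: inj_on_def)
    qed
    then have "(N *\<^sub>v x) $ a = N $$ (a, b) * x $ b"
      using N x(1) a b sum.mono_neutral_right[of "{0..<n}" "{b}" "\<lambda>i. N $$ (a, i) * x $ i"]
      by (auto simp: scalar_prod_def)
    then show "x $ b = 0" using x(3) Nab a by simp
  qed
  with x show False by (auto intro: eq_vecI)
qed

section \<open>Polynomials in two variables, clock and shift matrices\<close>

abbreviation const2 :: "complex \<Rightarrow> complex poly poly" where
  "const2 z \<equiv> [:[:z:]:]"

abbreviation eval2 :: "complex \<Rightarrow> complex \<Rightarrow> complex poly poly \<Rightarrow> complex" where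
  "eval2 a b p \<equiv> poly (poly p [:b:]) a"

lemma eval2_hom: "comm_ring_hom (eval2 a b)"
  by unfold_locales auto

lemma eval2_nonzero_exists:
  assumes "p \<noteq> 0"
  shows "\<exists>a b. eval2 a b p \<noteq> 0"
proof -
  have "infinite (range (\<lambda>b :: complex. [:b:]))"
    by (subst finite_image_iff) (auto simp: inj_on_def infinite_UNIV_char_0)
  then obtain b where "poly p [:b:] \<noteq> 0"
    using poly_roots_finite[OF assms] by (metis (mono_tags, lifting) finite_subset image_subsetI mem_Collect_eq)
  then show ?thesis by (metis poly_all_0_iff_0)
qed

text \<open>The substitutions \<open>\<alpha> \<mapsto> \<omega>\<alpha>\<close> in the inner and \<open>\<beta> \<mapsto> \<omega>\<beta>\<close> in the outer variable.\<close>

definition twist_inner :: "complex \<Rightarrow> complex poly poly \<Rightarrow> complex poly poly" where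
  "twist_inner w p = map_poly (\<lambda>q. q \<circ>\<^sub>p [:0, w:]) p"

definition twist_outer :: "complex \<Rightarrow> complex poly poly \<Rightarrow> complex poly poly" where
  "twist_outer w p = p \<circ>\<^sub>p [:0, [:w:]:]"

lemma coeff_twist_inner: "coeff (coeff (twist_inner w p) j) i = w ^ i * coeff (coeff p j) i"
  by (simp add: twist_inner_def coeff_map_poly coeff_pcompose_linear)

lemma coeff_twist_outer: "coeff (coeff (twist_outer w p) j) i = w ^ j * coeff (coeff p j) i"
  by (simp add: twist_outer_def coeff_pcompose_linear poly_const_pow)

lemma poly2_eqI: "(\<And>i j. coeff (coeff p j) i = coeff (coeff q j) i) \<Longrightarrow> p = q"
  by (simp add: poly_eq_iff)

lemma pcompose_hom: "comm_ring_hom (\<lambda>q :: 'a :: comm_ring_1 poly. q \<circ>\<^sub>p r)"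
  by unfold_locales (auto simp: pcompose_add pcompose_mult pcompose_1)

lemma twist_outer_hom: "comm_ring_hom (twist_outer w)"
  unfolding twist_outer_def by (rule pcompose_hom)

lemma twist_inner_hom: "comm_ring_hom (twist_inner w)"
proof -
  interpret h: comm_ring_hom "\<lambda>q :: complex poly. q \<circ>\<^sub>p [:0, w:]" by (rule pcompose_hom)
  interpret m: map_poly_comm_ring_hom "\<lambda>q :: complex poly. q \<circ>\<^sub>p [:0, w:]" ..
  show ?thesis unfolding twist_inner_def by unfold_locales
qed

lemma twist_const2 [simp]: "twist_inner w (const2 z) = const2 z" "twist_outer w (const2 z) = const2 z"
  by (rule poly2_eqI; simp add: coeff_twist_inner coeff_twist_outer coeff_pCons split: nat.split)+

text \<open>Conjugation by the shift moves both indices of an entry cyclically by one; conjugation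
  by the clock multiplies the entry (a, b) by \<omega>^(a - b). These actions are to be matched with
  the two twists.\<close>

definition shift_mat :: "nat \<Rightarrow> 'a :: comm_ring_1 mat" where
  "shift_mat n = mat n n (\<lambda>(a, b). if b = Suc a mod n then 1 else 0)"

definition clock_mat :: "nat \<Rightarrow> 'a :: comm_ring_1 \<Rightarrow> 'a mat" where
  "clock_mat n w = mat n n (\<lambda>(a, b). if a = b then w ^ a else 0)"

lemma shift_clock_carrier [simp]: "shift_mat n \<in> carrier_mat n n" "clock_mat n w \<in> carrier_mat n n"
  by (auto simp: shift_mat_def clock_mat_def)

lemma Suc_mod_inj: "a < n \<Longrightarrow> b < n \<Longrightarrow> Suc a mod n = Suc b mod n \<longleftrightarrow> a = b"
  by (auto simp: mod_Suc split: if_splits)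

lemma index_shift_mat_mult:
  "M \<in> carrier_mat n m \<Longrightarrow> a < n \<Longrightarrow> b < m \<Longrightarrow> (shift_mat n * M) $$ (a, b) = M $$ (Suc a mod n, b)"
  by (subst index_mult_mat_sum[OF shift_clock_carrier(1)]) (auto simp: shift_mat_def if_distrib[of "\<lambda>x. x * _"] cong: if_cong)

lemma index_mult_shift_mat_transpose:
  "M \<in> carrier_mat m n \<Longrightarrow> a < m \<Longrightarrow> b < n \<Longrightarrow> (M * (shift_mat n)\<^sup>T) $$ (a, b) = M $$ (a, Suc b mod n)"
  by (subst index_mult_mat_sum[where m = n and n = m and p = n]) (auto simp: shift_mat_def if_distrib[of "\<lambda>x. _ * x"] cong: if_cong)

lemma index_shift_mat_conj:
  assumes "M \<in> carrier_mat n n" "a < n" "b < n"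
  shows "(shift_mat n * M * (shift_mat n)\<^sup>T) $$ (a, b) = M $$ (Suc a mod n, Suc b mod n)"
  using assms index_mult_shift_mat_transpose[OF mult_carrier_mat[OF shift_clock_carrier(1) assms(1)], of a b]
    index_shift_mat_mult[OF assms(1), of a "Suc b mod n"] by simp

lemma index_clock_mat_mult:
  "M \<in> carrier_mat n m \<Longrightarrow> a < n \<Longrightarrow> b < m \<Longrightarrow> (clock_mat n w * M) $$ (a, b) = w ^ a * M $$ (a, b)"
  by (subst index_mult_mat_sum[OF shift_clock_carrier(2)]) (auto simp: clock_mat_def if_distrib[of "\<lambda>x. x * _"] cong: if_cong)

lemma index_mult_clock_mat:
  "M \<in> carrier_mat m n \<Longrightarrow> a < m \<Longrightarrow> b < n \<Longrightarrow> (M * clock_mat n w) $$ (a, b) = M $$ (a, b) * w ^ b"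
  by (subst index_mult_mat_sum[OF _ shift_clock_carrier(2)]) (auto simp: clock_mat_def if_distrib[of "\<lambda>x. _ * x"] cong: if_cong)

lemma index_clock_mat_conj:
  assumes "M \<in> carrier_mat n n" "a < n" "b < n"
  shows "(clock_mat n w * M * clock_mat n w') $$ (a, b) = w ^ a * M $$ (a, b) * w' ^ b"
  using assms index_mult_clock_mat[OF mult_carrier_mat[OF shift_clock_carrier(2) assms(1)], of a b]
    index_clock_mat_mult[OF assms(1), of a b] by simp

lemma shift_mat_inverse:
  "shift_mat n * (shift_mat n)\<^sup>T = (1\<^sub>m n :: 'a :: idom mat)" "(shift_mat n)\<^sup>T * shift_mat n = (1\<^sub>m n :: 'a :: idom mat)"
proof -
  show 1: "shift_mat n * (shift_mat n)\<^sup>T = (1\<^sub>m n :: 'a mat)"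
  proof (rule eq_matI)
    fix a b assume "a < dim_row (1\<^sub>m n :: 'a mat)" "b < dim_col (1\<^sub>m n :: 'a mat)"
    then have ab: "a < n" "b < n" by auto
    have "(shift_mat n * (shift_mat n)\<^sup>T) $$ (a, b) = (shift_mat n :: 'a mat)\<^sup>T $$ (Suc a mod n, b)"
      by (rule index_shift_mat_mult[where m = n]) (use ab in auto)
    also have "\<dots> = 1\<^sub>m n $$ (a, b)" using ab by (auto simp: shift_mat_def Suc_mod_inj)
    finally show "(shift_mat n * (shift_mat n)\<^sup>T) $$ (a, b) = (1\<^sub>m n :: 'a mat) $$ (a, b)" .
  qed (auto simp: shift_mat_def)
  show "(shift_mat n)\<^sup>T * shift_mat n = (1\<^sub>m n :: 'a mat)"
  proof (rule mult_right_cancel_det[where n = n and m = n])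
    show "det ((shift_mat n)\<^sup>T) \<noteq> (0 :: 'a)"
      by (rule det_nonzeroI(2)[OF _ _ 1]) auto
    show "(shift_mat n)\<^sup>T * shift_mat n * (shift_mat n)\<^sup>T = 1\<^sub>m n * (shift_mat n :: 'a mat)\<^sup>T"
      by (simp add: mat_mult_assoc 1 carrier_matD[OF shift_clock_carrier(1)])
  qed (auto intro: mult_carrier_mat[where n = n])
qed

lemma clock_mat_inverse:
  assumes "w * w' = 1"
  shows "clock_mat n w * clock_mat n w' = 1\<^sub>m n"
  using assms by (intro eq_matI) (auto simp: index_clock_mat_mult[of _ n n] simp del: index_mult_mat(1), auto simp: clock_mat_def simp flip: power_mult_distrib)

lemma map_pencil:
  assumes h: "comm_ring_hom h" and Y: "tuple n Y" and Q: "tuple e Q"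
  shows "map_mat h (pencil n e Q Y) = pencil n e (\<lambda>i. map_mat h (Q i)) (\<lambda>i. map_mat h (Y i))"
proof -
  interpret comm_ring_hom h by fact
  have "map_mat h (aff_ext n Y i) = aff_ext n (\<lambda>i. map_mat h (Y i)) i" for i
    by (auto simp: aff_ext_def mat_hom_one split: option.split)
  then show ?thesis
    unfolding pencil_def using Y Q by (subst pev_map[OF h]) auto
qed

lemma kron_left_one: "B \<in> carrier_mat 1 e \<Longrightarrow> V \<in> carrier_mat n n \<Longrightarrow>
    kron (1\<^sub>m n) B * kron V (1\<^sub>m e) = V * kron (1\<^sub>m n) B"
  using kron_mult[of "1\<^sub>m n" n n V n B 1 e "1\<^sub>m e" e] kron_mult[of V n n "1\<^sub>m n" n "1\<^sub>m 1" 1 1 B e]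
  by (simp add: kron_one_one)

lemma kron_right_one: "B \<in> carrier_mat e 1 \<Longrightarrow> V \<in> carrier_mat n n \<Longrightarrow>
    kron V (1\<^sub>m e) * kron (1\<^sub>m n) B = kron (1\<^sub>m n) B * V"
  using kron_mult[of V n n "1\<^sub>m n" n "1\<^sub>m e" e e B 1] kron_mult[of "1\<^sub>m n" n n V n B e 1 "1\<^sub>m 1" 1]
  by (simp add: kron_one_one)

text \<open>If h acts on the point as conjugation by P, it acts on the pencil as conjugation by
  \<open>kron P (1\<^sub>m e)\<close>, hence also on the adjugate. Since h fixes b and c, and these
  intertwine \<open>kron P (1\<^sub>m e)\<close> with P, the corner N transforms like the matrices
  of the point. Over a field, N would be \<open>det M\<close> times the value of the pencil: a value
  without denominators.\<close>

lemma map_adj_corner_conj: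
  fixes Q :: "'d :: finite option \<Rightarrow> 'a :: idom mat"
  assumes h: "comm_ring_hom h" and Y: "tuple n Y" and Q: "tuple e Q"
    and b: "b \<in> carrier_mat 1 e" and c: "c \<in> carrier_mat e 1"
    and fix_h: "\<And>i. map_mat h (Q i) = Q i" "map_mat h b = b" "map_mat h c = c"
    and P: "P \<in> carrier_mat n n" "P' \<in> carrier_mat n n" "P * P' = 1\<^sub>m n" "P' * P = 1\<^sub>m n"
    and hY: "\<And>i. map_mat h (Y i) = P * Y i * P'"
    and d: "det (pencil n e Q Y) \<noteq> 0"
  defines "N \<equiv> kron (1\<^sub>m n) b * adj_mat (pencil n e Q Y) * kron (1\<^sub>m n) c"
  shows "map_mat h N = P * N * P'"
proof -
  interpret comm_ring_hom h by fact
  define M where "M = pencil n e Q Y"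
  have M: "M \<in> carrier_mat (n * e) (n * e)" by (simp add: M_def)
  have "P * aff_ext n Y i * P' = aff_ext n (\<lambda>i. map_mat h (Y i)) i" for i
    using P hY by (auto simp: aff_ext_def split: option.split)
  then have hM: "map_mat h M = kron P (1\<^sub>m e) * M * kron P' (1\<^sub>m e)"
    unfolding M_def map_pencil[OF h Y Q] fix_h using Y Q P
    by (simp add: pencil_def pev_conj[where n = n and m = n])
  have PP: "kron P (1\<^sub>m e) * kron P' (1\<^sub>m e) = 1\<^sub>m (n * e)" "kron P' (1\<^sub>m e) * kron P (1\<^sub>m e) = 1\<^sub>m (n * e)"
    using kron_mult[OF P(1,2) one_carrier_mat[of e] one_carrier_mat]
      kron_mult[OF P(2,1) one_carrier_mat[of e] one_carrier_mat] P by simp_all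
  have kc: "kron P (1\<^sub>m e) \<in> carrier_mat (n * e) (n * e)" "kron P' (1\<^sub>m e) \<in> carrier_mat (n * e) (n * e)"
    using P by auto
  have adj: "map_mat h (adj_mat M) = kron P (1\<^sub>m e) * adj_mat M * kron P' (1\<^sub>m e)"
    by (rule adj_mat_hom_conj[OF h M d[folded M_def] kc PP hM])
  note a = adj_mat(1)[OF M]
  have one: "map_mat h (1\<^sub>m n) = 1\<^sub>m n" by (rule mat_hom_one)
  have kb: "kron (1\<^sub>m n) b \<in> carrier_mat n (n * e)" "kron (1\<^sub>m n) c \<in> carrier_mat (n * e) n"
    using kron_carrier[OF one_carrier_mat b, of n] kron_carrier[OF one_carrier_mat c, of n] by auto
  have "map_mat h N = kron (1\<^sub>m n) b * (kron P (1\<^sub>m e) * adj_mat M * kron P' (1\<^sub>m e)) * kron (1\<^sub>m n) c"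
    unfolding N_def M_def[symmetric]
    by (simp add: mat_hom_mult[OF mult_carrier_mat[OF kb(1) a] kb(2)] mat_hom_mult[OF kb(1) a] kron_map[OF h] one fix_h adj)
  also have "\<dots> = (kron (1\<^sub>m n) b * kron P (1\<^sub>m e)) * adj_mat M * (kron P' (1\<^sub>m e) * kron (1\<^sub>m n) c)"
    using b c P carrier_matD[OF a] M by (simp add: mat_mult_assoc)
  also have "\<dots> = P * N * P'"
    unfolding kron_left_one[OF b P(1)] kron_right_one[OF c P(2)] N_def M_def[symmetric]
    using b c P carrier_matD[OF a] M by (simp add: mat_mult_assoc)
  finally show ?thesis .
qed

text \<open>On the cyclic diagonal a - b = s modulo n, the entries of Y are the values at \<omega>^a
  of an interpolating polynomial f. The lift has the entries f(\<omega>^a \<alpha>) \<beta>^s.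
  Replacing \<alpha> by \<omega>\<alpha> moves a to a + 1 along the diagonal, replacing \<beta> by
  \<omega>\<beta> multiplies by \<omega>^s = \<omega>^(a - b), and \<alpha> = \<beta> = 1 returns
  Y.\<close>

lemma twisted_lift_exists:
  fixes Y :: "complex mat"
  assumes Y: "Y \<in> carrier_mat n n" and n: "n \<ge> 1"
    and w: "\<omega> ^ n = 1" "inj_on (\<lambda>k. \<omega> ^ k) {..<n}"
  shows "\<exists>Z \<in> carrier_mat n n. map_mat (eval2 1 1) Z = Y \<and>
     map_mat (twist_inner \<omega>) Z = shift_mat n * Z * (shift_mat n)\<^sup>T \<and>
     map_mat (twist_outer \<omega>) Z = clock_mat n (const2 \<omega>) * Z * clock_mat n (const2 (inverse \<omega>))"
proof -
  have w0: "\<omega> \<noteq> 0" using w(1) n by (auto simp: power_0_left)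
  \<comment> \<open>The two \<open>THE\<close> terms recover the row a from the root of unity
    \<omega>^a. The column is a - s modulo n, written as a + (n - s) because subtraction is
    truncated.\<close>
  define y where "y s z = Y $$ (THE a. a < n \<and> \<omega> ^ a = z, ((THE a. a < n \<and> \<omega> ^ a = z) + (n - s)) mod n)" for s z
  have "\<exists>f. \<forall>x\<in>(\<lambda>k. \<omega> ^ k) ` {..<n}. poly f x = y s x" for s
    by (rule poly_interpolation) auto
  then obtain f where f: "\<And>s x. x \<in> (\<lambda>k. \<omega> ^ k) ` {..<n} \<Longrightarrow> poly (f s) x = y s x" by metis
  have the: "(THE a'. a' < n \<and> \<omega> ^ a' = \<omega> ^ a) = a" if "a < n" for a
    using that w(2) by (intro the_equality) (auto simp: inj_on_def)
  have f': "poly (f s) (\<omega> ^ a) = Y $$ (a, (a + (n - s)) mod n)" if "a < n" for a s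
    using f[of "\<omega> ^ a" s] that by (simp add: y_def the)
  define s where "s a b = (n + a - b) mod n" for a b :: nat
  have s1: "s (Suc a mod n) (Suc b mod n) = s a b" if "a < n" "b < n" for a b
    using that n by (auto simp: s_def mod_Suc le_mod_geq)
  have s2: "(a + (n - s a b)) mod n = b" if "a < n" "b < n" for a b
    using that n by (cases "a < b") (auto simp: s_def le_mod_geq)
  have s3: "\<omega> ^ s a b = \<omega> ^ a * inverse \<omega> ^ b" if "a < n" "b < n" for a b
  proof -
    have "\<omega> ^ s a b * \<omega> ^ b = \<omega> ^ a"
    proof (cases "a < b")
      case True
      then have "s a b = n + a - b" using that by (simp add: s_def)
      then show ?thesis using that w(1) by (simp flip: power_add) (simp add: power_add)
    next
      case False
      then have "s a b = a - b" using that by (simp add: s_def le_mod_geq)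
      then show ?thesis using False by (simp flip: power_add)
    qed
    then show ?thesis using w0 by (simp add: field_simps power_inverse)
  qed
  define Z where "Z = mat n n (\<lambda>(a, b). monom (f (s a b) \<circ>\<^sub>p [:0, \<omega> ^ a:]) (s a b))"
  have Z: "Z \<in> carrier_mat n n" by (simp add: Z_def)
  have "\<omega> ^ (Suc a mod n) = \<omega> * \<omega> ^ a" for a
    using w(1) by (metis power_Suc power_add power_mult mod_mult_div_eq mult.right_neutral power_one)
  then have cZ: "coeff (coeff (Z $$ (Suc a mod n, Suc b mod n)) j) i = \<omega> ^ i * coeff (coeff (Z $$ (a, b)) j) i"
    if "a < n" "b < n" for a b i j
    using that n by (simp add: Z_def s1 coeff_pcompose_linear power_mult_distrib)
  have "map_mat (eval2 1 1) Z = Y"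
    using Y by (intro eq_matI) (auto simp: Z_def poly_monom poly_pcompose f' s2 simp flip: one_pCons)
  moreover have "map_mat (twist_inner \<omega>) Z = shift_mat n * Z * (shift_mat n)\<^sup>T"
  proof (rule eq_matI)
    fix a b assume "a < dim_row (shift_mat n * Z * (shift_mat n)\<^sup>T)" "b < dim_col (shift_mat n * Z * (shift_mat n :: complex poly poly mat)\<^sup>T)"
    then have ab: "a < n" "b < n" by (auto simp: shift_mat_def)
    have "(shift_mat n * Z * (shift_mat n)\<^sup>T) $$ (a, b) = Z $$ (Suc a mod n, Suc b mod n)"
      using ab Z n by (simp add: index_shift_mat_conj del: index_mult_mat(1))
    also have "\<dots> = twist_inner \<omega> (Z $$ (a, b))"
      by (rule poly2_eqI) (simp add: cZ[OF ab] coeff_twist_inner)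
    finally show "map_mat (twist_inner \<omega>) Z $$ (a, b) = (shift_mat n * Z * (shift_mat n)\<^sup>T) $$ (a, b)"
      using ab Z by simp
  qed (use Z in \<open>auto simp: shift_mat_def\<close>)
  moreover have "map_mat (twist_outer \<omega>) Z = clock_mat n (const2 \<omega>) * Z * clock_mat n (const2 (inverse \<omega>))"
  proof (rule eq_matI)
    fix a b assume "a < dim_row (clock_mat n (const2 \<omega>) * Z * clock_mat n (const2 (inverse \<omega>)))"
      "b < dim_col (clock_mat n (const2 \<omega>) * Z * clock_mat n (const2 (inverse \<omega>)))"
    then have ab: "a < n" "b < n" by (auto simp: clock_mat_def)
    have "(clock_mat n (const2 \<omega>) * Z * clock_mat n (const2 (inverse \<omega>))) $$ (a, b) =
        const2 (\<omega> ^ a) * Z $$ (a, b) * const2 (inverse \<omega> ^ b)"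
      by (simp only: index_clock_mat_conj[OF Z ab] poly_const_pow)
    also have "\<dots> = twist_outer \<omega> (Z $$ (a, b))"
      by (rule poly2_eqI) (use ab in \<open>auto simp: coeff_twist_outer Z_def s3\<close>)
    finally show "map_mat (twist_outer \<omega>) Z $$ (a, b) =
        (clock_mat n (const2 \<omega>) * Z * clock_mat n (const2 (inverse \<omega>))) $$ (a, b)"
      using ab Z by simp
  qed (use Z in \<open>auto simp: clock_mat_def\<close>)
  ultimately show ?thesis using Z by blast
qed

text \<open>The relations are homogeneous: the coefficient matrix of \<alpha>^i \<beta>^j satisfies
  the shift and clock relations with the factors \<omega>^i and \<omega>^j, so it is invertible once
  it is nonzero. Taking the lowest nonzero coefficient in \<beta>, then in \<alpha>, carries this
  over to N. It is the division algebra property: a twisted element is zero or invertible.\<close>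

lemma det_twisted_nonzero:
  assumes N: "N \<in> carrier_mat n n" "N \<noteq> 0\<^sub>m n n" and n: "n \<ge> 1"
    and w: "\<omega> ^ n = 1" "inj_on (\<lambda>k. \<omega> ^ k) {..<n}"
    and t1: "map_mat (twist_inner \<omega>) N = shift_mat n * N * (shift_mat n)\<^sup>T"
    and t2: "map_mat (twist_outer \<omega>) N = clock_mat n (const2 \<omega>) * N * clock_mat n (const2 (inverse \<omega>))"
  shows "det N \<noteq> 0"
proof -
  have w0: "\<omega> \<noteq> 0" using w(1) n by (auto simp: power_0_left)
  obtain j where j: "map_mat (\<lambda>p. coeff p j) N \<noteq> 0\<^sub>m n n" "det (map_mat (\<lambda>p. coeff p j) N) \<noteq> 0 \<longrightarrow> det N \<noteq> 0"
    using det_lowest_coeff[OF N] by blast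
  obtain i where i: "map_mat (\<lambda>p. coeff p i) (map_mat (\<lambda>p. coeff p j) N) \<noteq> 0\<^sub>m n n"
    "det (map_mat (\<lambda>p. coeff p i) (map_mat (\<lambda>p. coeff p j) N)) \<noteq> 0 \<longrightarrow> det (map_mat (\<lambda>p. coeff p j) N) \<noteq> 0"
    using det_lowest_coeff[OF _ j(1)] N(1) by auto
  define C where "C = map_mat (\<lambda>p. coeff p i) (map_mat (\<lambda>p. coeff p j) N)"
  have C: "C \<in> carrier_mat n n" using N by (simp add: C_def)
  have Cab: "C $$ (a, b) = coeff (coeff (N $$ (a, b)) j) i" if "a < n" "b < n" for a b
    using that N by (simp add: C_def)
  have "det C \<noteq> 0"
  proof (rule det_clock_shift_nonzero[OF C _ w(2,1), where \<nu> = "\<omega> ^ i" and \<mu> = "\<omega> ^ j"])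
    fix a b assume ab: "a < n" "b < n"
    have "twist_inner \<omega> (N $$ (a, b)) = N $$ (Suc a mod n, Suc b mod n)"
      using arg_cong[OF t1, of "\<lambda>M. M $$ (a, b)"] ab N n
      by (simp add: index_shift_mat_conj del: index_mult_mat(1))
    then have "coeff (coeff (N $$ (Suc a mod n, Suc b mod n)) j) i = \<omega> ^ i * coeff (coeff (N $$ (a, b)) j) i"
      by (metis coeff_twist_inner)
    then show "C $$ (Suc a mod n, Suc b mod n) = \<omega> ^ i * C $$ (a, b)"
      using ab n by (simp add: Cab)
    have "twist_outer \<omega> (N $$ (a, b)) = const2 (\<omega> ^ a) * N $$ (a, b) * const2 (inverse \<omega> ^ b)"
      using arg_cong[OF t2, of "\<lambda>M. M $$ (a, b)"] ab N(1)
      unfolding index_clock_mat_conj[OF N(1) ab] poly_const_pow by simp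
    then have "coeff (coeff (twist_outer \<omega> (N $$ (a, b))) j) i =
        coeff (coeff (const2 (\<omega> ^ a) * N $$ (a, b) * const2 (inverse \<omega> ^ b)) j) i" by simp
    then have "\<omega> ^ j * C $$ (a, b) = \<omega> ^ a * inverse \<omega> ^ b * C $$ (a, b)"
      using ab by (simp add: coeff_twist_outer Cab mult_ac)
    moreover have "\<omega> ^ (n + a - b) = \<omega> ^ a * inverse \<omega> ^ b"
    proof -
      have "\<omega> ^ (n + a - b) * \<omega> ^ b = \<omega> ^ a" using ab w(1) by (simp flip: power_add) (simp add: power_add)
      then show ?thesis using w0 by (simp add: field_simps power_inverse)
    qed
    ultimately show "\<omega> ^ (n + a - b) * C $$ (a, b) = \<omega> ^ j * C $$ (a, b)" by metis
  qed (use i w0 in \<open>auto simp: C_def\<close>)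
  then show ?thesis using i(2) j(2) by (simp add: C_def)
qed

lemma index_kron_one_mult:
  assumes b: "b \<in> carrier_mat f e" and W: "W \<in> carrier_mat (n * e) m" and a: "a < n" "j < f" "k < m"
  shows "(kron (1\<^sub>m n) b * W) $$ (a * f + j, k) = (\<Sum>i = 0..<e. b $$ (j, i) * W $$ (a * e + i, k))"
proof -
  have af: "a * f + j < n * f"
    using a by (metis add_less_cancel_left less_le_trans mult_Suc mult_le_mono1 Suc_leI add.commute)
  have "(kron (1\<^sub>m n) b * W) $$ (a * f + j, k) = (\<Sum>r = 0..<n * e. kron (1\<^sub>m n) b $$ (a * f + j, r) * W $$ (r, k))"
    by (rule index_mult_mat_sum[OF kron_carrier[OF one_carrier_mat b] W]) (use af a in auto)
  also have "\<dots> = (\<Sum>r = 0..<n * e. (if a = r div e then b $$ (j, r mod e) * W $$ ((r div e) * e + r mod e, k) else 0))"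
    using af a by (intro sum.cong refl) (simp add: kron_index[OF one_carrier_mat b] div_less_of_less_mult)
  also have "\<dots> = (\<Sum>a' = 0..<n. \<Sum>i = 0..<e. if a = a' then b $$ (j, i) * W $$ (a' * e + i, k) else 0)"
    by (rule sum_div_mod)
  also have "\<dots> = (\<Sum>a' = 0..<n. if a = a' then (\<Sum>i = 0..<e. b $$ (j, i) * W $$ (a' * e + i, k)) else 0)"
    by (intro sum.cong refl) simp
  also have "\<dots> = (\<Sum>i = 0..<e. b $$ (j, i) * W $$ (a * e + i, k))" using a by simp
  finally show ?thesis .
qed

text \<open>The j-th unit row selects the rows congruent to j modulo e; take the class of a row with
  a nonzero entry.\<close>

lemma nonzero_row_exists:
  fixes W :: "'a :: comm_ring_1 mat"
  assumes W: "W \<in> carrier_mat (n * e) m" "W \<noteq> 0\<^sub>m (n * e) m"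
  shows "\<exists>j<e. kron (1\<^sub>m n) (mat 1 e (\<lambda>(_, i). if i = j then 1 else 0)) * W \<noteq> 0\<^sub>m n m"
proof -
  obtain r k where rk: "r < n * e" "k < m" "W $$ (r, k) \<noteq> 0"
    using W by (metis carrier_matD eq_matI index_zero_mat)
  define b where "b = mat 1 e (\<lambda>(_, i). if i = r mod e then 1 else (0 :: 'a))"
  have b: "b \<in> carrier_mat 1 e" by (simp add: b_def)
  have "(kron (1\<^sub>m n) b * W) $$ (r div e * 1 + 0, k) = W $$ (r div e * e + r mod e, k)"
    using rk by (subst index_kron_one_mult[OF b W(1)])
      (auto simp: b_def div_less_of_less_mult mod_less_of_less_mult if_distrib[of "\<lambda>x. x * _"] cong: if_cong)
  then have "kron (1\<^sub>m n) b * W \<noteq> 0\<^sub>m n m"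
    using rk by (auto simp: div_less_of_less_mult)
  then show ?thesis using rk unfolding b_def by (intro exI[of _ "r mod e"]) (auto simp: mod_less_of_less_mult)
qed

text \<open>
  An Amitsur-type statement: some entry of the vector \<open>Q(X)\<^sup>-\<^sup>1 c\<close> is generically invertible. The point
  \<open>Y\<close> is deformed to a point over the division algebra generated by \<open>\<alpha> clock\<close> and
  \<open>\<beta> shift\<close> over \<open>\<complex>(\<alpha>\<^sup>n, \<beta>\<^sup>n)\<close>, whose elements are recognised by their behaviour under
  \<open>\<alpha> \<mapsto> \<omega>\<alpha>\<close> and \<open>\<beta> \<mapsto> \<omega>\<beta>\<close>.
\<close>

lemma invertible_corner_exists:
  fixes Q :: "'d :: finite option \<Rightarrow> complex mat"
  assumes Q: "tuple e Q" and n: "n \<ge> 1" and Y: "Y \<in> pdom n e Q"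
    and c: "c \<in> carrier_mat e 1" "c \<noteq> 0\<^sub>m e 1"
  shows "\<exists>b \<in> carrier_mat 1 e. \<exists>X \<in> pdom n e Q. det (pval n e b Q c X) \<noteq> 0"
proof -
  obtain \<omega> where w: "\<omega> ^ n = (1 :: complex)" "inj_on (\<lambda>k. \<omega> ^ k) {..<n}"
    using root_of_unity_exists[OF n] by blast
  have w0: "\<omega> \<noteq> 0" using w(1) n by (auto simp: power_0_left)
  have tY: "tuple n Y" and dY: "det (pencil n e Q Y) \<noteq> 0" using Y by (auto simp: pdom_def)
  obtain Z where Z: "\<And>i. Z i \<in> carrier_mat n n" "\<And>i. map_mat (eval2 1 1) (Z i) = Y i"
     "\<And>i. map_mat (twist_inner \<omega>) (Z i) = shift_mat n * Z i * (shift_mat n)\<^sup>T"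
     "\<And>i. map_mat (twist_outer \<omega>) (Z i) = clock_mat n (const2 \<omega>) * Z i * clock_mat n (const2 (inverse \<omega>))"
    using twisted_lift_exists[OF tupleD[OF tY] n w] by metis
  have tZ: "tuple n Z" using Z(1) by (simp add: tuple_def)
  define Q' where "Q' i = map_mat const2 (Q i)" for i
  have Q': "tuple e Q'" using Q by (simp add: Q'_def tuple_def)
  define M where "M = pencil n e Q' Z"
  have M: "M \<in> carrier_mat (n * e) (n * e)" by (simp add: M_def)
  have evc: "map_mat (eval2 a b) (map_mat const2 A) = A" for a b A
    by (auto intro!: eq_matI)
  have evM: "map_mat (eval2 a b) M = pencil n e Q (\<lambda>i. map_mat (eval2 a b) (Z i))" for a b
    unfolding M_def map_pencil[OF eval2_hom tZ Q'] by (simp add: Q'_def evc)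
  \<comment> \<open>The specialization \<alpha> = \<beta> = 1 returns the pencil at Y, which is
    invertible.\<close>
  have dM: "det M \<noteq> 0"
  proof
    assume "det M = 0"
    then have "det (map_mat (eval2 1 1) M) = 0" by (simp add: comm_ring_hom.hom_det[OF eval2_hom])
    with dY show False by (simp add: evM Z)
  qed
  define c' where "c' = map_mat const2 c"
  have c': "c' \<in> carrier_mat e 1" using c by (simp add: c'_def)
  have kc': "kron (1\<^sub>m n) c' \<in> carrier_mat (n * e) n" using kron_carrier[OF one_carrier_mat c', of n] by simp
  note a = adj_mat[OF M]
  have W: "adj_mat M * kron (1\<^sub>m n) c' \<in> carrier_mat (n * e) n" using a(1) kc' by simp
  \<comment> \<open>Multiplying by M turns the product into a nonzero multiple of the amplified
    column c', which is not zero.\<close>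
  have W0: "adj_mat M * kron (1\<^sub>m n) c' \<noteq> 0\<^sub>m (n * e) n"
  proof
    assume *: "adj_mat M * kron (1\<^sub>m n) c' = 0\<^sub>m (n * e) n"
    have "det M \<cdot>\<^sub>m kron (1\<^sub>m n) c' = M * adj_mat M * kron (1\<^sub>m n) c'"
      unfolding a(2) mult_smult_assoc_mat[OF one_carrier_mat kc'] left_mult_one_mat[OF kc'] ..
    also have "\<dots> = M * (adj_mat M * kron (1\<^sub>m n) c')" by (rule assoc_mult_mat[OF M a(1) kc'])
    also have "\<dots> = det M \<cdot>\<^sub>m 0\<^sub>m (n * e) n" unfolding * using M by simp
    finally have k0: "kron (1\<^sub>m n) c' = 0\<^sub>m (n * e) n"
      by (intro smult_mat_cancel[OF kc' _ dM]) auto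
    have "c = 0\<^sub>m e 1"
    proof (rule eq_matI)
      fix i j assume "i < dim_row (0\<^sub>m e 1)" "j < dim_col (0\<^sub>m e 1)"
      then have ij: "i < e" "j = 0" by auto
      then have "i < n * e" using n by (metis less_le_trans mult_le_mono1 nat_mult_1)
      then have "kron (1\<^sub>m n) c' $$ (i, 0) = c' $$ (i, 0)"
        using ij n by (subst kron_index[OF one_carrier_mat c']) auto
      then show "c $$ (i, j) = 0\<^sub>m e 1 $$ (i, j)"
        using ij c \<open>i < n * e\<close> n unfolding k0 by (simp add: c'_def)
    qed (use c in auto)
    with c show False by simp
  qed
  obtain j where j: "j < e" "kron (1\<^sub>m n) (mat 1 e (\<lambda>(_, i). if i = j then 1 else 0)) *
      (adj_mat M * kron (1\<^sub>m n) c') \<noteq> 0\<^sub>m n n"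
    using nonzero_row_exists[OF W W0] by blast
  define b where "b = mat 1 e (\<lambda>(_, i). if i = j then 1 else (0 :: complex))"
  define b' where "b' = map_mat const2 b"
  have b: "b \<in> carrier_mat 1 e" and b': "b' \<in> carrier_mat 1 e" by (auto simp: b_def b'_def)
  have "b' = mat 1 e (\<lambda>(_, i). if i = j then 1 else 0)"
    by (auto simp: b'_def b_def one_pCons intro!: eq_matI)
  note j = j(2)[folded this]
  have kb': "kron (1\<^sub>m n) b' \<in> carrier_mat n (n * e)" using kron_carrier[OF one_carrier_mat b', of n] by simp
  define N where "N = kron (1\<^sub>m n) b' * adj_mat M * kron (1\<^sub>m n) c'"
  have N: "N \<in> carrier_mat n n" using kb' a(1) kc' by (auto simp: N_def)
  have N0: "N \<noteq> 0\<^sub>m n n" using j by (simp add: N_def assoc_mult_mat[OF kb' a(1) kc'])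
  have fixc: "map_mat (twist_inner \<omega>) (map_mat const2 A) = map_mat const2 A"
    "map_mat (twist_outer \<omega>) (map_mat const2 A) = map_mat const2 A" for A
    by (auto intro!: eq_matI)
  have cl: "const2 \<omega> * const2 (inverse \<omega>) = 1" "const2 (inverse \<omega>) * const2 \<omega> = 1"
    using w0 by (auto simp: one_pCons)
  have dN: "det N \<noteq> 0"
  proof (rule det_twisted_nonzero[OF N N0 n w])
    show "map_mat (twist_inner \<omega>) N = shift_mat n * N * (shift_mat n)\<^sup>T"
      unfolding N_def M_def
      by (rule map_adj_corner_conj[OF twist_inner_hom tZ Q' b' c' _ _ _ _ _ _ _ Z(3)])
        (use dM in \<open>auto simp: Q'_def b'_def c'_def fixc shift_mat_inverse M_def\<close>)
    show "map_mat (twist_outer \<omega>) N = clock_mat n (const2 \<omega>) * N * clock_mat n (const2 (inverse \<omega>))"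
      unfolding N_def M_def
      by (rule map_adj_corner_conj[OF twist_outer_hom tZ Q' b' c' _ _ _ _ _ _ _ Z(4)])
        (use dM in \<open>auto simp: Q'_def b'_def c'_def fixc clock_mat_inverse[OF cl(1)] clock_mat_inverse[OF cl(2)] M_def\<close>)
  qed
  \<comment> \<open>A specialization that keeps both the pencil and the corner invertible. The
    resulting point X is in general not Y.\<close>
  with dM obtain \<alpha> \<beta> where ab: "eval2 \<alpha> \<beta> (det N * det M) \<noteq> 0"
    using eval2_nonzero_exists[of "det N * det M"] by auto
  interpret ev: comm_ring_hom "eval2 \<alpha> \<beta>" by (rule eval2_hom)
  define X where "X i = map_mat (eval2 \<alpha> \<beta>) (Z i)" for i
  define M' where "M' = pencil n e Q X"
  have M': "map_mat (eval2 \<alpha> \<beta>) M = M'" unfolding M'_def X_def by (rule evM)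
  have dM': "det M' = eval2 \<alpha> \<beta> (det M)" unfolding M'[symmetric] by (rule ev.hom_det)
  have cM': "M' \<in> carrier_mat (n * e) (n * e)" by (simp add: M'_def)
  have X: "X \<in> pdom n e Q" using Z(1) ab dM' by (auto simp: pdom_def tuple_def X_def M'_def)
  define A' where "A' = map_mat (eval2 \<alpha> \<beta>) (adj_mat M)"
  have A': "A' \<in> carrier_mat (n * e) (n * e)" using a(1) by (simp add: A'_def)
  have "A' * M' = map_mat (eval2 \<alpha> \<beta>) (det M \<cdot>\<^sub>m 1\<^sub>m (n * e))"
    unfolding A'_def M'[symmetric] ev.mat_hom_mult[OF a(1) M, symmetric] a(3) by simp
  also have "\<dots> = det M' \<cdot>\<^sub>m 1\<^sub>m (n * e)" unfolding dM' by (auto intro!: eq_matI)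
  finally have AM: "A' * M' = det M' \<cdot>\<^sub>m 1\<^sub>m (n * e)" .
  have "minv M' = (1 / det M') \<cdot>\<^sub>m A'"
  proof (rule minv_eqI'[OF cM'])
    show "(1 / det M') \<cdot>\<^sub>m A' * M' = 1\<^sub>m (n * e)"
      using ab dM' unfolding mult_smult_assoc_mat[OF A' cM'] AM by (auto intro!: eq_matI)
  qed (use A' in simp)
  then have "pval n e b Q c X = (1 / det M') \<cdot>\<^sub>m (kron (1\<^sub>m n) b * A' * kron (1\<^sub>m n) c)"
    unfolding pval_def M'_def[symmetric]
    using kron_carrier[OF one_carrier_mat[of n] b] kron_carrier[OF one_carrier_mat[of n] c(1)] A'
    by (simp add: mult_smult_distrib[OF _ A'] mult_smult_assoc_mat[OF mult_carrier_mat[OF _ A']])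
  also have "kron (1\<^sub>m n) b * A' * kron (1\<^sub>m n) c = map_mat (eval2 \<alpha> \<beta>) N"
    unfolding N_def A'_def using evc[of \<beta> \<alpha> b, folded b'_def] evc[of \<beta> \<alpha> c, folded c'_def]
    by (simp add: ev.mat_hom_mult[OF mult_carrier_mat[OF kb' a(1)] kc'] ev.mat_hom_mult[OF kb' a(1)]
       kron_map[OF eval2_hom] ev.mat_hom_one)
  finally have "det (pval n e b Q c X) = (1 / det M') ^ n * eval2 \<alpha> \<beta> (det N)"
    using N by simp
  then have "det (pval n e b Q c X) \<noteq> 0" using ab dM' by simp
  with b X show ?thesis by blast
qed

section \<open>Reducing the size of a pencil\<close>

text \<open>Let k be a position where c is nonzero. B projects along c onto the remaining
  coordinates, B' inserts a zero at position k, and b is the multiple of the k-th coordinate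
  functional with b c = 1.\<close>

lemma complement_exists:
  fixes c :: "'a :: field mat"
  assumes c: "c \<in> carrier_mat e 1" "c \<noteq> 0\<^sub>m e 1"
  shows "\<exists>B \<in> carrier_mat (e - 1) e. \<exists>B' \<in> carrier_mat e (e - 1). \<exists>b \<in> carrier_mat 1 e.
     B * B' = 1\<^sub>m (e - 1) \<and> B' * B = 1\<^sub>m e - c * b \<and> B * c = 0\<^sub>m (e - 1) 1"
proof -
  obtain k where k: "k < e" "c $$ (k, 0) \<noteq> 0"
    using c by (metis carrier_matD eq_matI index_zero_mat less_one)
  \<comment> \<open>\<open>ins\<close> enumerates the indices other than k in increasing order;
    \<open>del\<close> is its left inverse.\<close>
  define ins where "ins i = (if i < k then i else Suc i)" for i
  define del where "del j = (if j < k then j else j - 1)" for j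
  have ins: "ins i \<noteq> k" "i < e - 1 \<Longrightarrow> ins i < e" "ins i = ins j \<longleftrightarrow> i = j" "del (ins i) = i" for i j
    using k by (auto simp: ins_def del_def)
  have del: "j < e \<Longrightarrow> j \<noteq> k \<Longrightarrow> ins (del j) = j" "j < e \<Longrightarrow> j \<noteq> k \<Longrightarrow> del j < e - 1" for j
    using k by (auto simp: ins_def del_def)
  have eq_ins: "j = ins i \<longleftrightarrow> i = del j" if "j < e" "j \<noteq> k" for i j
    using ins(4) del(1)[OF that] by metis
  define B where "B = mat (e - 1) e (\<lambda>(i, j). (if j = ins i then 1 else 0) - (if j = k then c $$ (ins i, 0) / c $$ (k, 0) else 0))"
  define B' where "B' = mat e (e - 1) (\<lambda>(j, i). if j = ins i then 1 else (0 :: 'a))"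
  define b where "b = mat 1 e (\<lambda>(_, j). if j = k then 1 / c $$ (k, 0) else 0)"
  have cB: "B \<in> carrier_mat (e - 1) e" "B' \<in> carrier_mat e (e - 1)" "b \<in> carrier_mat 1 e"
    by (auto simp: B_def B'_def b_def)
  have "B * B' = 1\<^sub>m (e - 1)"
  proof (rule eq_matI)
    fix i j assume "i < dim_row (1\<^sub>m (e - 1) :: 'a mat)" "j < dim_col (1\<^sub>m (e - 1) :: 'a mat)"
    then have ij: "i < e - 1" "j < e - 1" by auto
    have "(B * B') $$ (i, j) = (\<Sum>l = 0..<e. if l = ins j then B $$ (i, l) else 0)"
      unfolding index_mult_mat_sum[OF cB(1,2) ij] using ij by (intro sum.cong refl) (simp add: B'_def)
    also have "\<dots> = 1\<^sub>m (e - 1) $$ (i, j)"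
      using ij ins by (auto simp: B_def)
    finally show "(B * B') $$ (i, j) = 1\<^sub>m (e - 1) $$ (i, j)" .
  qed (use cB in auto)
  moreover have "B' * B = 1\<^sub>m e - c * b"
  proof (rule eq_matI)
    fix j m assume "j < dim_row (1\<^sub>m e - c * b)" "m < dim_col (1\<^sub>m e - c * b)"
    then have jm: "j < e" "m < e" using c cB by auto
    have r: "(1\<^sub>m e - c * b) $$ (j, m) = (if j = m then 1 else 0) - (if m = k then c $$ (j, 0) / c $$ (k, 0) else 0)"
      using jm c cB by (simp add: b_def scalar_prod_def)
    have "(B' * B) $$ (j, m) = (\<Sum>i = 0..<e - 1. if j = ins i then B $$ (i, m) else 0)"
      unfolding index_mult_mat_sum[OF cB(2,1) jm] using jm by (intro sum.cong refl) (simp add: B'_def)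
    also have "\<dots> = (1\<^sub>m e - c * b) $$ (j, m)"
    proof (cases "j = k")
      case True
      then have "(\<Sum>i = 0..<e - 1. if j = ins i then B $$ (i, m) else 0) = 0"
        using ins(1) by (intro sum.neutral) metis
      then show ?thesis using True k unfolding r by auto
    next
      case False
      then have "(\<Sum>i = 0..<e - 1. if j = ins i then B $$ (i, m) else 0) = B $$ (del j, m)"
        using jm del(2)[of j] by (simp add: eq_ins)
      then show ?thesis using False jm del(1)[of j] del(2)[of j] unfolding r by (auto simp: B_def)
    qed
    finally show "(B' * B) $$ (j, m) = (1\<^sub>m e - c * b) $$ (j, m)" .
  qed (use cB c in auto)
  moreover have "B * c = 0\<^sub>m (e - 1) 1"
  proof (rule eq_matI)
    fix i j assume "i < dim_row (0\<^sub>m (e - 1) 1 :: 'a mat)" "j < dim_col (0\<^sub>m (e - 1) 1 :: 'a mat)"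
    then have ij: "i < e - 1" "j = 0" by auto
    have "(B * c) $$ (i, j) = (\<Sum>l = 0..<e. (if l = ins i then c $$ (l, 0) else 0) -
         (if l = k then c $$ (ins i, 0) / c $$ (k, 0) * c $$ (l, 0) else 0))"
      using ij by (subst index_mult_mat_sum[OF cB(1) c(1)]) (auto simp: B_def intro!: sum.cong)
    also have "\<dots> = 0" using k ins(2)[OF ij(1)] by (simp add: sum_subtractf)
    finally show "(B * c) $$ (i, j) = 0\<^sub>m (e - 1) 1 $$ (i, j)" using ij by simp
  qed (use cB c in auto)
  ultimately show ?thesis using cB by blast
qed

lemma complement_exists_row:
  fixes b :: "'a :: field mat"
  assumes b: "b \<in> carrier_mat 1 e" "b \<noteq> 0\<^sub>m 1 e"
  shows "\<exists>S \<in> carrier_mat e (e - 1). \<exists>S' \<in> carrier_mat (e - 1) e. \<exists>c \<in> carrier_mat e 1.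
     S' * S = 1\<^sub>m (e - 1) \<and> S * S' = 1\<^sub>m e - c * b"
proof -
  have bT: "b\<^sup>T \<in> carrier_mat e 1" "b\<^sup>T \<noteq> 0\<^sub>m e 1"
    using b by (auto, metis transpose_transpose zero_transpose_mat)
  obtain B B' a where B: "B \<in> carrier_mat (e - 1) e" "B' \<in> carrier_mat e (e - 1)" "a \<in> carrier_mat 1 e"
     "B * B' = 1\<^sub>m (e - 1)" "B' * B = 1\<^sub>m e - b\<^sup>T * a"
    using complement_exists[OF bT] by blast
  have "B'\<^sup>T * B\<^sup>T = 1\<^sub>m (e - 1)" using transpose_mult[OF B(1,2)] B(4) by simp
  moreover have "B\<^sup>T * B'\<^sup>T = 1\<^sub>m e - a\<^sup>T * b"
    using transpose_mult[OF B(2,1)] transpose_mult[OF bT(1) B(3)]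
    unfolding B(5) by (subst (asm) transpose_minus[of _ e e]) (use B b in auto)
  ultimately show ?thesis using B by (intro bexI[of _ "B\<^sup>T"] bexI[of _ "B'\<^sup>T"] bexI[of _ "a\<^sup>T"]) auto
qed

lemma kron_one_zero: "kron (1\<^sub>m n) (0\<^sub>m e f) = 0\<^sub>m (n * e) (n * f)"
  by (intro eq_matI) (auto simp: kron_index[of _ n n _ e f] mod_less_of_less_mult)

lemma kron_one_minus:
  assumes "A \<in> carrier_mat e f" "B \<in> carrier_mat e f"
  shows "kron (1\<^sub>m n) (A - B) = kron (1\<^sub>m n) A - kron (1\<^sub>m n) B"
proof -
  have "A - B \<in> carrier_mat e f" using assms by auto
  then show ?thesis using assms
    by (intro eq_matI) (auto simp: kron_index[of _ n n _ e f] mod_less_of_less_mult div_less_of_less_mult algebra_simps)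
qed

lemma pencil_sandwich:
  assumes "B \<in> carrier_mat e' e" "D \<in> carrier_mat e e'" "tuple n X" "tuple e Q"
  shows "pencil n e' (\<lambda>i. B * Q i * D) X = kron (1\<^sub>m n) B * pencil n e Q X * kron (1\<^sub>m n) D"
  unfolding pencil_def by (rule pev_one_sandwich[symmetric]) (use assms in auto)

lemma kron_one_carrier:
  "A \<in> carrier_mat e 1 \<Longrightarrow> kron (1\<^sub>m n) A \<in> carrier_mat (n * e) n"
  "A \<in> carrier_mat 1 e \<Longrightarrow> kron (1\<^sub>m n) A \<in> carrier_mat n (n * e)"
  using kron_carrier[of "1\<^sub>m n" n n A e 1] kron_carrier[of "1\<^sub>m n" n n A 1 e] by auto

lemma pval_carrier:
  "u \<in> carrier_mat 1 e \<Longrightarrow> v \<in> carrier_mat e 1 \<Longrightarrow> pval n e u Q v X \<in> carrier_mat n n"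
  unfolding pval_def by (auto intro!: mult_carrier_mat[where n = "n * e"] kron_one_carrier)

text \<open>Put G = M^-1, J = (A G C)^-1 and H = G - G C J A G; the invertible corner A G C is what
  makes H available. Then A H = 0 and M H = 1 - C J A G. From S S' = 1 - D A it follows that S S' H
  = H, and from B C = 0 that B M H = B. So S' H B' is a right inverse of B M S.\<close>

lemma compression_invertible:
  fixes M :: "'a :: field mat"
  assumes M: "M \<in> carrier_mat N N" "det M \<noteq> 0"
    and B: "B \<in> carrier_mat p N" "B' \<in> carrier_mat N p" "B * B' = 1\<^sub>m p"
    and C: "C \<in> carrier_mat N n" "B * C = 0\<^sub>m p n"
    and S: "S \<in> carrier_mat N p" "S' \<in> carrier_mat p N"
    and A: "A \<in> carrier_mat n N" "D \<in> carrier_mat N n" "S * S' = 1\<^sub>m N - D * A"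
    and K: "det (A * minv M * C) \<noteq> 0"
  shows "det (B * M * S) \<noteq> 0"
proof -
  define G where "G = minv M"
  have G: "G \<in> carrier_mat N N" "M * G = 1\<^sub>m N" using minv_inverse[OF M] M by (auto simp: G_def)
  define L where "L = A * G * C"
  have L: "L \<in> carrier_mat n n" using A C G by (auto simp: L_def)
  define J where "J = minv L"
  have J: "J \<in> carrier_mat n n" "L * J = 1\<^sub>m n"
    using minv_inverse[OF L] K L by (auto simp: J_def L_def G_def)
  define H where "H = G - G * (C * (J * (A * G)))"
  have W: "C * (J * (A * G)) \<in> carrier_mat N N"
    by (rule mult_carrier_mat[OF C(1) mult_carrier_mat[OF J(1) mult_carrier_mat[OF A(1) G(1)]]])
  have GW: "G * (C * (J * (A * G))) \<in> carrier_mat N N" by (rule mult_carrier_mat[OF G(1) W])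
  have H: "H \<in> carrier_mat N N" unfolding H_def using GW by (rule minus_carrier_mat)
  have "A * (G * (C * (J * (A * G)))) = L * J * (A * G)"
    using A(1) C(1) G(1) J(1) by (simp add: L_def mat_mult_assoc)
  also have "\<dots> = A * G" using J A G by simp
  finally have "A * H = 0\<^sub>m n N"
    unfolding H_def using mult_minus_distrib_mat[OF A(1) G(1) GW] A G by auto
  then have "(D * A) * H = 0\<^sub>m N N" using A H by (simp add: mat_mult_assoc)
  then have SH: "S * S' * H = H"
    unfolding A(3) using minus_mult_distrib_mat[of "1\<^sub>m N" N N "D * A" H N] H A by (auto intro!: eq_matI)
  have "M * (G * (C * (J * (A * G)))) = C * (J * (A * G))"
    using assoc_mult_mat[OF M(1) G(1) W] unfolding G(2) left_mult_one_mat[OF W] by simp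
  then have MH: "M * H = 1\<^sub>m N - C * (J * (A * G))"
    unfolding H_def using mult_minus_distrib_mat[OF M(1) G(1) GW] G by simp
  have "B * (C * (J * (A * G))) = 0\<^sub>m p N"
    using assoc_mult_mat[of B p N C n "J * (A * G)" N] B C A G J by simp
  then have BMH: "B * (M * H) = B"
    unfolding MH using mult_minus_distrib_mat[OF B(1) one_carrier_mat W] B by (auto intro!: eq_matI)
  have "B * M * S * (S' * H * B') = B * (M * (S * S' * H)) * B'"
    using B M S H by (simp add: mat_mult_assoc)
  also have "\<dots> = 1\<^sub>m p" unfolding SH BMH B(3) ..
  finally show ?thesis
    by (rule det_nonzeroI(1)[rotated 2])
      (use B(1,2) M(1) S H in \<open>auto intro!: mult_carrier_mat[where n = N]\<close>)
qed

text \<open>Let y = u Q^-1. Since y c = 0, the row y equals y B' B for the projection B along c, and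
  u S = y Q S = (y B') (B Q S). So the compressed pencil B Q S with the vectors u S and B v has the
  same value. It is nondegenerate because S comes from a row b for which b Q^-1 c is invertible at
  some point.\<close>

lemma pencil_reduction:
  fixes Q :: "'d :: finite option \<Rightarrow> complex mat"
  assumes Q: "tuple e Q" and u: "u \<in> carrier_mat 1 e" and v: "v \<in> carrier_mat e 1" and nd: "pnondeg e Q"
    and T: "tuple f T" "pnondeg f T"
    and c: "c \<in> carrier_mat e 1" "c \<noteq> 0\<^sub>m e 1"
    and ann: "\<And>n X. n \<ge> 1 \<Longrightarrow> X \<in> pdom n e Q \<Longrightarrow> X \<in> pdom n f T \<Longrightarrow> pval n e u Q c X = 0\<^sub>m n n"
  shows "\<exists>u' Q' v'. tuple (e - 1) Q' \<and> u' \<in> carrier_mat 1 (e - 1) \<and> v' \<in> carrier_mat (e - 1) 1 \<and>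
    pnondeg (e - 1) Q' \<and> pequiv e u Q v (e - 1) u' Q' v'"
proof -
  obtain n X0 where n: "n \<ge> 1" "X0 \<in> pdom n e Q" using nd by (auto simp: pnondeg_def)
  obtain b X where b: "b \<in> carrier_mat 1 e" and X: "X \<in> pdom n e Q" and dbc: "det (pval n e b Q c X) \<noteq> 0"
    using invertible_corner_exists[OF Q n c] by blast
  \<comment> \<open>A zero row would give the value zero, whose determinant vanishes because n is
    positive.\<close>
  have "b \<noteq> 0\<^sub>m 1 e"
  proof
    assume b0: "b = 0\<^sub>m 1 e"
    have "pval n e b Q c X = 0\<^sub>m n n"
      unfolding pval_def b0 using kron_one_carrier(1)[OF c(1), of n] kron_one_zero[where ?'a = complex, of n 1 e] by (simp add: left_mult_zero_mat[of _ "n * e"])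
    then have "det (0\<^sub>m n n :: complex mat) \<noteq> 0" using dbc by simp
    moreover have "(0\<^sub>m n n :: complex mat) = 0 \<cdot>\<^sub>m 1\<^sub>m n" by (auto intro!: eq_matI)
    ultimately show False using n by (metis det_smult index_one_mat(3) mult_zero_left not_one_le_zero power_0_left)
  qed
  note b = b this
  obtain B B' a where B: "B \<in> carrier_mat (e - 1) e" "B' \<in> carrier_mat e (e - 1)" "a \<in> carrier_mat 1 e"
     "B * B' = 1\<^sub>m (e - 1)" "B' * B = 1\<^sub>m e - c * a" "B * c = 0\<^sub>m (e - 1) 1"
    using complement_exists[OF c] by blast
  obtain S S' d where S: "S \<in> carrier_mat e (e - 1)" "S' \<in> carrier_mat (e - 1) e" "d \<in> carrier_mat e 1"
     "S' * S = 1\<^sub>m (e - 1)" "S * S' = 1\<^sub>m e - d * b"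
    using complement_exists_row[OF b] by blast
  define Q' where "Q' i = B * Q i * S" for i
  have Q': "tuple (e - 1) Q'"
    unfolding tuple_def Q'_def using B S tupleD[OF Q] by (auto intro!: mult_carrier_mat[where n = e])
  have u': "u * S \<in> carrier_mat 1 (e - 1)" and v': "B * v \<in> carrier_mat (e - 1) 1" using u v S B by auto
  let ?k = "\<lambda>m. kron (1\<^sub>m m)"
  have pen: "pencil m (e - 1) Q' Y = ?k m B * pencil m e Q Y * ?k m S" if "tuple m Y" for m Y
    unfolding Q'_def by (rule pencil_sandwich[OF B(1) S(1) that Q])
  have nd': "pnondeg (e - 1) Q'"
  proof -
    have X': "tuple n X" "det (pencil n e Q X) \<noteq> 0" using X by (auto simp: pdom_def)
    have "det (?k n B * pencil n e Q X * ?k n S) \<noteq> 0"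
    proof (rule compression_invertible[OF pencil_carrier X'(2)])
      show "?k n B * ?k n B' = 1\<^sub>m (n * (e - 1))" using kron_one_mult[OF B(1,2)] B(4) by simp
      show "?k n B * ?k n c = 0\<^sub>m (n * (e - 1)) n" using kron_one_mult[OF B(1) c(1)] B(6) by (simp add: kron_one_zero)
      show "?k n S * ?k n S' = 1\<^sub>m (n * e) - ?k n d * ?k n b"
        unfolding kron_one_mult[OF S(1,2)] kron_one_mult[OF S(3) b(1)] S(5)
        by (subst kron_one_minus[OF one_carrier_mat]) (use S b in auto)
      show "det (?k n b * minv (pencil n e Q X) * ?k n c) \<noteq> 0" using dbc by (simp add: pval_def)
    qed (use B S b c in \<open>auto intro: kron_one_carrier\<close>)
    then have "X \<in> pdom n (e - 1) Q'" using X' by (simp add: pdom_def pen[OF X'(1)] del: One_nat_def)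
    with n show ?thesis by (auto simp: pnondeg_def)
  qed
  \<comment> \<open>The annihilation of c is known only where T is invertible as well, so equality
    is shown there and extended by density.\<close>
  have "pequiv e u Q v (e - 1) (u * S) Q' (B * v)"
  proof (rule pequivI_generic[OF Q u v Q' u' v' T])
    fix m Y assume m: "m \<ge> (1 :: nat)" and Y: "Y \<in> pdom m e Q" "Y \<in> pdom m (e - 1) Q'" "Y \<in> pdom m f T"
    define M where "M = pencil m e Q Y"
    have M: "M \<in> carrier_mat (m * e) (m * e)" "det M \<noteq> 0" using Y by (auto simp: M_def pdom_def)
    have M': "pencil m (e - 1) Q' Y = ?k m B * M * ?k m S" using pen Y by (auto simp: M_def pdom_def)
    define N where "N = ?k m B * M * ?k m S"
    have N: "N \<in> carrier_mat (m * (e - 1)) (m * (e - 1))" "det N \<noteq> 0" using Y M' pencil_carrier[of m "e - 1" Q' Y] by (auto simp: N_def pdom_def)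
    define y where "y = ?k m u * minv M"
    have y: "y \<in> carrier_mat m (m * e)" unfolding y_def by (rule mult_carrier_mat[OF kron_one_carrier(2)[OF u] minv_carrier[OF M(1)]])
    have yc: "y * ?k m c = 0\<^sub>m m m" using ann[OF m Y(1,3)] by (simp add: y_def pval_def M_def)
    have "?k m B' * ?k m B = 1\<^sub>m (m * e) - ?k m c * ?k m a"
      unfolding kron_one_mult[OF B(2,1)] kron_one_mult[OF c(1) B(3)] B(5)
      by (subst kron_one_minus[OF one_carrier_mat]) (use B c in auto)
    moreover have "y * (1\<^sub>m (m * e) - ?k m c * ?k m a) = y - y * ?k m c * ?k m a"
      using y kron_one_carrier(1)[OF c(1), of m] kron_one_carrier(2)[OF B(3), of m]
      by (simp add: mult_minus_distrib_mat[OF y one_carrier_mat] assoc_mult_mat[OF y])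
    ultimately have yB: "y * (?k m B' * ?k m B) = y"
      using y yc kron_one_carrier(2)[OF B(3), of m]
      by (simp add: left_mult_zero_mat[of _ m]) (auto intro!: eq_matI)
    have yM: "y * M = ?k m u" unfolding y_def
      using assoc_mult_mat[OF kron_one_carrier(2)[OF u] minv_carrier[OF M(1)] M(1)] minv_inverse(2)[OF M]
        right_mult_one_mat[OF kron_one_carrier(2)[OF u]] by simp
    have "?k m (u * S) = y * M * ?k m S" unfolding yM using kron_one_mult[OF u S(1)] by simp
    also have "\<dots> = y * (?k m B' * ?k m B) * M * ?k m S" unfolding yB ..
    also have "\<dots> = y * ?k m B' * N" unfolding N_def using y M(1) B S by (simp add: mat_mult_assoc)
    finally have "?k m (u * S) * minv N = y * ?k m B' * (N * minv N)"
      using y B N by (simp add: mat_mult_assoc)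
    then have "?k m (u * S) * minv N = y * ?k m B'"
      using minv_inverse[OF N] y B by simp
    then have "pval m (e - 1) (u * S) Q' (B * v) Y = y * ?k m B' * ?k m (B * v)"
      unfolding pval_def M' N_def[symmetric] by simp
    also have "\<dots> = y * (?k m B' * ?k m B) * ?k m v"
      unfolding kron_one_mult[OF B(1) v, symmetric] using y B v by (simp add: mat_mult_assoc)
    also have "\<dots> = pval m e u Q v Y" unfolding yB by (simp add: y_def pval_def M_def)
    finally show "pval m e u Q v Y = pval m (e - 1) (u * S) Q' (B * v) Y" ..
  qed
  with Q' u' v' nd' show ?thesis by blast
qed

section \<open>Transposition, which exchanges the roles of the row u and the column v\<close>

abbreviation tr :: "('i \<Rightarrow> 'a mat) \<Rightarrow> 'i \<Rightarrow> 'a mat" where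
  "tr Q \<equiv> (\<lambda>i. (Q i)\<^sup>T)"

lemma tuple_tr [simp]: "tuple e (tr Q) \<longleftrightarrow> tuple e Q"
  by (auto simp: tuple_def)

lemma pencil_tr:
  assumes "tuple n X" "tuple e Q"
  shows "pencil n e (tr Q) (tr X) = (pencil n e Q X)\<^sup>T"
proof -
  have "aff_ext n (tr X) = tr (aff_ext n X)" by (auto simp: aff_ext_def fun_eq_iff split: option.split)
  then show ?thesis using assms by (simp add: pencil_def pev_transpose)
qed

lemma pdom_tr:
  assumes "tuple e Q"
  shows "tr X \<in> pdom n e (tr Q) \<longleftrightarrow> X \<in> pdom n e Q"
proof (cases "tuple n X")
  case True
  then show ?thesis using assms by (simp add: pdom_def pencil_tr det_transpose[OF pencil_carrier])
next
  case False
  then show ?thesis by (simp add: pdom_def)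
qed

lemma pnondeg_tr: "tuple e Q \<Longrightarrow> pnondeg e (tr Q) \<longleftrightarrow> pnondeg e Q"
proof -
  assume Q: "tuple e Q"
  have "X \<in> pdom n e (tr Q) \<longleftrightarrow> tr X \<in> pdom n e Q" for n X
    using pdom_tr[OF Q, of "tr X" n] by simp
  then have "pdom n e (tr Q) \<noteq> {} \<longleftrightarrow> pdom n e Q \<noteq> {}" for n
    using pdom_tr[OF Q, of _ n] by (metis equals0I ex_in_conv)
  then show ?thesis by (simp add: pnondeg_def)
qed

lemma pval_tr:
  assumes X: "X \<in> pdom n e Q" and Q: "tuple e Q" and u: "u \<in> carrier_mat a e" and v: "v \<in> carrier_mat e b"
  shows "pval n e v\<^sup>T (tr Q) u\<^sup>T (tr X) = (pval n e u Q v X)\<^sup>T"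
proof -
  have X': "tuple n X" "det (pencil n e Q X) \<noteq> 0" using X by (auto simp: pdom_def)
  have c: "kron (1\<^sub>m n) u \<in> carrier_mat (n * a) (n * e)" "kron (1\<^sub>m n) v \<in> carrier_mat (n * e) (n * b)"
    "minv (pencil n e Q X) \<in> carrier_mat (n * e) (n * e)" using u v by auto
  show ?thesis
    unfolding pval_def pencil_tr[OF X'(1) Q] minv_transpose[OF pencil_carrier X'(2)]
      transpose_mult[OF mult_carrier_mat[OF c(1,3)] c(2)] transpose_mult[OF c(1,3)] kron_transpose
    using c u v by (simp add: kron_transpose[symmetric] mat_mult_assoc)
qed

lemma pequiv_tr:
  assumes "tuple e Q" "u \<in> carrier_mat 1 e" "v \<in> carrier_mat e 1"
    "tuple e' Q'" "u' \<in> carrier_mat 1 e'" "v' \<in> carrier_mat e' 1"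
    and eq: "pequiv e u Q v e' u' Q' v'"
  shows "pequiv e v\<^sup>T (tr Q) u\<^sup>T e' v'\<^sup>T (tr Q') u'\<^sup>T"
  unfolding pequiv_def
proof (intro allI impI ballI)
  fix n X assume n: "n \<ge> (1 :: nat)" and X: "X \<in> pdom n e (tr Q) \<inter> pdom n e' (tr Q')"
  have X': "tr X \<in> pdom n e Q" "tr X \<in> pdom n e' Q'"
    using X pdom_tr[OF assms(1), of "tr X" n] pdom_tr[OF assms(4), of "tr X" n] by simp_all
  then show "pval n e v\<^sup>T (tr Q) u\<^sup>T X = pval n e' v'\<^sup>T (tr Q') u'\<^sup>T X"
    using pval_tr[OF X'(1) assms(1-3)] pval_tr[OF X'(2) assms(4-6)] eq n by (simp add: pequiv_def)
qed

text \<open>The column version applied to the transposed pencil, with the smaller pencil transposed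
  back.\<close>

lemma pencil_reduction_tr:
  fixes Q :: "'d :: finite option \<Rightarrow> complex mat"
  assumes Q: "tuple e Q" and u: "u \<in> carrier_mat 1 e" and v: "v \<in> carrier_mat e 1" and nd: "pnondeg e Q"
    and T: "tuple f T" "pnondeg f T"
    and c: "c \<in> carrier_mat 1 e" "c \<noteq> 0\<^sub>m 1 e"
    and ann: "\<And>n X. n \<ge> 1 \<Longrightarrow> X \<in> pdom n e Q \<Longrightarrow> X \<in> pdom n f T \<Longrightarrow> pval n e c Q v X = 0\<^sub>m n n"
  shows "\<exists>u' Q' v'. tuple (e - 1) Q' \<and> u' \<in> carrier_mat 1 (e - 1) \<and> v' \<in> carrier_mat (e - 1) 1 \<and>
    pnondeg (e - 1) Q' \<and> pequiv e u Q v (e - 1) u' Q' v'"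
proof -
  have c': "c\<^sup>T \<in> carrier_mat e 1" "c\<^sup>T \<noteq> 0\<^sub>m e 1"
    using c by (auto, metis transpose_transpose zero_transpose_mat)
  have "pval n e v\<^sup>T (tr Q) c\<^sup>T X = 0\<^sub>m n n"
    if "n \<ge> 1" "X \<in> pdom n e (tr Q)" "X \<in> pdom n f (tr T)" for n X
  proof -
    have X': "tr X \<in> pdom n e Q" "tr X \<in> pdom n f T"
      using that pdom_tr[OF Q, of "tr X" n] pdom_tr[OF T(1), of "tr X" n] by simp_all
    show ?thesis using pval_tr[OF X'(1) Q c(1) v] ann[OF that(1) X'] by (simp add: zero_transpose_mat)
  qed
  then obtain u' Q' v' where *: "tuple (e - 1) Q'" "u' \<in> carrier_mat 1 (e - 1)" "v' \<in> carrier_mat (e - 1) 1"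
    "pnondeg (e - 1) Q'" "pequiv e v\<^sup>T (tr Q) u\<^sup>T (e - 1) u' Q' v'"
    using pencil_reduction[of e "tr Q" "v\<^sup>T" "u\<^sup>T" f "tr T" "c\<^sup>T"] assms c'
    by (auto simp: pnondeg_tr)
  have "pequiv e u Q v (e - 1) v'\<^sup>T (tr Q') u'\<^sup>T"
    using pequiv_tr[of e "tr Q" "v\<^sup>T" "u\<^sup>T", OF _ _ _ *(1-3,5)] Q u v by simp
  with * show ?thesis by (intro exI[of _ "v'\<^sup>T"] exI[of _ "tr Q'"] exI[of _ "u'\<^sup>T"]) (auto simp: pnondeg_tr)
qed

section \<open>The domain of a minimal pencil\<close>

text \<open>A proper subspace is killed by a nonzero functional; induction on the number e of
  coordinates. If the subspace has an element s1 with last coordinate 1, its slice with last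
  coordinate 0 has no annihilator either, and s1 adds the last direction. Otherwise all last
  coordinates vanish, so the last coordinate functional is an annihilator. Functions stand for
  tuples of length e, hence P must ignore the coordinates from e on.\<close>

lemma subspace_eq_if_no_annihilator_fun:
  fixes P :: "(nat \<Rightarrow> 'a :: field) \<Rightarrow> bool"
  assumes "P (\<lambda>_. 0)" "\<And>s s'. P s \<Longrightarrow> P s' \<Longrightarrow> P (\<lambda>i. s i + s' i)" "\<And>c s. P s \<Longrightarrow> P (\<lambda>i. c * s i)"
    and "\<And>s s'. P s \<Longrightarrow> (\<And>i. i < e \<Longrightarrow> s' i = s i) \<Longrightarrow> P s'"
    and "\<And>c. (\<And>s. P s \<Longrightarrow> (\<Sum>i<e. s i * c i) = 0) \<Longrightarrow> (\<forall>i<e. c i = 0)"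
  shows "P s"
  using assms
proof (induction e arbitrary: P s)
  case (0 P s)
  show ?case by (rule "0.prems"(4)[OF "0.prems"(1)]) simp
next
  case (Suc e P s)
  note P = Suc.prems
  show ?case
  proof (cases "\<exists>s1. P s1 \<and> s1 e = 1")
    case True
    then obtain s1 where s1: "P s1" "s1 e = 1" by blast
    have diff: "P (\<lambda>i. s i - s e * s1 i)" if "P s" for s
      using P(2)[OF that P(3)[OF s1(1), of "- s e"]] by simp
    have "P (s(e := 0))" for s
    proof (rule Suc.IH[where P = "\<lambda>s. P (s(e := 0))"])
      fix c assume c: "\<And>s. P (s(e := 0)) \<Longrightarrow> (\<Sum>i<e. s i * c i) = 0"
      \<comment> \<open>The functional on the slice is extended so that it vanishes at s1.\<close>
      define c' where "c' = c(e := - (\<Sum>i<e. s1 i * c i))"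
      have "(\<Sum>i<Suc e. s i * c' i) = 0" if "P s" for s
      proof -
        have "(\<lambda>i. s i - s e * s1 i)(e := 0) = (\<lambda>i. s i - s e * s1 i)" using s1 by auto
        then have "(\<Sum>i<e. (s i - s e * s1 i) * c i) = 0" using diff[OF that] by (intro c) simp
        then show ?thesis
          by (simp add: c'_def sum_subtractf algebra_simps sum_distrib_left)
      qed
      from P(5)[OF this] have "\<forall>i<Suc e. c' i = 0" .
      then show "\<forall>i<e. c i = 0" by (auto simp: c'_def less_Suc_eq split: if_splits)
    next
      show "P ((\<lambda>_. 0)(e := 0))" using P(1) by (simp add: fun_upd_idem)
      show "P ((\<lambda>i. s i + s' i)(e := 0))" if "P (s(e := 0))" "P (s'(e := 0))" for s s'
        using P(2)[OF that] by (rule P(4)) auto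
      show "P ((\<lambda>i. c * s i)(e := 0))" if "P (s(e := 0))" for c s
        using P(3)[OF that, of c] by (rule P(4)) auto
      show "P (s'(e := 0))" if "P (s(e := 0))" "\<And>i. i < e \<Longrightarrow> s' i = s i" for s s'
        using that by (auto intro: P(4))
    qed
    then have "P ((\<lambda>i. s i - s e * s1 i)(e := 0))" .
    from P(2)[OF this P(3)[OF s1(1), of "s e"]] show ?thesis
      by (rule P(4)) (use s1 in \<open>auto\<close>)
  next
    case False
    have "s e = 0" if "P s" for s
    proof (rule ccontr)
      assume "s e \<noteq> 0"
      with P(3)[OF that, of "inverse (s e)"] False show False by auto
    qed
    then have "(\<Sum>i<Suc e. s i * (if i = e then 1 else 0)) = 0" if "P s" for s
      using that by simp
    from P(5)[OF this, rule_format, of e] show ?thesis by simp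
  qed
qed

lemma subspace_eq_if_no_annihilator:
  fixes S :: "'a :: field mat set"
  assumes S: "S \<subseteq> carrier_mat 1 e" "0\<^sub>m 1 e \<in> S" "\<And>s s'. s \<in> S \<Longrightarrow> s' \<in> S \<Longrightarrow> s + s' \<in> S"
     "\<And>c s. s \<in> S \<Longrightarrow> c \<cdot>\<^sub>m s \<in> S"
    and ann: "\<And>c. c \<in> carrier_mat e 1 \<Longrightarrow> (\<And>s. s \<in> S \<Longrightarrow> s * c = 0\<^sub>m 1 1) \<Longrightarrow> c = 0\<^sub>m e 1"
    and l: "l \<in> carrier_mat 1 e"
  shows "l \<in> S"
proof -
  define r where "r s = mat 1 e (\<lambda>(_, i). s i :: 'a)" for s
  have "r (\<lambda>i. l $$ (0, i)) \<in> S"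
  proof (rule subspace_eq_if_no_annihilator_fun[where P = "\<lambda>s. r s \<in> S" and e = e])
    have "r (\<lambda>_. 0) = 0\<^sub>m 1 e" by (auto simp: r_def intro!: eq_matI)
    with S(2) show "r (\<lambda>_. 0) \<in> S" by simp
    show "r (\<lambda>i. s i + s' i) \<in> S" if "r s \<in> S" "r s' \<in> S" for s s'
    proof -
      have "r (\<lambda>i. s i + s' i) = r s + r s'" by (auto simp: r_def intro!: eq_matI)
      with S(3)[OF that] show ?thesis by simp
    qed
    show "r (\<lambda>i. c * s i) \<in> S" if "r s \<in> S" for c s
    proof -
      have "r (\<lambda>i. c * s i) = c \<cdot>\<^sub>m r s" by (auto simp: r_def intro!: eq_matI)
      with S(4)[OF that] show ?thesis by simp
    qed
    show "r s' \<in> S" if "r s \<in> S" "\<And>i. i < e \<Longrightarrow> s' i = s i" for s s'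
    proof -
      have "r s' = r s" using that(2) by (auto simp: r_def intro!: eq_matI)
      with that(1) show ?thesis by simp
    qed
    fix c assume c: "\<And>s. r s \<in> S \<Longrightarrow> (\<Sum>i<e. s i * c i) = 0"
    define c' where "c' = mat e 1 (\<lambda>(i, _). c i)"
    have "c' = 0\<^sub>m e 1"
    proof (rule ann)
      fix s assume s: "s \<in> S"
      have "r (\<lambda>i. s $$ (0, i)) = s" using s S(1) by (auto simp: r_def intro!: eq_matI)
      then have "(\<Sum>i<e. s $$ (0, i) * c i) = 0" using s by (intro c) simp
      then show "s * c' = 0\<^sub>m 1 1"
        using s S(1) by (intro eq_matI) (auto simp: c'_def scalar_prod_def lessThan_atLeast0)
    qed (simp add: c'_def)
    then show "\<forall>i<e. c i = 0"
    proof -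
      assume *: "c' = 0\<^sub>m e 1"
      show ?thesis
    proof (intro allI impI)
      fix i assume "i < e"
      then have "c' $$ (i, 0) = 0" using * by simp
      then show "c i = 0" using \<open>i < e\<close> by (simp add: c'_def)
    qed
    qed
  qed
  moreover have "r (\<lambda>i. l $$ (0, i)) = l" using l by (auto simp: r_def intro!: eq_matI)
  ultimately show ?thesis by simp
qed

text \<open>X is only in the domain of T; that it lies in the domain of Q is the goal. So
  boundedness is asked along the lines from X whose points near X are in the domain of Q. All sizes
  are included because the argument passes to block tuples.\<close>

definition bounded_along :: "nat \<Rightarrow> ('d :: finite option \<Rightarrow> complex mat) \<Rightarrow> nat \<Rightarrow> complex mat \<Rightarrow>
    ('d option \<Rightarrow> complex mat) \<Rightarrow> complex mat \<Rightarrow> bool" where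
  "bounded_along f T e u Q v \<longleftrightarrow> (\<forall>n\<ge>1. \<forall>X\<in>pdom n f T. \<forall>Z. tuple n Z \<longrightarrow>
     (\<forall>\<^sub>F t in at 0. (\<lambda>i. X i + t \<cdot>\<^sub>m Z i) \<in> pdom n e Q) \<longrightarrow>
     bounded_entries n n (at 0) (\<lambda>t. pval n e u Q v (\<lambda>i. X i + t \<cdot>\<^sub>m Z i)))"

lemma pval_add_left:
  assumes "u \<in> carrier_mat 1 e" "u' \<in> carrier_mat 1 e" "v \<in> carrier_mat e 1"
  shows "pval n e (u + u') Q v X = pval n e u Q v X + pval n e u' Q v X"
proof -
  let ?G = "minv (pencil n e Q X)"
  have c: "kron (1\<^sub>m n) u \<in> carrier_mat n (n * e)" "kron (1\<^sub>m n) u' \<in> carrier_mat n (n * e)"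
    "kron (1\<^sub>m n) v \<in> carrier_mat (n * e) n" "?G \<in> carrier_mat (n * e) (n * e)"
    using assms by (auto intro: kron_one_carrier)
  show ?thesis
    unfolding pval_def kron_add_right[OF one_carrier_mat assms(1,2)] add_mult_distrib_mat[OF c(1,2,4)]
    by (rule add_mult_distrib_mat[OF mult_carrier_mat[OF c(1,4)] mult_carrier_mat[OF c(2,4)] c(3)])
qed

lemma pval_smult_left:
  assumes "u \<in> carrier_mat 1 e" "v \<in> carrier_mat e 1"
  shows "pval n e (a \<cdot>\<^sub>m u) Q v X = a \<cdot>\<^sub>m pval n e u Q v X"
proof -
  let ?G = "minv (pencil n e Q X)"
  have c: "kron (1\<^sub>m n) u \<in> carrier_mat n (n * e)"
    "kron (1\<^sub>m n) v \<in> carrier_mat (n * e) n" "?G \<in> carrier_mat (n * e) (n * e)"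
    using assms by (auto intro: kron_one_carrier)
  show ?thesis
    unfolding pval_def kron_smult_right mult_smult_assoc_mat[OF c(1,3)]
    by (rule mult_smult_assoc_mat[OF mult_carrier_mat[OF c(1,3)] c(2)])
qed

text \<open>Boundedness is preserved by linear combinations in l, so the admissible rows form a
  subspace, and it suffices that no nonzero column annihilates them. The family A will be the
  coefficients of the variables, and later the identity alone.\<close>

lemma pval_subspace_all:
  assumes v: "v \<in> carrier_mat e 1" and A: "\<And>i :: 'i. A i \<in> carrier_mat e e"
    and ann: "\<And>c. c \<in> carrier_mat e 1 \<Longrightarrow>
      (\<And>l. l \<in> carrier_mat 1 e \<Longrightarrow> (\<And>i. bounded_entries n n F (\<lambda>t. pval n e (l * A i) Q v (X t))) \<Longrightarrow> l * c = 0\<^sub>m 1 1) \<Longrightarrow> c = 0\<^sub>m e 1"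
    and l: "l \<in> carrier_mat 1 e"
  shows "bounded_entries n n F (\<lambda>t. pval n e (l * A i) Q v (X t))"
proof -
  define S where "S = {l \<in> carrier_mat 1 e. \<forall>i. bounded_entries n n F (\<lambda>t. pval n e (l * A i) Q v (X t))}"
  have "l \<in> S"
  proof (rule subspace_eq_if_no_annihilator[where S = S and e = e, OF _ _ _ _ _ l])
    show smult: "c \<cdot>\<^sub>m s \<in> S" if "s \<in> S" for c s
    proof -
      have "c \<cdot>\<^sub>m s * A i = c \<cdot>\<^sub>m (s * A i)" "s * A i \<in> carrier_mat 1 e" for i
        using that A[of i] by (auto simp: S_def mult_smult_assoc_mat)
      with that show ?thesis
        by (auto simp: S_def pval_smult_left[OF _ v] intro: bounded_entries_smult)
    qed
    have "bounded_entries n n F (\<lambda>t. pval n e (0\<^sub>m 1 e * A i) Q v (X t))" for i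
    proof -
      have z: "0\<^sub>m 1 e * A i = 0 \<cdot>\<^sub>m 0\<^sub>m 1 e" using A[of i] by (auto intro!: eq_matI)
      have "pval n e (0\<^sub>m 1 e * A i) Q v (X t) = 0 \<cdot>\<^sub>m pval n e (0\<^sub>m 1 e) Q v (X t)" for t
        unfolding z by (rule pval_smult_left[OF zero_carrier_mat v])
      moreover have "0 \<cdot>\<^sub>m pval n e (0\<^sub>m 1 e) Q v (X t) = 0\<^sub>m n n" for t
        using pval_carrier[of "0\<^sub>m 1 e" e v n Q "X t"] v by (auto intro!: eq_matI)
      ultimately show ?thesis by (simp add: bounded_entries_const)
    qed
    then show "0\<^sub>m 1 e \<in> S" by (simp add: S_def)
    show "s + s' \<in> S" if "s \<in> S" "s' \<in> S" for s s'
    proof -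
      have "(s + s') * A i = s * A i + s' * A i" "s * A i \<in> carrier_mat 1 e" "s' * A i \<in> carrier_mat 1 e" for i
        using that A[of i] by (auto simp: S_def add_mult_distrib_mat)
      with that show ?thesis
        by (auto simp: S_def pval_add_left[OF _ _ v] intro: bounded_entries_add)
    qed
  qed (use ann in \<open>auto simp: S_def\<close>)
  then show ?thesis by (simp add: S_def)
qed

lemma bounded_entries_upper_right:
  assumes "bounded_entries (n1 + n2) (m1 + m2) F (\<lambda>t. four_block_mat (A t) (B t) (C t) (D t))"
    and c: "\<And>t. A t \<in> carrier_mat n1 m1" "\<And>t. B t \<in> carrier_mat n1 m2" "\<And>t. D t \<in> carrier_mat n2 m2"
  shows "bounded_entries n1 m2 F B"
proof -
  have "(\<lambda>t. B t $$ (i, j)) \<in> O[F](\<lambda>_. 1)" if "i < n1" "j < m2" for i j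
  proof -
    have d: "dim_row (A t) = n1" "dim_col (A t) = m1" "dim_row (D t) = n2" "dim_col (D t) = m2" for t
      using c(1)[of t] c(3)[of t] by auto
    have "(\<lambda>t. four_block_mat (A t) (B t) (C t) (D t) $$ (i, m1 + j)) \<in> O[F](\<lambda>_. 1)"
      using assms(1) that by (simp add: bounded_entries_def)
    then show ?thesis using that by (simp add: d)
  qed
  with c(2) show ?thesis by (simp add: bounded_entries_def)
qed

section \<open>Values at block upper triangular tuples\<close>

lemma kron_one_block:
  assumes "u \<in> carrier_mat a b"
  shows "kron (1\<^sub>m (n + m)) u = four_block_mat (kron (1\<^sub>m n) u) (0\<^sub>m (n * a) (m * b)) (0\<^sub>m (m * a) (n * b)) (kron (1\<^sub>m m) u)"
proof -
  have z: "kron (0\<^sub>m p q) u = 0\<^sub>m (p * a) (q * b)" for p q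
    using assms by (intro eq_matI) (auto simp: kron_index[of _ p q _ a b] div_less_of_less_mult)
  show ?thesis
    unfolding four_block_one_mat[symmetric]
    by (subst kron_four_block[of _ n n _ m _ m]) (use assms in \<open>auto simp: z\<close>)
qed

lemma pencil_four_block:
  assumes X: "tuple n X" "tuple m Y" and H: "\<And>i. H i \<in> carrier_mat n m" and Q: "tuple e Q"
  shows "pencil (n + m) e Q (\<lambda>i. four_block_mat (X i) (H i) (0\<^sub>m m n) (Y i)) =
     four_block_mat (pencil n e Q X) (pev n m e Q (lin_ext n m H)) (0\<^sub>m (m * e) (n * e)) (pencil m e Q Y)"
proof -
  have "aff_ext (n + m) (\<lambda>i. four_block_mat (X i) (H i) (0\<^sub>m m n) (Y i)) =
     (\<lambda>i. four_block_mat (aff_ext n X i) (lin_ext n m H i) (0\<^sub>m m n) (aff_ext m Y i))"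
    by (auto simp: aff_ext_def lin_ext_def fun_eq_iff split: option.split)
  then show ?thesis using assms
    by (simp add: pencil_def pev_four_block[of _ n n _ m _ m] pev_zero)
qed

text \<open>The off-diagonal block comes from the corner of the inverse of a block triangular
  matrix. It is the difference-differential of the noncommutative function at X and Y in the
  direction H, and it factors through both inverses.\<close>

lemma pval_four_block:
  assumes X: "X \<in> pdom n e Q" "Y \<in> pdom m e Q" and H: "\<And>i. H i \<in> carrier_mat n m" and Q: "tuple e Q"
    and u: "u \<in> carrier_mat 1 e" and v: "v \<in> carrier_mat e 1"
  shows "pval (n + m) e u Q v (\<lambda>i. four_block_mat (X i) (H i) (0\<^sub>m m n) (Y i)) =
     four_block_mat (pval n e u Q v X)
      (- (kron (1\<^sub>m n) u * minv (pencil n e Q X) * pev n m e Q (lin_ext n m H) * minv (pencil m e Q Y) * kron (1\<^sub>m m) v))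
      (0\<^sub>m m n) (pval m e u Q v Y)"
proof -
  have X': "tuple n X" "det (pencil n e Q X) \<noteq> 0" "tuple m Y" "det (pencil m e Q Y) \<noteq> 0"
    using X by (auto simp: pdom_def)
  let ?G = "minv (pencil n e Q X)" and ?G' = "minv (pencil m e Q Y)" and ?L = "pev n m e Q (lin_ext n m H)"
  have c: "kron (1\<^sub>m n) u \<in> carrier_mat n (n * e)" "kron (1\<^sub>m m) u \<in> carrier_mat m (m * e)"
    "kron (1\<^sub>m n) v \<in> carrier_mat (n * e) n" "kron (1\<^sub>m m) v \<in> carrier_mat (m * e) m"
    "?G \<in> carrier_mat (n * e) (n * e)" "?G' \<in> carrier_mat (m * e) (m * e)" "?L \<in> carrier_mat (n * e) (m * e)"
    using u v by (auto intro: kron_one_carrier)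
  have c2: "- (?G * ?L * ?G') \<in> carrier_mat (n * e) (m * e)"
    "?G * ?L * ?G' \<in> carrier_mat (n * e) (m * e)" using c by auto
  have 1: "kron (1\<^sub>m n) u * (- (?G * ?L * ?G')) = - (kron (1\<^sub>m n) u * ?G * ?L * ?G')"
    using c(5-7) carrier_matD[OF c(1)] uminus_mult_right_mat[of "kron (1\<^sub>m n) u" "?G * ?L * ?G'"] u
    by (simp add: mat_mult_assoc)
  have c3: "kron (1\<^sub>m n) u * ?G * ?L * ?G' \<in> carrier_mat n (m * e)"
    by (rule mult_carrier_mat[OF mult_carrier_mat[OF mult_carrier_mat[OF c(1,5)] c(7)] c(6)])
  have 2: "- (kron (1\<^sub>m n) u * ?G * ?L * ?G') * kron (1\<^sub>m m) v = - (kron (1\<^sub>m n) u * ?G * ?L * ?G' * kron (1\<^sub>m m) v)"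
    by (rule uminus_mult_left_mat) (simp add: carrier_matD[OF v])
  have c4: "kron (1\<^sub>m n) u * ?G * ?L * ?G' * kron (1\<^sub>m m) v \<in> carrier_mat n m"
    by (rule mult_carrier_mat[OF c3 c(4)])
  have c6: "kron (1\<^sub>m n) u * ?G * kron (1\<^sub>m n) v \<in> carrier_mat n n"
    "kron (1\<^sub>m m) u * ?G' \<in> carrier_mat m (m * e)"
    "kron (1\<^sub>m m) u * ?G' * kron (1\<^sub>m m) v \<in> carrier_mat m m"
    by (rule mult_carrier_mat[OF mult_carrier_mat[OF c(1,5)] c(3)], rule mult_carrier_mat[OF c(2,6)],
        rule mult_carrier_mat[OF mult_carrier_mat[OF c(2,6)] c(4)])
  have z: "- 0\<^sub>m m (m * e) = (0\<^sub>m m (m * e) :: complex mat)" by (intro eq_matI) auto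
  have c7: "- (kron (1\<^sub>m n) u * ?G * ?L * ?G' * kron (1\<^sub>m m) v) \<in> carrier_mat n m" using c4 by simp
  show ?thesis
    unfolding pval_def pencil_four_block[OF X'(1,3) H Q]
      four_block_upper_inverse[OF pencil_carrier pev_carrier pencil_carrier X'(2,4)]
      kron_one_block[OF u] kron_one_block[OF v]
    using c c2 c3 c4 X'
    by (simp add: mult_four_block_mat[of _ n "n * e" _ "m * e" _ m _ _ "n * e" _ "m * e"]
          mult_four_block_mat[of _ n "n * e" _ "m * e" _ m _ _ n _ m]
          left_mult_zero_mat[of _ "m * e"] left_mult_zero_mat[of _ "n * e"]
          right_mult_zero_mat[of _ _ "n * e"] right_mult_zero_mat[of _ _ "m * e"] 1 2 z
          carrier_matD[OF u] left_add_zero_mat[OF c6(2)] left_add_zero_mat[OF c6(3)]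
          left_add_zero_mat[OF c7] right_add_zero_mat[OF c6(1)])
qed

lemma pval_mult_left:
  assumes "u \<in> carrier_mat 1 e" "v \<in> carrier_mat e 1"
  shows "pval n e u Q v X = kron (1\<^sub>m n) u * (minv (pencil n e Q X) * kron (1\<^sub>m n) v)"
  unfolding pval_def using assms kron_one_carrier by (auto simp: mat_mult_assoc)

lemma zero_if_all_products_zero:
  fixes A :: "'a :: comm_ring_1 mat"
  assumes A: "A \<in> carrier_mat n m"
    and z: "\<And>a b. a \<in> carrier_mat 1 n \<Longrightarrow> b \<in> carrier_mat m 1 \<Longrightarrow> a * A * b = 0\<^sub>m 1 1"
  shows "A = 0\<^sub>m n m"
proof (rule eq_matI)
  fix i j assume "i < dim_row (0\<^sub>m n m :: 'a mat)" "j < dim_col (0\<^sub>m n m :: 'a mat)"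
  then have ij: "i < n" "j < m" by auto
  define a where "a = mat 1 n (\<lambda>(_, k). if k = i then 1 else (0 :: 'a))"
  define b where "b = mat m 1 (\<lambda>(k, _). if k = j then 1 else (0 :: 'a))"
  have c: "a \<in> carrier_mat 1 n" "b \<in> carrier_mat m 1" by (auto simp: a_def b_def)
  have z1: "(0 :: nat) < 1" by simp
  have "(a * A * b) $$ (0, 0) = (\<Sum>k = 0..<m. if k = j then (a * A) $$ (0, k) else 0)"
    unfolding index_mult_mat_sum[OF mult_carrier_mat[OF c(1) A] c(2) z1 z1]
    by (intro sum.cong refl) (simp add: b_def)
  also have "\<dots> = (a * A) $$ (0, j)" using ij by simp
  also have "\<dots> = (\<Sum>k = 0..<n. if k = i then A $$ (k, j) else 0)"
    unfolding index_mult_mat_sum[OF c(1) A z1 ij(2)]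
    by (intro sum.cong refl) (simp add: a_def)
  also have "\<dots> = A $$ (i, j)" using ij by simp
  finally show "A $$ (i, j) = 0\<^sub>m n m $$ (i, j)" using z[OF c] ij by simp
qed (use A in auto)

text \<open>
  In dual form: the entries of the row vectors \<open>u Q(Y)\<^sup>-\<^sup>1\<close>, for \<open>Y\<close> ranging over the common domain
  of \<open>Q\<close> and \<open>T\<close>, span the whole space of rows of length \<open>e\<close>.
\<close>

definition spanning :: "nat \<Rightarrow> ('d :: finite option \<Rightarrow> complex mat) \<Rightarrow> nat \<Rightarrow> complex mat \<Rightarrow>
    ('d option \<Rightarrow> complex mat) \<Rightarrow> bool" where
  "spanning f T e u Q \<longleftrightarrow> (\<forall>c \<in> carrier_mat e 1. c \<noteq> 0\<^sub>m e 1 \<longrightarrow>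
     (\<exists>n\<ge>1. \<exists>X\<in>pdom n e Q \<inter> pdom n f T. pval n e u Q c X \<noteq> 0\<^sub>m n n))"

text \<open>
  The off-diagonal block of the value at \<open>[[Y, H], [0, X]]\<close> contains \<open>u Q(Y)\<^sup>-\<^sup>1 H\<^sub>k Q\<^sub>k Q(X)\<^sup>-\<^sup>1 v\<close>.
\<close>

lemma bounded_along_bracket:
  fixes Q T :: "'d :: finite option \<Rightarrow> complex mat"
  assumes Q: "tuple e Q" and u: "u \<in> carrier_mat 1 e" and v: "v \<in> carrier_mat e 1" and T: "tuple f T"
    and bd: "bounded_along f T e u Q v"
    and n: "n \<ge> 1" and X: "X \<in> pdom n f T" and Z: "tuple n Z"
    and ev: "\<forall>\<^sub>F t in at 0. (\<lambda>i. X i + t \<cdot>\<^sub>m Z i) \<in> pdom n e Q"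
    and m: "m \<ge> 1" and Y: "Y \<in> pdom m e Q" "Y \<in> pdom m f T"
    and a: "a \<in> carrier_mat 1 m" and h: "h \<in> carrier_mat m 1"
  defines "\<eta> \<equiv> a * kron (1\<^sub>m m) u * minv (pencil m e Q Y) * kron h (1\<^sub>m e)"
  shows "bounded_entries n n (at 0) (\<lambda>t. pval n e (\<eta> * Q (Some k)) Q v (\<lambda>i. X i + t \<cdot>\<^sub>m Z i))"
proof -
  have tX: "tuple n X" and tY: "tuple m Y" using X Y by (auto simp: pdom_def)
  have dY: "det (pencil m e Q Y) \<noteq> 0" using Y by (auto simp: pdom_def)
  \<comment> \<open>Y is amplified n times so that the column h, tensored with the identity of size
    n, fits as a block between the amplified Y and X.\<close>
  define N where "N = n * m"
  define Y' where "Y' = inflate n Y"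
  have Y': "Y' \<in> pdom N e Q" "Y' \<in> pdom N f T" and tY': "tuple N Y'"
    using Y inflate_pdom Q T tuple_inflate[OF tY] by (auto simp: Y'_def N_def)
  define G where "G = minv (pencil m e Q Y)"
  have G: "G \<in> carrier_mat (m * e) (m * e)" by (auto simp: G_def)
  have pY': "minv (pencil N e Q Y') = kron (1\<^sub>m n) G"
    unfolding Y'_def N_def pencil_inflate[OF tY Q] G_def by (rule kron_one_inverse(2)[OF pencil_carrier dY])
  \<comment> \<open>Only the k-th variable has an off-diagonal block, which isolates its
    coefficient.\<close>
  define H where "H = (\<lambda>i. if i = k then kron (1\<^sub>m n) h else 0\<^sub>m N n)"
  have kh: "kron (1\<^sub>m n) h \<in> carrier_mat N n"
    using kron_carrier[OF one_carrier_mat h, of n] by (simp add: N_def)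
  have H: "H i \<in> carrier_mat N n" for i using kh by (simp add: H_def)
  have Qc: "Q i \<in> carrier_mat e e" for i using Q by simp
  have "lin_ext N n H i = (if i = Some k then kron (1\<^sub>m n) h else 0\<^sub>m N n)" for i
    by (auto simp: lin_ext_def H_def split: option.split)
  moreover have "kron (0\<^sub>m N n) (Q i) $$ (r, c) = 0" if "r < N * e" "c < n * e" for i r c
    using that by (subst kron_index[of _ N n _ e e]) (auto simp: div_less_of_less_mult Qc)
  ultimately have kz: "kron (lin_ext N n H i) (Q i) $$ (r, c) =
      (if i = Some k then kron (kron (1\<^sub>m n) h) (Q (Some k)) $$ (r, c) else 0)"
    if "r < N * e" "c < n * e" for i r c
    using that by simp
  have pH: "pev N n e Q (lin_ext N n H) = kron (kron (1\<^sub>m n) h) (Q (Some k))"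
  proof (rule eq_matI)
    fix r c assume "r < dim_row (kron (kron (1\<^sub>m n) h) (Q (Some k)))" "c < dim_col (kron (kron (1\<^sub>m n) h) (Q (Some k)))"
    then have "r < N * e" "c < n * e" by (simp_all only: carrier_matD[OF kron_carrier[OF kh Qc[of "Some k"]]])
    then show "pev N n e Q (lin_ext N n H) $$ (r, c) = kron (kron (1\<^sub>m n) h) (Q (Some k)) $$ (r, c)"
      by (simp add: pev_def msum_index kz)
  qed (simp_all only: carrier_matD[OF kron_carrier[OF kh Qc]] pev_dim)
  define X' where "X' = (\<lambda>i. four_block_mat (Y' i) (H i) (0\<^sub>m n N) (X i))"
  \<comment> \<open>The line moves only the lower right block, from X in the direction Z.\<close>
  define Z' where "Z' = (\<lambda>i. four_block_mat (0\<^sub>m N N) (0\<^sub>m N n) (0\<^sub>m n N) (Z i))"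
  have X'Z': "(\<lambda>i. X' i + t \<cdot>\<^sub>m Z' i) = (\<lambda>i. four_block_mat (Y' i) (H i) (0\<^sub>m n N) (X i + t \<cdot>\<^sub>m Z i))" for t
  proof
    fix i
    have "dim_row (H i) = N" "dim_col (H i) = n" using H[of i] by auto
    then show "X' i + t \<cdot>\<^sub>m Z' i = four_block_mat (Y' i) (H i) (0\<^sub>m n N) (X i + t \<cdot>\<^sub>m Z i)"
      using tY' tX Z by (intro eq_matI) (auto simp: X'_def Z'_def)
  qed
  have block_pdom: "(\<lambda>i. four_block_mat (Y' i) (H i) (0\<^sub>m n N) (W i)) \<in> pdom (N + n) e' Q'"
    if "W \<in> pdom n e' Q'" "Y' \<in> pdom N e' Q'" "tuple e' Q'" for W e' and Q' :: "'d option \<Rightarrow> complex mat"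
  proof -
    have tW: "tuple n W" using that by (simp add: pdom_def)
    have "tuple (N + n) (\<lambda>i. four_block_mat (Y' i) (H i) (0\<^sub>m n N) (W i))"
      using tY' tW by (auto simp: tuple_def)
    then show ?thesis
      using that unfolding pdom_def mem_Collect_eq pencil_four_block[OF tY' tW H that(3)]
      by (subst det_four_block_mat_lower_left_zero[OF pencil_carrier pev_carrier refl pencil_carrier]) auto
  qed
  \<comment> \<open>The boundedness assumption is applied at size N + n, larger than the size of
    X.\<close>
  have "bounded_entries (N + n) (N + n) (at 0) (\<lambda>t. pval (N + n) e u Q v (\<lambda>i. X' i + t \<cdot>\<^sub>m Z' i))"
  proof (rule bd[unfolded bounded_along_def, rule_format])
    show "X' \<in> pdom (N + n) f T" unfolding X'_def by (rule block_pdom[OF X Y'(2) T])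
    show "tuple (N + n) Z'" using Z by (auto simp: tuple_def Z'_def)
    show "\<forall>\<^sub>F t in at 0. (\<lambda>i. X' i + t \<cdot>\<^sub>m Z' i) \<in> pdom (N + n) e Q"
      using ev unfolding X'Z' by eventually_elim (rule block_pdom[OF _ Y'(1) Q])
  qed (use n in simp)
  moreover define Xt where "Xt t = (\<lambda>i. X i + t \<cdot>\<^sub>m Z i)" for t
  define z where "z t = minv (pencil n e Q (Xt t)) * kron (1\<^sub>m n) v" for t
  have z: "z t \<in> carrier_mat (n * e) n" for t
    unfolding z_def by (rule mult_carrier_mat[OF minv_carrier[OF pencil_carrier] kron_one_carrier(1)[OF v]])
  define b where "b = kron (1\<^sub>m n) (kron (1\<^sub>m m) u * G * kron h (Q (Some k)))"
  have ku: "kron (1\<^sub>m m) u \<in> carrier_mat m (m * e)" by (rule kron_one_carrier(2)[OF u])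
  have khQ: "kron h (Q (Some k)) \<in> carrier_mat (m * e) e" using kron_carrier[OF h Qc, of "Some k"] by simp
  have cb: "kron (1\<^sub>m m) u * G * kron h (Q (Some k)) \<in> carrier_mat m e"
    by (rule mult_carrier_mat[OF mult_carrier_mat[OF ku G] khQ])
  then have b: "b \<in> carrier_mat N (n * e)" by (auto simp: b_def N_def)
  have "\<forall>\<^sub>F t in at 0. pval (N + n) e u Q v (\<lambda>i. X' i + t \<cdot>\<^sub>m Z' i) =
     four_block_mat (pval N e u Q v Y') (- (b * z t)) (0\<^sub>m n N) (pval n e u Q v (Xt t))"
    using ev
  proof eventually_elim
    case (elim t)
    have k: "kron (1\<^sub>m N) u = kron (1\<^sub>m n) (kron (1\<^sub>m m) u)" "kron (kron (1\<^sub>m n) h) (Q (Some k)) = kron (1\<^sub>m n) (kron h (Q (Some k)))"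
      unfolding N_def by (metis kron_assoc kron_one, rule kron_assoc)
    have "kron (1\<^sub>m n) (kron (1\<^sub>m m) u) * kron (1\<^sub>m n) G * kron (1\<^sub>m n) (kron h (Q (Some k))) = b"
      unfolding b_def kron_one_mult[OF ku G] kron_one_mult[OF mult_carrier_mat[OF ku G] khQ] ..
    then show ?case
      unfolding X'Z' pval_four_block[OF Y'(1) elim H Q u v] pY' pH k Xt_def z_def
      by (simp only: assoc_mult_mat[OF b minv_carrier[OF pencil_carrier] kron_one_carrier(1)[OF v]])
  qed
  ultimately have "bounded_entries (N + n) (N + n) (at 0)
     (\<lambda>t. four_block_mat (pval N e u Q v Y') (- (b * z t)) (0\<^sub>m n N) (pval n e u Q v (Xt t)))"
    by - (erule bounded_entries_cong, intro four_block_carrier_mat pval_carrier[OF u v], assumption)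
  then have "bounded_entries N n (at 0) (\<lambda>t. - (b * z t))"
    by (rule bounded_entries_upper_right) (auto intro!: pval_carrier u v mult_carrier_mat[OF b z])
  then have "bounded_entries N n (at 0) (\<lambda>t. (- 1) \<cdot>\<^sub>m (- (b * z t)))"
    by (rule bounded_entries_smult)
  moreover have "(- 1) \<cdot>\<^sub>m (- (b * z t)) = b * z t" for t
    by (intro eq_matI) auto
  ultimately have "bounded_entries N n (at 0) (\<lambda>t. b * z t)" by simp
  then have "bounded_entries n n (at 0) (\<lambda>t. kron (1\<^sub>m n) a * (b * z t))"
    by - (rule bounded_entries_mult[where m = N and A = "\<lambda>_. kron (1\<^sub>m n) a"], rule bounded_entries_const,
      use kron_carrier[OF one_carrier_mat a, of n] in \<open>simp add: N_def\<close>, assumption)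
  moreover have "kron (1\<^sub>m n) a * (b * z t) = pval n e (\<eta> * Q (Some k)) Q v (Xt t)" for t
  proof -
    have ka: "kron (1\<^sub>m n) a \<in> carrier_mat n N" using kron_carrier[OF one_carrier_mat a, of n] by (simp add: N_def)
    have "kron h (1\<^sub>m e) * Q (Some k) = kron h (Q (Some k))"
      using kron_mult[OF h one_carrier_mat[of 1] one_carrier_mat[of e] Qc] h
      by (simp add: one_kron[OF Qc, unfolded One_nat_def] left_mult_one_mat[OF Qc])
    then have "\<eta> * Q (Some k) = a * (kron (1\<^sub>m m) u * G * kron h (Q (Some k)))"
      unfolding \<eta>_def G_def[symmetric] using a ku G h carrier_matD[OF Qc] u by (simp add: mat_mult_assoc)
    then have "kron (1\<^sub>m n) (\<eta> * Q (Some k)) = kron (1\<^sub>m n) a * b"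
      unfolding b_def kron_one_mult[OF a cb] by simp
    moreover have "\<eta> * Q (Some k) \<in> carrier_mat 1 e"
      unfolding \<open>\<eta> * Q (Some k) = _\<close> by (rule mult_carrier_mat[OF a cb])
    ultimately show ?thesis
      unfolding pval_mult_left[OF _ v] z_def[symmetric]
      by (simp add: pval_mult_left[OF _ v] z_def[symmetric] assoc_mult_mat[OF ka b z])
  qed
  ultimately show ?thesis by (simp add: Xt_def)
qed

text \<open>\<open>bounded_along_bracket\<close> and spanning give boundedness for all rows l Q_k,
  where k is a variable. The identity l Q(X) Q(X)^-1 v = l v then yields it for the constant
  coefficient. Finally the rows l Q_i span everything, since a common kernel vector of the
  coefficients would make the pencil singular at every point.\<close>

lemma bounded_along_all_left:
  fixes Q T :: "'d :: finite option \<Rightarrow> complex mat"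
  assumes Q: "tuple e Q" and u: "u \<in> carrier_mat 1 e" and v: "v \<in> carrier_mat e 1" and T: "tuple f T"
    and nd: "pnondeg e Q" and bd: "bounded_along f T e u Q v" and sp: "spanning f T e u Q"
    and l: "l \<in> carrier_mat 1 e"
  shows "bounded_along f T e l Q v"
  unfolding bounded_along_def
proof (intro allI impI ballI)
  fix n X Z assume n: "n \<ge> (1 :: nat)" and X: "X \<in> pdom n f T" and Z: "tuple n Z"
    and ev: "\<forall>\<^sub>F t in at 0. (\<lambda>i. X i + t \<cdot>\<^sub>m Z i) \<in> pdom n e Q"
  define Xt where "Xt t = (\<lambda>i. X i + t \<cdot>\<^sub>m Z i)" for t
  have tX: "tuple n X" using X by (simp add: pdom_def)
  have tXt: "tuple n (Xt t)" for t unfolding Xt_def by (rule tuple_line[OF tX Z])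
  have Qc: "Q i \<in> carrier_mat e e" for i using Q by simp
  have A: "bounded_entries n n (at 0) (\<lambda>t. pval n e (l * Q (Some k)) Q v (Xt t))"
    if l: "l \<in> carrier_mat 1 e" for l k
  proof (rule pval_subspace_all[where A = "\<lambda>k. Q (Some k)", OF v Qc _ l])
    fix c assume c: "c \<in> carrier_mat e 1"
      and ann: "\<And>l. l \<in> carrier_mat 1 e \<Longrightarrow>
        (\<And>k. bounded_entries n n (at 0) (\<lambda>t. pval n e (l * Q (Some k)) Q v (Xt t))) \<Longrightarrow> l * c = 0\<^sub>m 1 1"
    show "c = 0\<^sub>m e 1"
    proof (rule ccontr)
      assume "c \<noteq> 0\<^sub>m e 1"
      then obtain m Y where m: "m \<ge> 1" and Y: "Y \<in> pdom m e Q" "Y \<in> pdom m f T"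
        and nz: "pval m e u Q c Y \<noteq> 0\<^sub>m m m"
        using sp c unfolding spanning_def by blast
      \<comment> \<open>For the row \<eta> of the bracket lemma, \<eta> c equals a (u Q(Y)^-1 c) h.
        So an annihilator c makes u Q(Y)^-1 c vanish, against spanning.\<close>
      have "a * pval m e u Q c Y * h = 0\<^sub>m 1 1" if a: "a \<in> carrier_mat 1 m" and h: "h \<in> carrier_mat m 1" for a h
      proof -
        define G where "G = minv (pencil m e Q Y)"
        have G: "G \<in> carrier_mat (m * e) (m * e)" by (auto simp: G_def)
        have ku: "kron (1\<^sub>m m) u \<in> carrier_mat m (m * e)" and kc: "kron (1\<^sub>m m) c \<in> carrier_mat (m * e) m"
          using kron_one_carrier u c by auto
        have kh: "kron h (1\<^sub>m e) \<in> carrier_mat (m * e) e" using kron_carrier[OF h one_carrier_mat, of e] by simp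
        have \<eta>: "a * kron (1\<^sub>m m) u * G * kron h (1\<^sub>m e) \<in> carrier_mat 1 e"
          by (rule mult_carrier_mat[OF mult_carrier_mat[OF mult_carrier_mat[OF a ku] G] kh])
        have hc: "kron h (1\<^sub>m e) * c = kron (1\<^sub>m m) c * h"
          using kron_mult[OF h one_carrier_mat[of 1] one_carrier_mat[of e] c]
            kron_mult[OF one_carrier_mat[of m] h c one_carrier_mat[of 1]] h c
          by (simp add: one_kron[OF c, unfolded One_nat_def] kron_one_one[OF h])
        have "a * kron (1\<^sub>m m) u * G * kron h (1\<^sub>m e) * c = 0\<^sub>m 1 1"
          by (rule ann[OF \<eta>], unfold G_def Xt_def, rule bounded_along_bracket[OF Q u v T bd n X Z ev m Y a h])
        moreover have "a * kron (1\<^sub>m m) u * G * kron h (1\<^sub>m e) * c = a * kron (1\<^sub>m m) u * G * (kron h (1\<^sub>m e) * c)"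
          by (rule assoc_mult_mat[OF mult_carrier_mat[OF mult_carrier_mat[OF a ku] G] kh c])
        moreover have "a * pval m e u Q c Y * h = a * kron (1\<^sub>m m) u * G * (kron (1\<^sub>m m) c * h)"
          unfolding pval_def G_def[symmetric] using a u G c h by (simp add: mat_mult_assoc)
        ultimately show ?thesis by (simp add: hc)
      qed
      from zero_if_all_products_zero[OF pval_carrier[OF u c] this] nz show False by blast
    qed
  qed
  \<comment> \<open>The constant coefficient cannot be isolated by an off-diagonal block, because
    the identity is not perturbed. It is recovered from l v as the sum of all X_i (l Q_i Q^-1 v),
    where the terms of the variables are bounded.\<close>
  have B: "bounded_entries n n (at 0) (\<lambda>t. pval n e (l * Q None) Q v (Xt t))"
    if l: "l \<in> carrier_mat 1 e" for l
  proof -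
    define P where "P i t = pval n e (l * Q i) Q v (Xt t)" for i t
    have lQ: "l * Q i \<in> carrier_mat 1 e" for i by (rule mult_carrier_mat[OF l Qc])
    have P: "P i t \<in> carrier_mat n n" for i t unfolding P_def by (rule pval_carrier[OF lQ v])
    define S where "S t = msum n n (\<lambda>i. lin_ext n n (Xt t) i * P i t)" for t
    have lin: "lin_ext n n (Xt t) i \<in> carrier_mat n n" for t i using tXt by simp
    have "bounded_entries n n (at 0) (\<lambda>t. lin_ext n n (Xt t) i * P i t)" for i
    proof (cases i)
      case None
      have "0\<^sub>m n n * P None t = 0\<^sub>m n n" for t using P[of None t] by (rule left_mult_zero_mat)
      then show ?thesis using None by (simp add: lin_ext_def bounded_entries_const)
    next
      case (Some k)
      have "bounded_entries n n (at 0) (\<lambda>t. Xt t k)"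
        unfolding Xt_def using tX Z
        by (intro entries_tendsto_imp_bounded[OF entries_tendsto_line]) auto
      then show ?thesis
        using A[OF l, of k] Some by (auto simp: lin_ext_def P_def intro: bounded_entries_mult)
    qed
    then have S: "bounded_entries n n (at 0) S" unfolding S_def by (rule bounded_entries_msum)
    then have Sc: "S t \<in> carrier_mat n n" for t by (simp add: bounded_entries_def)
    have lv: "kron (1\<^sub>m n) (l * v) \<in> carrier_mat n n"
      using kron_carrier[OF one_carrier_mat mult_carrier_mat[OF l v], of n] by simp
    have "\<forall>\<^sub>F t in at 0. kron (1\<^sub>m n) (l * v) + (- 1) \<cdot>\<^sub>m S t = P None t"
      using ev
    proof eventually_elim
      case (elim t)
      define M where "M = pencil n e Q (Xt t)"
      have M: "M \<in> carrier_mat (n * e) (n * e)" "det M \<noteq> 0" using elim by (auto simp: M_def pdom_def Xt_def)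
      define z where "z = minv M * kron (1\<^sub>m n) v"
      have kv: "kron (1\<^sub>m n) v \<in> carrier_mat (n * e) n" and kl: "kron (1\<^sub>m n) l \<in> carrier_mat n (n * e)"
        using kron_one_carrier l v by auto
      have z: "z \<in> carrier_mat (n * e) n" unfolding z_def by (rule mult_carrier_mat[OF minv_carrier[OF M(1)] kv])
      have Mz: "M * z = kron (1\<^sub>m n) v"
        unfolding z_def using assoc_mult_mat[OF M(1) minv_carrier[OF M(1)] kv] minv_inverse(1)[OF M] left_mult_one_mat[OF kv] by simp
      have aff: "aff_ext n (Xt t) i \<in> carrier_mat n n" for i using tXt by simp
      have kaff: "kron (aff_ext n (Xt t) i) (Q i) \<in> carrier_mat (n * e) (n * e)" for i
        by (rule kron_carrier[OF aff Qc])
      have kW: "kron (1\<^sub>m n) l * kron (aff_ext n (Xt t) i) (Q i) = aff_ext n (Xt t) i * kron (1\<^sub>m n) (l * Q i)" for i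
        using kron_mult[OF one_carrier_mat aff l Qc, of i i] kron_mult[OF aff one_carrier_mat one_carrier_mat[of 1] lQ, of i i]
        by (simp add: left_mult_one_mat[OF aff] right_mult_one_mat[OF aff] left_mult_one_mat[OF lQ[unfolded One_nat_def]] kron_one_one[OF aff])
      have kWc: "kron (1\<^sub>m n) l * kron (aff_ext n (Xt t) i) (Q i) \<in> carrier_mat n (n * e)" for i
        by (rule mult_carrier_mat[OF kl kaff])
      have klQ: "kron (1\<^sub>m n) (l * Q i) \<in> carrier_mat n (n * e)" for i by (rule kron_one_carrier(2)[OF lQ])
      have term_eq: "kron (1\<^sub>m n) l * kron (aff_ext n (Xt t) i) (Q i) * z = aff_ext n (Xt t) i * P i t" for i
        unfolding kW P_def pval_mult_left[OF lQ v] M_def[symmetric] z_def[symmetric]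
        by (rule assoc_mult_mat[OF aff klQ z])
      have "kron (1\<^sub>m n) (l * v) = kron (1\<^sub>m n) l * (M * z)" unfolding Mz kron_one_mult[OF l v] ..
      also have "\<dots> = kron (1\<^sub>m n) l * M * z" by (rule assoc_mult_mat[symmetric, OF kl M(1) z])
      also have "kron (1\<^sub>m n) l * M = msum n (n * e) (\<lambda>i. kron (1\<^sub>m n) l * kron (aff_ext n (Xt t) i) (Q i))"
        unfolding M_def pencil_def pev_def by (rule mult_msum[OF kl kaff])
      also have "\<dots> * z = msum n n (\<lambda>i. aff_ext n (Xt t) i * P i t)"
        unfolding msum_mult[OF z kWc] by (rule msum_cong[OF term_eq])
      finally have *: "kron (1\<^sub>m n) (l * v) = msum n n (\<lambda>i. aff_ext n (Xt t) i * P i t)" .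
      have "(aff_ext n (Xt t) i * P i t) $$ (r, c) = (if i = None then P None t $$ (r, c) else 0) +
           (lin_ext n n (Xt t) i * P i t) $$ (r, c)" if "r < n" "c < n" for i r c
      proof (cases i)
        case None
        have "0\<^sub>m n n * P None t = 0\<^sub>m n n" using P[of None t] by (rule left_mult_zero_mat)
        moreover have "1\<^sub>m n * P None t = P None t" using P[of None t] by (rule left_mult_one_mat)
        ultimately show ?thesis using None that by (simp add: aff_ext_def lin_ext_def)
      next
        case (Some k)
        then show ?thesis by (simp add: aff_ext_def lin_ext_def)
      qed
      then have "kron (1\<^sub>m n) (l * v) = P None t + S t"
        unfolding * S_def using P[of None t] by (intro eq_matI) (auto simp: msum_index sum.distrib)
      then show ?case using P[of None t] Sc[of t] by (auto intro!: eq_matI)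
    qed
    then have "bounded_entries n n (at 0) (P None)"
      by (intro bounded_entries_cong[OF bounded_entries_add[OF bounded_entries_const[OF lv] bounded_entries_smult[OF S]]] P)
    then show ?thesis unfolding P_def[abs_def] .
  qed
  have AB: "bounded_entries n n (at 0) (\<lambda>t. pval n e (l * Q i) Q v (Xt t))" if "l \<in> carrier_mat 1 e" for l i
    using A[OF that] B[OF that] by (cases i) auto
  have "bounded_entries n n (at 0) (\<lambda>t. pval n e (l * 1\<^sub>m e) Q v (Xt t))"
  proof (rule pval_subspace_all[where A = "\<lambda>_ :: unit. 1\<^sub>m e", OF v one_carrier_mat _ l])
    fix c assume c: "c \<in> carrier_mat e 1"
      and ann: "\<And>l. l \<in> carrier_mat 1 e \<Longrightarrow>
        (\<And>i :: unit. bounded_entries n n (at 0) (\<lambda>t. pval n e (l * 1\<^sub>m e) Q v (Xt t))) \<Longrightarrow> l * c = 0\<^sub>m 1 1"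
    have Qic: "Q i * c \<in> carrier_mat e 1" for i by (rule mult_carrier_mat[OF Qc c])
    have Qc0: "Q i * c = 0\<^sub>m e 1" for i
    proof (rule zero_if_all_products_zero[OF Qic])
      fix a b :: "complex mat" assume a: "a \<in> carrier_mat 1 e" and b: "b \<in> carrier_mat 1 (1 :: nat)"
      have aQ: "a * Q i \<in> carrier_mat 1 e" by (rule mult_carrier_mat[OF a Qc])
      have "a * Q i * c = 0\<^sub>m 1 1"
        by (rule ann[OF aQ], unfold right_mult_one_mat[OF aQ], rule AB[OF a])
      then have "a * (Q i * c) = 0\<^sub>m 1 1" using assoc_mult_mat[OF a Qc c, of i] by simp
      then show "a * (Q i * c) * b = 0\<^sub>m 1 1" using left_mult_zero_mat[OF b, of 1] by simp
    qed
    obtain m Y where m: "m \<ge> 1" and Y: "Y \<in> pdom m e Q" using nd by (auto simp: pnondeg_def)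
    define M where "M = pencil m e Q Y"
    have M: "M \<in> carrier_mat (m * e) (m * e)" "det M \<noteq> 0" and tY: "tuple m Y" using Y by (auto simp: M_def pdom_def)
    have aff: "aff_ext m Y i \<in> carrier_mat m m" for i using tY by simp
    have kc: "kron (1\<^sub>m m) c \<in> carrier_mat (m * e) m" by (rule kron_one_carrier(1)[OF c])
    have k0: "kron (aff_ext m Y i) (Q i) * kron (1\<^sub>m m) c = 0\<^sub>m (m * e) m" for i
      using kron_mult[OF aff one_carrier_mat Qc c, of i i] unfolding Qc0
      using aff[of i] by (auto simp: kron_index[of _ m m _ e 1] mod_less_of_less_mult intro!: eq_matI)
    have "M * kron (1\<^sub>m m) c = msum (m * e) m (\<lambda>i. kron (aff_ext m Y i) (Q i) * kron (1\<^sub>m m) c)"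
      unfolding M_def pencil_def pev_def by (rule msum_mult[OF kc kron_carrier[OF aff Qc]])
    also have "\<dots> = 0\<^sub>m (m * e) m" unfolding k0 by (intro eq_matI) (auto simp: msum_index)
    finally have "minv M * M * kron (1\<^sub>m m) c = 0\<^sub>m (m * e) m"
      unfolding assoc_mult_mat[OF minv_carrier[OF M(1)] M(1) kc] using right_mult_zero_mat[OF minv_carrier[OF M(1)]] by simp
    then have "kron (1\<^sub>m m) c = kron (1\<^sub>m m) (0\<^sub>m e 1)"
      unfolding minv_inverse(2)[OF M] left_mult_one_mat[OF kc] kron_one_zero by simp
    from kron_one_inj[OF c zero_carrier_mat m this] show "c = 0\<^sub>m e 1" .
  qed
  then show "bounded_entries n n (at 0) (\<lambda>t. pval n e l Q v (\<lambda>i. X i + t \<cdot>\<^sub>m Z i))"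
    unfolding right_mult_one_mat[OF l] Xt_def .
qed

lemma bounded_along_tr:
  assumes bd: "bounded_along f T e u Q v" and Q: "tuple e Q" and T: "tuple f T"
    and u: "u \<in> carrier_mat 1 e" and v: "v \<in> carrier_mat e 1"
  shows "bounded_along f (tr T) e v\<^sup>T (tr Q) u\<^sup>T"
  unfolding bounded_along_def
proof (intro allI impI ballI)
  fix n X Z assume n: "n \<ge> (1 :: nat)" and X: "X \<in> pdom n f (tr T)" and Z: "tuple n Z"
    and ev: "\<forall>\<^sub>F t in at 0. (\<lambda>i. X i + t \<cdot>\<^sub>m Z i) \<in> pdom n e (tr Q)"
  have tX: "tuple n X" using X by (simp add: pdom_def)
  have line: "tr (\<lambda>i. X i + t \<cdot>\<^sub>m Z i) = (\<lambda>i. (X i)\<^sup>T + t \<cdot>\<^sub>m (Z i)\<^sup>T)" for t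
    using tX Z by (intro ext eq_matI) auto
  have line2: "tr (\<lambda>i. (X i)\<^sup>T + t \<cdot>\<^sub>m (Z i)\<^sup>T) = (\<lambda>i. X i + t \<cdot>\<^sub>m Z i)" for t
    using tX Z by (intro ext eq_matI) auto
  have dom: "W \<in> pdom n e (tr Q) \<longleftrightarrow> tr W \<in> pdom n e Q" for W
    using pdom_tr[OF Q, of "tr W" n] by simp
  have "tr X \<in> pdom n f T" using X pdom_tr[OF T, of "tr X" n] by simp
  then have "bounded_entries n n (at 0) (\<lambda>t. pval n e u Q v (\<lambda>i. (X i)\<^sup>T + t \<cdot>\<^sub>m (Z i)\<^sup>T))"
    using bd n Z ev unfolding bounded_along_def dom line by auto
  then have *: "bounded_entries n n (at 0) (\<lambda>t. (pval n e u Q v (\<lambda>i. (X i)\<^sup>T + t \<cdot>\<^sub>m (Z i)\<^sup>T))\<^sup>T)"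
    by (rule bounded_entries_transpose)
  show "bounded_entries n n (at 0) (\<lambda>t. pval n e v\<^sup>T (tr Q) u\<^sup>T (\<lambda>i. X i + t \<cdot>\<^sub>m Z i))"
  proof (rule bounded_entries_cong[OF *])
    show "\<forall>\<^sub>F t in at 0. (pval n e u Q v (\<lambda>i. (X i)\<^sup>T + t \<cdot>\<^sub>m (Z i)\<^sup>T))\<^sup>T = pval n e v\<^sup>T (tr Q) u\<^sup>T (\<lambda>i. X i + t \<cdot>\<^sub>m Z i)"
      using ev
    proof eventually_elim
      case (elim t)
      then have "(\<lambda>i. (X i)\<^sup>T + t \<cdot>\<^sub>m (Z i)\<^sup>T) \<in> pdom n e Q" unfolding dom line .
      from pval_tr[OF this Q u v] show ?case unfolding line2 by simp
    qed
  qed (use u v in \<open>auto intro!: pval_carrier\<close>)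
qed

lemma det_kron_one:
  fixes M :: "'a :: idom mat"
  assumes M: "M \<in> carrier_mat e e"
  shows "det (kron (1\<^sub>m k) M) = det M ^ k"
proof (induction k)
  case 0
  have "kron (1\<^sub>m 0) M = 1\<^sub>m 0" using M by (intro eq_matI) auto
  then show ?case by simp
next
  case (Suc k)
  have z: "kron (0\<^sub>m p q) M = 0\<^sub>m (p * e) (q * e)" for p q
    using M by (intro eq_matI) (auto simp: kron_index[of _ p q _ e e] div_less_of_less_mult)
  have "1\<^sub>m (Suc k) = four_block_mat (1\<^sub>m 1) (0\<^sub>m 1 k) (0\<^sub>m k 1) (1\<^sub>m k :: 'a mat)"
    using four_block_one_mat[of 1 k] by simp
  then have "kron (1\<^sub>m (Suc k)) M = four_block_mat M (0\<^sub>m e (k * e)) (0\<^sub>m (k * e) e) (kron (1\<^sub>m k) M)"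
    using kron_four_block[of "1\<^sub>m 1" 1 1 "0\<^sub>m 1 k" k "0\<^sub>m k 1" k "1\<^sub>m k :: 'a mat" M e e] M one_kron[OF M] z[of 1 k] z[of k 1]
    by simp
  then show ?case
    using Suc M by (simp add: det_four_block_mat_lower_left_zero[OF M, of _ "k * e"])
qed

text \<open>Unit vectors on both sides single out one entry of each block. Thus boundedness of the
  values for all rows and columns becomes boundedness of every entry of the inverse pencil.\<close>

lemma index_corner:
  fixes G :: "'a :: comm_ring_1 mat"
  assumes G: "G \<in> carrier_mat (n * e) (n * e)" and rs: "r < n * e" "s < n * e"
  shows "(kron (1\<^sub>m n) (mat 1 e (\<lambda>(_, k). if k = r mod e then 1 else 0)) * G *
     kron (1\<^sub>m n) (mat e 1 (\<lambda>(k, _). if k = s mod e then 1 else 0))) $$ (r div e, s div e) = G $$ (r, s)"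
proof -
  define l where "l j = mat 1 e (\<lambda>(_, k). if k = j then 1 else (0 :: 'a))" for j
  have l: "l j \<in> carrier_mat 1 e" for j by (simp add: l_def)
  have row: "(kron (1\<^sub>m n) (l (r mod e)) * W) $$ (r div e, k) = W $$ (r, k)"
    if "W \<in> carrier_mat (n * e) m" "r < n * e" "k < m" for W m r k
    using index_kron_one_mult[OF l that(1), of "r div e" 0 k "r mod e"] that
    by (simp add: l_def div_less_of_less_mult mod_less_of_less_mult if_distrib[of "\<lambda>x. x * _"] cong: if_cong)
  have lT: "mat e 1 (\<lambda>(k, _). if k = s mod e then 1 else 0) = (l (s mod e))\<^sup>T"
    by (intro eq_matI) (auto simp: l_def)
  have GT: "G\<^sup>T \<in> carrier_mat (n * e) (n * e)" using G by simp
  have kl: "kron (1\<^sub>m n) (l j) \<in> carrier_mat n (n * e)" for j by (rule kron_one_carrier(2)[OF l])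
  have kG: "kron (1\<^sub>m n) (l j) * G \<in> carrier_mat n (n * e)" for j by (rule mult_carrier_mat[OF kl G])
  have "(kron (1\<^sub>m n) (l (r mod e)) * G * (kron (1\<^sub>m n) (l (s mod e)))\<^sup>T) =
     (kron (1\<^sub>m n) (l (s mod e)) * (kron (1\<^sub>m n) (l (r mod e)) * G)\<^sup>T)\<^sup>T"
    using transpose_mult[OF kl transpose_carrier_mat[THEN iffD2, OF kG]] by simp
  moreover have "(kron (1\<^sub>m n) (l (s mod e)) * (kron (1\<^sub>m n) (l (r mod e)) * G)\<^sup>T) $$ (s div e, r div e) =
      (kron (1\<^sub>m n) (l (r mod e)) * G)\<^sup>T $$ (s, r div e)"
    by (rule row[where m = n]) (use kG rs in \<open>auto simp: div_less_of_less_mult\<close>)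
  moreover have "(kron (1\<^sub>m n) (l (r mod e)) * G)\<^sup>T $$ (s, r div e) = G $$ (r, s)"
    using row[OF G rs] carrier_matD[OF G] rs by (simp add: carrier_matD[OF l] div_less_of_less_mult del: index_mult_mat(1))
  moreover have "(kron (1\<^sub>m n) (l j))\<^sup>T = kron (1\<^sub>m n) (l j)\<^sup>T" for j by (simp add: kron_transpose)
  ultimately show ?thesis
    unfolding lT l_def[symmetric]
    using rs l carrier_matD[OF l] G
    by (simp add: div_less_of_less_mult del: index_mult_mat(1))
qed

lemma pequiv_sym: "pequiv e u Q v e' u' Q' v' \<Longrightarrow> pequiv e' u' Q' v' e u Q v"
  by (auto simp: pequiv_def)

text \<open>Agreement on common domains is not evidently transitive, as the middle pencil may be
  singular where the outer two are invertible. It is nondegenerate, so the density argument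
  applies.\<close>

lemma pequiv_trans:
  assumes "tuple e Q" "u \<in> carrier_mat 1 e" "v \<in> carrier_mat e 1"
    and "tuple e'' Q''" "u'' \<in> carrier_mat 1 e''" "v'' \<in> carrier_mat e'' 1"
    and "tuple e' Q'" "pnondeg e' Q'" "pequiv e u Q v e' u' Q' v'" "pequiv e' u' Q' v' e'' u'' Q'' v''"
  shows "pequiv e u Q v e'' u'' Q'' v''"
  by (rule pequivI_generic[OF assms(1-8)]) (use assms(9,10) in \<open>auto simp: pequiv_def\<close>)

text \<open>If Q(X) were singular, the determinant of the pencil would tend to 0 along a line into X
  while the determinant of its inverse stays bounded; yet their product is 1. Boundedness starts
  from the given u and v, for which the value agrees with that of T, continuous at X.\<close>

theorem minimal_pencil_domain:
  fixes Q T :: "'d :: finite option \<Rightarrow> complex mat"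
  assumes Q: "tuple e Q" "u \<in> carrier_mat 1 e" "v \<in> carrier_mat e 1" and nd: "pnondeg e Q"
    and min: "\<And>e' u' Q' v'. e' < e \<Longrightarrow> tuple e' Q' \<Longrightarrow> u' \<in> carrier_mat 1 e' \<Longrightarrow> v' \<in> carrier_mat e' 1 \<Longrightarrow>
       pnondeg e' Q' \<Longrightarrow> \<not> pequiv e u Q v e' u' Q' v'"
    and T: "tuple f T" "a \<in> carrier_mat 1 f" "b \<in> carrier_mat f 1"
    and eq: "pequiv e u Q v f a T b" and n: "n \<ge> 1" and X: "X \<in> pdom n f T"
  shows "X \<in> pdom n e Q"
proof -
  have ndT: "pnondeg f T" using n X by (auto simp: pnondeg_def)
  \<comment> \<open>A nonzero column forces e > 0, so that e - 1 is really smaller.\<close>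
  have e1: "e - 1 < e" if "c \<in> carrier_mat e 1" "c \<noteq> 0\<^sub>m e 1" for c :: "complex mat"
    using that by (cases e) (auto intro!: eq_matI)
  have bd: "bounded_along f T e u Q v"
    unfolding bounded_along_def
  proof (intro allI impI ballI)
    fix n X Z assume n: "n \<ge> (1 :: nat)" and X: "X \<in> pdom n f T" and Z: "tuple n Z"
      and ev: "\<forall>\<^sub>F t in at 0. (\<lambda>i. X i + t \<cdot>\<^sub>m Z i) \<in> pdom n e Q"
    have tX: "tuple n X" using X by (simp add: pdom_def)
    have *: "bounded_entries n n (at 0) (\<lambda>t. pval n f a T b (\<lambda>i. X i + t \<cdot>\<^sub>m Z i))"
      using entries_tendsto_imp_bounded[OF pval_tendsto[OF X Z T]] by simp
    have X0: "(\<lambda>i. X i + 0 \<cdot>\<^sub>m Z i) = X" using tX Z by (intro ext eq_matI) auto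
    have "\<forall>\<^sub>F t in at 0. (\<lambda>i. X i + t \<cdot>\<^sub>m Z i) \<in> pdom n f T"
      by (rule eventually_pdom_line[OF tX Z T(1), of 0]) (simp add: X0 X)
    with ev have "\<forall>\<^sub>F t in at 0. pval n f a T b (\<lambda>i. X i + t \<cdot>\<^sub>m Z i) = pval n e u Q v (\<lambda>i. X i + t \<cdot>\<^sub>m Z i)"
      by eventually_elim (use eq n in \<open>auto simp: pequiv_def\<close>)
    with * show "bounded_entries n n (at 0) (\<lambda>t. pval n e u Q v (\<lambda>i. X i + t \<cdot>\<^sub>m Z i))"
      by - (erule bounded_entries_cong, (use Q in \<open>auto intro!: pval_carrier\<close>)[1], assumption)
  qed
  have sp: "spanning f T e u Q"
    unfolding spanning_def
  proof (intro ballI impI, rule ccontr)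
    fix c assume c: "c \<in> carrier_mat e 1" "c \<noteq> 0\<^sub>m e 1"
      and no: "\<not> (\<exists>n\<ge>1. \<exists>X\<in>pdom n e Q \<inter> pdom n f T. pval n e u Q c X \<noteq> 0\<^sub>m n n)"
    have "\<exists>u' Q' v'. tuple (e - 1) Q' \<and> u' \<in> carrier_mat 1 (e - 1) \<and> v' \<in> carrier_mat (e - 1) 1 \<and>
      pnondeg (e - 1) Q' \<and> pequiv e u Q v (e - 1) u' Q' v'"
      by (rule pencil_reduction[OF Q nd T(1) ndT c]) (use no in auto)
    then show False using min[OF e1[OF c]] by blast
  qed
  have sp': "spanning f (tr T) e v\<^sup>T (tr Q)"
    unfolding spanning_def
  proof (intro ballI impI, rule ccontr)
    fix c assume c: "c \<in> carrier_mat e 1" "c \<noteq> 0\<^sub>m e 1"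
      and no: "\<not> (\<exists>n\<ge>1. \<exists>X\<in>pdom n e (tr Q) \<inter> pdom n f (tr T). pval n e v\<^sup>T (tr Q) c X \<noteq> 0\<^sub>m n n)"
    have cT: "c\<^sup>T \<in> carrier_mat 1 e" "c\<^sup>T \<noteq> 0\<^sub>m 1 e"
      using c by (auto, metis transpose_transpose zero_transpose_mat)
    have "\<exists>u' Q' v'. tuple (e - 1) Q' \<and> u' \<in> carrier_mat 1 (e - 1) \<and> v' \<in> carrier_mat (e - 1) 1 \<and>
      pnondeg (e - 1) Q' \<and> pequiv e u Q v (e - 1) u' Q' v'"
    proof (rule pencil_reduction_tr[OF Q nd T(1) ndT cT])
      fix n X assume "n \<ge> (1 :: nat)" and X: "X \<in> pdom n e Q" "X \<in> pdom n f T"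
      then have "tr X \<in> pdom n e (tr Q)" "tr X \<in> pdom n f (tr T)" using pdom_tr Q T by auto
      with no \<open>n \<ge> 1\<close> have "pval n e v\<^sup>T (tr Q) c (tr X) = 0\<^sub>m n n" by blast
      moreover have "pval n e v\<^sup>T (tr Q) c (tr X) = (pval n e c\<^sup>T Q v X)\<^sup>T"
        using pval_tr[OF X(1) Q(1) cT(1) Q(3)] by simp
      ultimately show "pval n e c\<^sup>T Q v X = 0\<^sub>m n n"
        by (metis transpose_transpose zero_transpose_mat)
    qed
    then show False using min[OF e1[OF c]] by blast
  qed
  \<comment> \<open>The row u is replaced by any l; after transposition the column v has become the
    row and is replaced by any w.\<close>
  have all: "bounded_along f T e l Q w" if l: "l \<in> carrier_mat 1 e" and w: "w \<in> carrier_mat e 1" for l w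
  proof -
    have 1: "bounded_along f T e l Q v"
      by (rule bounded_along_all_left[OF Q T(1) nd bd sp l])
    have 2: "bounded_along f (tr T) e v\<^sup>T (tr Q) l\<^sup>T"
      by (rule bounded_along_tr[OF 1 Q(1) T(1) l Q(3)])
    have 3: "bounded_along f (tr T) e w\<^sup>T (tr Q) l\<^sup>T"
      by (rule bounded_along_all_left[OF _ _ _ _ _ 2 sp']) (use Q T l w nd in \<open>auto simp: pnondeg_tr\<close>)
    show ?thesis using bounded_along_tr[OF 3, of] Q T l w by simp
  qed
  obtain m Y where m: "m \<ge> 1" and Y: "Y \<in> pdom m e Q" using nd by (auto simp: pnondeg_def)
  have tX: "tuple n X" and tY: "tuple m Y" using X Y by (auto simp: pdom_def)
  define N where "N = m * n"
  define X' where "X' = inflate m X"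
  define Y' where "Y' = inflate n Y"
  have X': "X' \<in> pdom N f T" and Y': "Y' \<in> pdom N e Q" and tX': "tuple N X'" and tY': "tuple N Y'"
    using inflate_pdom[OF X T(1)] inflate_pdom[OF Y Q(1), of n] tuple_inflate[OF tX] tuple_inflate[OF tY, of n]
    by (auto simp: X'_def Y'_def N_def mult.commute)
  \<comment> \<open>The line starts at the amplified X and reaches an amplified point of the domain
    of Q at t = 1, so all but finitely many of its points are in that domain.\<close>
  define Z where "Z = (\<lambda>i. Y' i - X' i)"
  have Z: "tuple N Z" using tX' tY' by (auto simp: Z_def tuple_def)
  have "(\<lambda>i. X' i + 1 \<cdot>\<^sub>m Z i) = Y'" using tX' tY'
    by (auto simp: fun_eq_iff Z_def intro!: eq_matI)
  then have ev: "\<forall>\<^sub>F t in at 0. (\<lambda>i. X' i + t \<cdot>\<^sub>m Z i) \<in> pdom N e Q"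
    using eventually_pdom_line[OF tX' Z Q(1), of 1] Y' by simp
  define M where "M t = pencil N e Q (\<lambda>i. X' i + t \<cdot>\<^sub>m Z i)" for t
  have M: "M t \<in> carrier_mat (N * e) (N * e)" for t by (simp add: M_def)
  have N1: "N \<ge> 1" using m n by (simp add: N_def)
  have "bounded_entries (N * e) (N * e) (at 0) (\<lambda>t. minv (M t))"
    unfolding bounded_entries_def
  proof (intro conjI allI impI)
    fix r s assume rs: "r < N * e" "s < N * e"
    define l where "l = mat 1 e (\<lambda>(_, k). if k = r mod e then 1 else (0 :: complex))"
    define w where "w = mat e 1 (\<lambda>(k, _). if k = s mod e then 1 else (0 :: complex))"
    have lw: "l \<in> carrier_mat 1 e" "w \<in> carrier_mat e 1" by (auto simp: l_def w_def)
    have "bounded_entries N N (at 0) (\<lambda>t. pval N e l Q w (\<lambda>i. X' i + t \<cdot>\<^sub>m Z i))"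
      using all[OF lw] N1 X' Z ev unfolding bounded_along_def by blast
    then have "(\<lambda>t. pval N e l Q w (\<lambda>i. X' i + t \<cdot>\<^sub>m Z i) $$ (r div e, s div e)) \<in> O[at 0](\<lambda>_. 1)"
      using rs by (simp add: bounded_entries_def div_less_of_less_mult)
    then show "(\<lambda>t. minv (M t) $$ (r, s)) \<in> O[at 0](\<lambda>_. 1)"
      unfolding pval_def l_def w_def M_def[symmetric] index_corner[OF minv_carrier[OF M] rs] .
  qed (use M in auto)
  then have O: "(\<lambda>t. det (minv (M t))) \<in> O[at 0](\<lambda>_. 1)" by (rule bounded_det)
  have lim: "((\<lambda>t. det (M t)) \<longlongrightarrow> det (pencil N e Q X')) (at 0)"
    unfolding M_def by (rule tendsto_det[OF pencil_tendsto[OF tX' Z Q(1)]])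
  have one: "\<forall>\<^sub>F t in at 0. det (M t) * det (minv (M t)) = 1"
    using ev
  proof eventually_elim
    case (elim t)
    then have "M t * minv (M t) = 1\<^sub>m (N * e)" by (intro minv_inverse[OF M]) (auto simp: pdom_def M_def)
    then show ?case using det_mult[OF M minv_carrier[OF M], of t t] by simp
  qed
  have "det (pencil N e Q X') \<noteq> 0"
  proof
    assume "det (pencil N e Q X') = 0"
    with lim have "(\<lambda>t. det (M t)) \<in> o[at 0](\<lambda>_. 1)" by (intro smalloI_tendsto) auto
    from landau_o.small_big_mult[OF this O] have "(\<lambda>t. det (M t) * det (minv (M t))) \<in> o[at 0](\<lambda>_. 1)" by simp
    then have "(\<lambda>t :: complex. 1 :: complex) \<in> o[at 0](\<lambda>_. 1)"
      using landau_o.small.in_cong[OF one] by blast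
    then have "((\<lambda>t :: complex. 1 / 1 :: complex) \<longlongrightarrow> 0) (at 0)" by (rule smalloD_tendsto)
    then show False by (simp add: tendsto_const_iff)
  qed
  \<comment> \<open>The determinant at the amplified point is the m-th power of the determinant at
    X.\<close>
  then have "det (pencil n e Q X) \<noteq> 0"
    unfolding X'_def N_def pencil_inflate[OF tX Q(1)] det_kron_one[OF pencil_carrier] using m by auto
  then show ?thesis using tX by (simp add: pdom_def)
qed

section \<open>Realizations of expressions\<close>

text \<open>
  Exchanges the two factors of a Kronecker product: the blocks of \<open>swapped_pencil\<close> are indexed by the
  entries of \<open>Q\<close>, so that block matrices of pencils can be evaluated blockwise.
\<close>

definition kron_swap :: "nat \<Rightarrow> nat \<Rightarrow> nat \<Rightarrow> nat \<Rightarrow> 'a mat \<Rightarrow> 'a mat" where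
  "kron_swap n e m f M = mat (e * n) (f * m) (\<lambda>(i, j). M $$ ((i mod n) * e + i div n, (j mod m) * f + j div m))"

lemma swap_index_less: "i < e * n \<Longrightarrow> (i mod n) * e + i div n < n * e" for i e n :: nat
proof -
  assume i: "i < e * n"
  then have "i mod n < n" "i div n < e" by (auto simp: mod_less_of_less_mult div_less_of_less_mult)
  then have "(i mod n) * e + i div n < (i mod n) * e + e" by simp
  also have "\<dots> = Suc (i mod n) * e" by simp
  also have "\<dots> \<le> n * e" using \<open>i mod n < n\<close> by (intro mult_le_mono1) simp
  finally show ?thesis .
qed

lemma swap_index_div_mod:
  fixes i e n :: nat
  assumes "i < e * n"
  shows "((i mod n) * e + i div n) div e = i mod n" "((i mod n) * e + i div n) mod e = i div n"
proof -
  have "i div n < e" by (rule div_less_of_less_mult[OF assms])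
  then show "((i mod n) * e + i div n) div e = i mod n" "((i mod n) * e + i div n) mod e = i div n" by auto
qed

lemma kron_swap_carrier [simp, intro]: "kron_swap n e m f M \<in> carrier_mat (e * n) (f * m)"
  by (simp add: kron_swap_def)

lemma kron_swap_kron:
  assumes "A \<in> carrier_mat n m" "B \<in> carrier_mat e f"
  shows "kron_swap n e m f (kron A B) = kron B A"
  using assms by (intro eq_matI)
    (auto simp: kron_swap_def kron_index[OF assms] kron_index[OF assms(2,1)] swap_index_less swap_index_div_mod div_less_of_less_mult intro: mult.commute)

text \<open>Swapping the tensor factors permutes rows and columns, so it is multiplicative on all
  matrices and not only on Kronecker products: the inner summation is merely reordered.\<close>

lemma kron_swap_mult:
  assumes M: "M \<in> carrier_mat (n * e) (m * f)" and N: "N \<in> carrier_mat (m * f) (p * g)"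
  shows "kron_swap n e p g (M * N) = kron_swap n e m f M * kron_swap m f p g N"
proof (rule eq_matI)
  fix i j
  assume "i < dim_row (kron_swap n e m f M * kron_swap m f p g N)" "j < dim_col (kron_swap n e m f M * kron_swap m f p g N)"
  then have ij: "i < e * n" "j < g * p" by (auto simp: kron_swap_def)
  define i' j' where "i' = (i mod n) * e + i div n" and "j' = (j mod p) * g + j div p"
  have ij': "i' < n * e" "j' < p * g" using swap_index_less ij by (auto simp: i'_def j'_def)
  have "(\<Sum>k = 0..<m * f. M $$ (i', k) * N $$ (k, j')) =
     (\<Sum>k = 0..<m * f. M $$ (i', (k div f) * f + k mod f) * N $$ ((k div f) * f + k mod f, j'))"
    by simp
  also have "\<dots> = (\<Sum>b = 0..<m. \<Sum>a = 0..<f. M $$ (i', b * f + a) * N $$ (b * f + a, j'))"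
    by (rule sum_div_mod)
  also have "\<dots> = (\<Sum>a = 0..<f. \<Sum>b = 0..<m. M $$ (i', b * f + a) * N $$ (b * f + a, j'))"
    by (rule sum.swap)
  also have "\<dots> = (\<Sum>k = 0..<f * m. M $$ (i', (k mod m) * f + k div m) * N $$ ((k mod m) * f + k div m, j'))"
    by (rule sum_div_mod[symmetric])
  also have "\<dots> = (\<Sum>k = 0..<f * m. kron_swap n e m f M $$ (i, k) * kron_swap m f p g N $$ (k, j))"
    using ij by (intro sum.cong refl) (simp add: kron_swap_def i'_def j'_def)
  also have "\<dots> = (kron_swap n e m f M * kron_swap m f p g N) $$ (i, j)"
    by (rule index_mult_mat_sum[symmetric, OF kron_swap_carrier kron_swap_carrier ij])
  finally show "kron_swap n e p g (M * N) $$ (i, j) = (kron_swap n e m f M * kron_swap m f p g N) $$ (i, j)"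
    using ij index_mult_mat_sum[OF M N ij'] by (simp add: kron_swap_def i'_def j'_def)
qed (auto simp: kron_swap_def)

lemma kron_swap_swap:
  assumes "M \<in> carrier_mat (n * e) (m * f)"
  shows "kron_swap e n f m (kron_swap n e m f M) = M"
proof (rule eq_matI)
  fix i j assume "i < dim_row M" "j < dim_col M"
  then have ij: "i < n * e" "j < m * f" using assms by auto
  have "(i mod e) * n + i div e < e * n" "(j mod f) * m + j div f < f * m"
    using swap_index_less[of i n e] swap_index_less[of j m f] ij by auto
  then show "kron_swap e n f m (kron_swap n e m f M) $$ (i, j) = M $$ (i, j)"
    using ij by (simp add: kron_swap_def swap_index_div_mod div_less_of_less_mult)
qed (use assms in \<open>auto simp: kron_swap_def\<close>)

lemma kron_swap_small: "A \<in> carrier_mat n m \<Longrightarrow> kron_swap n 1 m 1 A = A"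
  by (intro eq_matI) (auto simp: kron_swap_def)

lemma kron_swap_inverse:
  assumes M: "M \<in> carrier_mat (n * e) (n * e)"
  shows "det (kron_swap n e n e M) \<noteq> 0 \<longleftrightarrow> det M \<noteq> (0 :: 'a :: field)"
    "det M \<noteq> 0 \<Longrightarrow> minv (kron_swap n e n e M) = kron_swap n e n e (minv M)"
proof -
  have one: "kron_swap n e n e (1\<^sub>m (n * e)) = (1\<^sub>m (e * n) :: 'a mat)" for n e
    using kron_swap_kron[of "1\<^sub>m n :: 'a mat" n n "1\<^sub>m e" e e] by simp
  have *: "kron_swap n e n e M * kron_swap n e n e (minv M) = 1\<^sub>m (e * n)"
    if "M \<in> carrier_mat (n * e) (n * e)" "det M \<noteq> 0" for M :: "'a mat" and n e
    using kron_swap_mult[OF that(1) minv_carrier[OF that(1)]] minv_inverse(1)[OF that] one by metis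
  show "minv (kron_swap n e n e M) = kron_swap n e n e (minv M)" if "det M \<noteq> 0"
    by (rule minv_eqI[OF _ _ *[OF M that]]) auto
  have d: "det (kron_swap n e n e M) \<noteq> 0" if "M \<in> carrier_mat (n * e) (n * e)" "det M \<noteq> 0" for M :: "'a mat" and n e
    by (rule det_nonzeroI(1)[OF _ _ *[OF that]]) auto
  show "det (kron_swap n e n e M) \<noteq> 0 \<longleftrightarrow> det M \<noteq> 0"
    using d[OF M] d[OF kron_swap_carrier, of n e M] kron_swap_swap[OF M] by metis
qed

definition swapped_pencil :: "nat \<Rightarrow> nat \<Rightarrow> ('d :: finite option \<Rightarrow> 'a :: comm_ring_1 mat) \<Rightarrow> ('d \<Rightarrow> 'a mat) \<Rightarrow> 'a mat" where
  "swapped_pencil n e Q X = msum (e * n) (e * n) (\<lambda>i. kron (Q i) (aff_ext n X i))"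

lemma swapped_pencil_carrier [simp, intro]: "swapped_pencil n e Q X \<in> carrier_mat (e * n) (e * n)"
  by (simp add: swapped_pencil_def)

lemma swapped_pencil_dim [simp]:
  "dim_row (swapped_pencil n e Q X) = e * n" "dim_col (swapped_pencil n e Q X) = e * n"
  by (simp_all add: swapped_pencil_def)

lemma swapped_pencil_eq:
  assumes X: "tuple n X" and Q: "tuple e Q"
  shows "swapped_pencil n e Q X = kron_swap n e n e (pencil n e Q X)"
proof -
  have aff: "aff_ext n X i \<in> carrier_mat n n" "Q i \<in> carrier_mat e e" for i using X Q by auto
  show ?thesis
    by (intro eq_matI) (auto simp: swapped_pencil_def kron_swap_kron[OF aff, symmetric] pencil_def pev_def kron_swap_def
       msum_index swap_index_less)
qed

lemma swapped_pencil_pval: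
  assumes X: "tuple n X" and Q: "tuple e Q" and u: "u \<in> carrier_mat 1 e" and v: "v \<in> carrier_mat e 1"
  shows "det (swapped_pencil n e Q X) \<noteq> 0 \<longleftrightarrow> det (pencil n e Q X) \<noteq> 0"
    "det (pencil n e Q X) \<noteq> 0 \<Longrightarrow>
      pval n e u Q v X = kron u (1\<^sub>m n) * minv (swapped_pencil n e Q X) * kron v (1\<^sub>m n)"
proof -
  show "det (swapped_pencil n e Q X) \<noteq> 0 \<longleftrightarrow> det (pencil n e Q X) \<noteq> 0"
    unfolding swapped_pencil_eq[OF X Q] by (rule kron_swap_inverse(1)[OF pencil_carrier])
  assume d: "det (pencil n e Q X) \<noteq> 0"
  let ?G = "minv (pencil n e Q X)"
  have c: "kron (1\<^sub>m n) u \<in> carrier_mat (n * 1) (n * e)" "kron (1\<^sub>m n) v \<in> carrier_mat (n * e) (n * 1)"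
    "?G \<in> carrier_mat (n * e) (n * e)" using u v by auto
  have "pval n e u Q v X = kron_swap n 1 n 1 (pval n e u Q v X)"
    by (rule kron_swap_small[symmetric, OF pval_carrier[OF u v]])
  also have "\<dots> = kron u (1\<^sub>m n) * minv (swapped_pencil n e Q X) * kron v (1\<^sub>m n)"
    unfolding pval_def kron_swap_mult[OF mult_carrier_mat[OF c(1,3)] c(2)] kron_swap_mult[OF c(1,3)]
      kron_swap_kron[OF one_carrier_mat u] kron_swap_kron[OF one_carrier_mat v]
      swapped_pencil_eq[OF X Q] kron_swap_inverse(2)[OF pencil_carrier d] ..
  finally show "pval n e u Q v X = kron u (1\<^sub>m n) * minv (swapped_pencil n e Q X) * kron v (1\<^sub>m n)" .
qed

text \<open>The couplings b and c sit in the constant coefficient only, so at every point they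
  appear as scalar blocks independent of X.\<close>

definition block_pencil ::
  "(nat \<Rightarrow> nat \<Rightarrow> 'a :: comm_ring_1 mat \<Rightarrow> 'a mat \<Rightarrow> ('d option \<Rightarrow> 'a mat) \<Rightarrow> ('d option \<Rightarrow> 'a mat) \<Rightarrow> 'd option \<Rightarrow> 'a mat)" where
  "block_pencil e f b c Q R i = (if i = None then four_block_mat (Q i) b c (R i)
     else four_block_mat (Q i) (0\<^sub>m e f) (0\<^sub>m f e) (R i))"

lemma tuple_block_pencil [simp]:
  "tuple e Q \<Longrightarrow> tuple f R \<Longrightarrow> tuple (e + f) (block_pencil e f b c Q R)"
  by (auto simp: tuple_def block_pencil_def)

lemma swapped_block_pencil:
  fixes Q R :: "'d :: finite option \<Rightarrow> 'a :: comm_ring_1 mat"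
  assumes Q: "tuple e Q" and R: "tuple f R" and b: "b \<in> carrier_mat e f" and c: "c \<in> carrier_mat f e" and X: "tuple n X"
  shows "swapped_pencil n (e + f) (block_pencil e f b c Q R) X =
    four_block_mat (swapped_pencil n e Q X) (kron b (1\<^sub>m n)) (kron c (1\<^sub>m n)) (swapped_pencil n f R X)"
proof -
  define B where "B i = (if i = None then kron b (1\<^sub>m n) else 0\<^sub>m (e * n) (f * n))" for i :: "'d option"
  define C where "C i = (if i = None then kron c (1\<^sub>m n) else 0\<^sub>m (f * n) (e * n))" for i :: "'d option"
  have aff: "aff_ext n X i \<in> carrier_mat n n" for i using X by simp
  have QR: "Q i \<in> carrier_mat e e" "R i \<in> carrier_mat f f" for i using Q R by auto
  have z: "kron (0\<^sub>m p q) (aff_ext n X i) = 0\<^sub>m (p * n) (q * n)" for p q i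
    using aff[of i] by (intro eq_matI) (auto simp: kron_index[of _ p q _ n n] div_less_of_less_mult)
  have k: "kron (block_pencil e f b c Q R i) (aff_ext n X i) =
     four_block_mat (kron (Q i) (aff_ext n X i)) (B i) (C i) (kron (R i) (aff_ext n X i))" for i
  proof (cases i)
    case None
    then show ?thesis using kron_four_block[OF QR(1) b c QR(2) aff, of i i i]
      by (simp add: block_pencil_def B_def C_def) (simp add: aff_ext_def)
  next
    case (Some j)
    then show ?thesis using kron_four_block[OF QR(1) zero_carrier_mat zero_carrier_mat QR(2) aff, of i i i]
      by (simp add: block_pencil_def B_def C_def z)
  qed
  have d: "dim_row (kron (Q i) (aff_ext n X i)) = e * n" "dim_col (kron (Q i) (aff_ext n X i)) = e * n"
    "dim_row (kron (R i) (aff_ext n X i)) = f * n" "dim_col (kron (R i) (aff_ext n X i)) = f * n" for i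
    using carrier_matD[OF kron_carrier[OF QR(1) aff]] carrier_matD[OF kron_carrier[OF QR(2) aff]] by auto
  have sB: "(\<Sum>i\<in>UNIV. B i $$ (r, s)) = kron b (1\<^sub>m n) $$ (r, s)" if "r < e * n" "s < f * n" for r s
  proof -
    have "B i $$ (r, s) = (if i = None then kron b (1\<^sub>m n) $$ (r, s) else 0)" for i
      using that by (simp add: B_def)
    then show ?thesis by simp
  qed
  have sC: "(\<Sum>i\<in>UNIV. C i $$ (r, s)) = kron c (1\<^sub>m n) $$ (r, s)" if "r < f * n" "s < e * n" for r s
  proof -
    have "C i $$ (r, s) = (if i = None then kron c (1\<^sub>m n) $$ (r, s) else 0)" for i
      using that by (simp add: C_def)
    then show ?thesis by simp
  qed
  show ?thesis
    by (intro eq_matI) (auto simp: swapped_pencil_def msum_index k d sB sC distrib_right simp del: kron_dim)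
qed

text \<open>A row in two parts, written as a block matrix with empty lower blocks so that the
  product rule for four blocks applies; \<open>col_pair\<close> likewise.\<close>

definition row_pair :: "nat \<Rightarrow> nat \<Rightarrow> 'a :: zero mat \<Rightarrow> 'a mat \<Rightarrow> 'a mat" where
  "row_pair e f u w = four_block_mat u w (0\<^sub>m 0 e) (0\<^sub>m 0 f)"

definition col_pair :: "nat \<Rightarrow> nat \<Rightarrow> 'a :: zero mat \<Rightarrow> 'a mat \<Rightarrow> 'a mat" where
  "col_pair e f v w = four_block_mat v (0\<^sub>m e 0) w (0\<^sub>m f 0)"

lemma pair_carrier [simp]:
  "u \<in> carrier_mat a e \<Longrightarrow> w \<in> carrier_mat a f \<Longrightarrow> row_pair e f u w \<in> carrier_mat a (e + f)"
  "v \<in> carrier_mat e a \<Longrightarrow> x \<in> carrier_mat f a \<Longrightarrow> col_pair e f v x \<in> carrier_mat (e + f) a"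
  unfolding row_pair_def col_pair_def
  using four_block_carrier_mat[of u a e "0\<^sub>m 0 f" 0 f] four_block_carrier_mat[of v e a "0\<^sub>m f 0" f 0] by auto

lemma kron_pair:
  assumes "u \<in> carrier_mat a e" "w \<in> carrier_mat a f" "v \<in> carrier_mat e a" "x \<in> carrier_mat f a" "M \<in> carrier_mat n n"
  shows "kron (row_pair e f u w) M = row_pair (e * n) (f * n) (kron u M) (kron w M)"
    "kron (col_pair e f v x) M = col_pair (e * n) (f * n) (kron v M) (kron x M)"
proof -
  have z: "kron (0\<^sub>m 0 q) M = 0\<^sub>m 0 (q * n)" "kron (0\<^sub>m q 0) M = 0\<^sub>m (q * n) 0" for q
    using assms by (auto intro!: eq_matI)
  show "kron (row_pair e f u w) M = row_pair (e * n) (f * n) (kron u M) (kron w M)"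
    unfolding row_pair_def by (subst kron_four_block[OF assms(1,2) _ _ assms(5), of _ 0]) (auto simp: z)
  show "kron (col_pair e f v x) M = col_pair (e * n) (f * n) (kron v M) (kron x M)"
    unfolding col_pair_def by (subst kron_four_block[OF assms(3) _ assms(4) _ assms(5), of _ 0]) (auto simp: z)
qed

lemma row_pair_mult_block:
  assumes "u \<in> carrier_mat a e" "w \<in> carrier_mat a f"
    "A \<in> carrier_mat e e'" "B \<in> carrier_mat e f'" "C \<in> carrier_mat f e'" "D \<in> carrier_mat f f'"
  shows "row_pair e f u w * four_block_mat A B C D = row_pair e' f' (u * A + w * C) (u * B + w * D)"
  unfolding row_pair_def
  by (subst mult_four_block_mat[OF assms(1,2) _ _ assms(3-6)])
    (use assms in \<open>auto intro!: cong_four_block_mat eq_matI\<close>)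

lemma row_pair_mult_col_pair:
  assumes "u \<in> carrier_mat a e" "w \<in> carrier_mat a f" "v \<in> carrier_mat e b" "x \<in> carrier_mat f b"
  shows "row_pair e f u w * col_pair e f v x = u * v + w * x"
  unfolding row_pair_def col_pair_def
  by (subst mult_four_block_mat[OF assms(1,2) _ _ assms(3) _ assms(4)])
    (use assms in \<open>auto intro!: eq_matI\<close>)

lemma kron_uminus_left: "kron (- A) B = - kron A B"
proof -
  have "- C = (- 1) \<cdot>\<^sub>m C" for C :: "'a mat" by (intro eq_matI) auto
  then show ?thesis by (metis kron_smult_left)
qed

text \<open>The triangular shape makes the domain exactly the intersection of both domains. The
  coupling term gives all operations their shape: it vanishes for b = 0, which yields sums, and for
  b = - v w it is the product of the two values.\<close>

lemma block_upper_pval: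
  assumes Q: "tuple e Q" "u \<in> carrier_mat 1 e" "v \<in> carrier_mat e 1"
    and R: "tuple f R" "w \<in> carrier_mat 1 f" "x \<in> carrier_mat f 1" and b: "b \<in> carrier_mat e f" and X: "tuple n X"
  defines "S \<equiv> block_pencil e f b (0\<^sub>m f e) Q R"
  shows "det (pencil n (e + f) S X) \<noteq> 0 \<longleftrightarrow> det (pencil n e Q X) \<noteq> 0 \<and> det (pencil n f R X) \<noteq> 0"
    "det (pencil n (e + f) S X) \<noteq> 0 \<Longrightarrow>
      pval n (e + f) (row_pair e f u w) S (col_pair e f v x) X =
       pval n e u Q v X + (- (kron u (1\<^sub>m n) * (minv (swapped_pencil n e Q X) * (kron b (1\<^sub>m n) * (minv (swapped_pencil n f R X) * kron x (1\<^sub>m n))))))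
       + pval n f w R x X"
proof -
  have S: "tuple (e + f) S" using Q R by (simp add: S_def)
  have kz: "kron (0\<^sub>m f e) (1\<^sub>m n) = (0\<^sub>m (f * n) (e * n) :: complex mat)"
    by (intro eq_matI) (auto simp: kron_index[of _ f e _ n n] div_less_of_less_mult)
  have sw: "swapped_pencil n (e + f) S X =
    four_block_mat (swapped_pencil n e Q X) (kron b (1\<^sub>m n)) (0\<^sub>m (f * n) (e * n)) (swapped_pencil n f R X)"
    unfolding S_def by (subst swapped_block_pencil) (use Q R b X kz in auto)
  have kb: "kron b (1\<^sub>m n) \<in> carrier_mat (e * n) (f * n)" using b by auto
  have uw: "row_pair e f u w \<in> carrier_mat 1 (e + f)" "col_pair e f v x \<in> carrier_mat (e + f) 1" using Q R by auto
  note p = swapped_pencil_pval[OF X S uw] swapped_pencil_pval[OF X Q] swapped_pencil_pval[OF X R]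
  show eq: "det (pencil n (e + f) S X) \<noteq> 0 \<longleftrightarrow> det (pencil n e Q X) \<noteq> 0 \<and> det (pencil n f R X) \<noteq> 0"
    unfolding p(1)[symmetric] p(3)[symmetric] p(5)[symmetric] sw
    unfolding det_four_block_mat_lower_left_zero[OF swapped_pencil_carrier kb refl swapped_pencil_carrier] by simp
  assume d: "det (pencil n (e + f) S X) \<noteq> 0"
  then have d2: "det (pencil n e Q X) \<noteq> 0" "det (pencil n f R X) \<noteq> 0" using eq by auto
  then have d3: "det (swapped_pencil n e Q X) \<noteq> 0" "det (swapped_pencil n f R X) \<noteq> 0" using p by auto
  let ?G = "minv (swapped_pencil n e Q X)" and ?H = "minv (swapped_pencil n f R X)"
  let ?k = "\<lambda>A. kron A (1\<^sub>m n) :: complex mat"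
  have G: "?G \<in> carrier_mat (e * n) (e * n)" "?H \<in> carrier_mat (f * n) (f * n)" by auto
  have ks: "?k u \<in> carrier_mat n (e * n)" "?k w \<in> carrier_mat n (f * n)" "?k v \<in> carrier_mat (e * n) n" "?k x \<in> carrier_mat (f * n) n"
    using kron_carrier[OF Q(2) one_carrier_mat[of n]] kron_carrier[OF R(2) one_carrier_mat[of n]]
      kron_carrier[OF Q(3) one_carrier_mat[of n]] kron_carrier[OF R(3) one_carrier_mat[of n]] by auto
  have B: "- (?G * ?k b * ?H) \<in> carrier_mat (e * n) (f * n)" using G kb by auto
  have uG: "?k u * ?G \<in> carrier_mat n (e * n)" "?k w * ?H \<in> carrier_mat n (f * n)" using ks G by auto
  have uB: "?k u * (- (?G * ?k b * ?H)) \<in> carrier_mat n (f * n)" using ks B by auto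
  have "?k u * (?G * (?k b * (?H * ?k x))) \<in> carrier_mat n n"
    by (rule mult_carrier_mat[OF ks(1) mult_carrier_mat[OF G(1) mult_carrier_mat[OF kb mult_carrier_mat[OF G(2) ks(4)]]]])
  then have T: "- (?k u * (?G * (?k b * (?H * ?k x)))) \<in> carrier_mat n n" by (rule uminus_carrier_mat)
  have "pval n (e + f) (row_pair e f u w) S (col_pair e f v x) X =
     row_pair (e * n) (f * n) (?k u) (?k w) * four_block_mat ?G (- (?G * ?k b * ?H)) (0\<^sub>m (f * n) (e * n)) ?H *
      col_pair (e * n) (f * n) (?k v) (?k x)"
    unfolding p(2)[OF d] sw four_block_upper_inverse[OF swapped_pencil_carrier kb swapped_pencil_carrier d3]
      kron_pair[OF Q(2) R(2) Q(3) R(3) one_carrier_mat] ..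
  also have "\<dots> = row_pair (e * n) (f * n) (?k u * ?G + ?k w * 0\<^sub>m (f * n) (e * n)) (?k u * (- (?G * ?k b * ?H)) + ?k w * ?H)
      * col_pair (e * n) (f * n) (?k v) (?k x)"
    by (subst row_pair_mult_block[OF ks(1,2) G(1) B _ G(2)]) auto
  also have "?k u * ?G + ?k w * 0\<^sub>m (f * n) (e * n) = ?k u * ?G"
    using ks(2) uG(1) by (simp add: right_mult_zero_mat[OF ks(2)] right_add_zero_mat[OF uG(1)])
  also have "row_pair (e * n) (f * n) (?k u * ?G) (?k u * (- (?G * ?k b * ?H)) + ?k w * ?H)
      * col_pair (e * n) (f * n) (?k v) (?k x) =
      ?k u * ?G * ?k v + (?k u * (- (?G * ?k b * ?H)) + ?k w * ?H) * ?k x"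
    by (rule row_pair_mult_col_pair[OF uG(1) add_carrier_mat[OF uG(2)] ks(3,4)])
  also have "(?k u * (- (?G * ?k b * ?H)) + ?k w * ?H) * ?k x = ?k u * (- (?G * ?k b * ?H)) * ?k x + ?k w * ?H * ?k x"
    by (rule add_mult_distrib_mat[OF uB uG(2) ks(4)])
  also have "?k u * (- (?G * ?k b * ?H)) * ?k x = - (?k u * (?G * (?k b * (?H * ?k x))))"
    using Q R b by (simp add: mat_mult_assoc)
  finally show "pval n (e + f) (row_pair e f u w) S (col_pair e f v x) X =
       pval n e u Q v X + (- (kron u (1\<^sub>m n) * (minv (swapped_pencil n e Q X) * (kron b (1\<^sub>m n) * (minv (swapped_pencil n f R X) * kron x (1\<^sub>m n))))))
       + pval n f w R x X"
    unfolding p(4)[OF d2(1)] p(6)[OF d2(2)]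
    by (simp only: assoc_add_mat[OF mult_carrier_mat[OF uG(1) ks(3)] T mult_carrier_mat[OF uG(2) ks(4)]])
qed

text \<open>Block elimination leaves the Schur complement - P in the lower right corner. It decides
  invertibility, and its inverse is the corresponding corner of the whole inverse.\<close>

lemma bordered_inverse:
  fixes M :: "'a :: field mat"
  assumes M: "M \<in> carrier_mat N N" "det M \<noteq> 0" and V: "V \<in> carrier_mat N n" and U: "U \<in> carrier_mat n N"
  defines "P \<equiv> U * (minv M * V)"
  shows "det (four_block_mat M V U (0\<^sub>m n n)) \<noteq> 0 \<longleftrightarrow> det P \<noteq> 0"
    "det P \<noteq> 0 \<Longrightarrow> \<exists>A\<in>carrier_mat N N. \<exists>B\<in>carrier_mat N n. \<exists>C\<in>carrier_mat n N.
      minv (four_block_mat M V U (0\<^sub>m n n)) = four_block_mat A B C (- minv P)"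
proof -
  let ?B = "four_block_mat M V U (0\<^sub>m n n)"
  define G where "G = minv M"
  have G: "G \<in> carrier_mat N N" "M * G = 1\<^sub>m N" "G * M = 1\<^sub>m N" using minv_inverse[OF M] M by (auto simp: G_def)
  have GV: "G * V \<in> carrier_mat N n" and UG: "U * G \<in> carrier_mat n N" using G(1) U V by auto
  have P: "P \<in> carrier_mat n n" and P': "P = U * (G * V)" using U GV by (auto simp: P_def G_def)
  have B: "?B \<in> carrier_mat (N + n) (N + n)" using M by auto
  \<comment> \<open>A unipotent left factor that clears the block U.\<close>
  let ?L = "four_block_mat (1\<^sub>m N) (0\<^sub>m N n) (- (U * G)) (1\<^sub>m n)"
  have mUG: "- (U * G) \<in> carrier_mat n N" using UG by simp
  have "- (U * G) * M = - (U * (G * M))" using U G(1) M by (simp add: mat_mult_assoc)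
  then have 1: "- (U * G) * M + 1\<^sub>m n * U = 0\<^sub>m n N" using U G by (auto intro!: eq_matI)
  have "- (U * G) * V = - P" using U G(1) V by (simp add: mat_mult_assoc P')
  then have 2: "- (U * G) * V + 1\<^sub>m n * 0\<^sub>m n n = - P" using P by (auto intro!: eq_matI)
  have 3: "1\<^sub>m N * M + 0\<^sub>m N n * U = M" "1\<^sub>m N * V + 0\<^sub>m N n * 0\<^sub>m n n = V" using M V U by (auto intro!: eq_matI)
  have LB: "?L * ?B = four_block_mat M V (0\<^sub>m n N) (- P)"
    unfolding mult_four_block_mat[OF one_carrier_mat zero_carrier_mat mUG one_carrier_mat M(1) V U zero_carrier_mat] 1 2 3 ..
  have "det ?L = 1"
    by (subst det_four_block_mat_upper_right_zero[OF one_carrier_mat refl mUG one_carrier_mat]) simp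
  moreover have "?L \<in> carrier_mat (N + n) (N + n)" by auto
  ultimately have "det ?B = det (?L * ?B)" using B by (subst det_mult) auto
  also have "\<dots> = det M * det (- P)"
    unfolding LB using P by (intro det_four_block_mat_lower_left_zero[OF M(1) V refl]) auto
  also have "- P = (- 1) \<cdot>\<^sub>m P" by (intro eq_matI) auto
  finally show "det ?B \<noteq> 0 \<longleftrightarrow> det P \<noteq> 0" using M by simp
  assume "det P \<noteq> 0"
  note iP = minv_inverse[OF P this]
  define J where "J = minv P"
  have J: "J \<in> carrier_mat n n" "P * J = 1\<^sub>m n" "J * P = 1\<^sub>m n" using iP P by (auto simp: J_def)
  have JUG: "J * (U * G) \<in> carrier_mat n N" and GVJ: "G * V * J \<in> carrier_mat N n"
    by (rule mult_carrier_mat[OF J(1) UG], rule mult_carrier_mat[OF GV J(1)])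
  have GVJUG: "G * V * (J * (U * G)) \<in> carrier_mat N N" by (rule mult_carrier_mat[OF GV JUG])
  have VJUG: "V * (J * (U * G)) \<in> carrier_mat N N" by (rule mult_carrier_mat[OF V JUG])
  define A where "A = G - G * V * (J * (U * G))"
  have A: "A \<in> carrier_mat N N" unfolding A_def by (rule minus_carrier_mat[OF GVJUG])
  have mg: "M * (G * W) = W" if "W \<in> carrier_mat N p" for W p
    using assoc_mult_mat[OF M(1) G(1) that] unfolding G(2) left_mult_one_mat[OF that] by simp
  have "M * (G * V * (J * (U * G))) = V * (J * (U * G))"
    using mg[OF VJUG] assoc_mult_mat[OF G(1) V JUG] by simp
  then have MA: "M * A = 1\<^sub>m N - V * (J * (U * G))"
    unfolding A_def using mult_minus_distrib_mat[OF M(1) G(1) GVJUG] G(2) by simp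
  have "U * (G * V * (J * (U * G))) = P * J * (U * G)"
    unfolding P' using U G(1) V J(1) by (simp add: mat_mult_assoc)
  then have "U * (G * V * (J * (U * G))) = U * G" unfolding J(2) left_mult_one_mat[OF UG] .
  then have UA: "U * A = 0\<^sub>m n N"
    unfolding A_def using mult_minus_distrib_mat[OF U G(1) GVJUG] UG by auto
  have MGVJ: "M * (G * V * J) = V * J"
    using mg[OF mult_carrier_mat[OF V J(1)]] assoc_mult_mat[OF G(1) V J(1)] by simp
  have UGVJ: "U * (G * V * J) = 1\<^sub>m n"
    using assoc_mult_mat[OF U GV J(1)] J(2) by (simp add: P')
  have mJ: "- J \<in> carrier_mat n n" using J by simp
  have VJ: "V * J \<in> carrier_mat N n" by (rule mult_carrier_mat[OF V J(1)])
  have VmJ: "V * - J = - (V * J)" using V J(1) by (intro uminus_mult_right_mat) simp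
  have cancel: "1\<^sub>m N - W + W = 1\<^sub>m N" if "W \<in> carrier_mat N N" for W :: "'a mat"
    using that by (auto intro!: eq_matI)
  have cancel2: "W + - W = 0\<^sub>m N n" if "W \<in> carrier_mat N n" for W :: "'a mat"
    using that by (auto intro!: eq_matI)
  have "?B * four_block_mat A (G * V * J) (J * (U * G)) (- J) =
     four_block_mat (M * A + V * (J * (U * G))) (M * (G * V * J) + V * - J)
      (U * A + 0\<^sub>m n n * (J * (U * G))) (U * (G * V * J) + 0\<^sub>m n n * - J)"
    by (rule mult_four_block_mat[OF M(1) V U zero_carrier_mat A GVJ JUG mJ])
  also have "\<dots> = four_block_mat (1\<^sub>m N) (0\<^sub>m N n) (0\<^sub>m n N) (1\<^sub>m n)"
    unfolding MA MGVJ UA UGVJ VmJ left_mult_zero_mat[OF JUG] left_mult_zero_mat[OF mJ]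
    using cancel[OF VJUG] cancel2[OF VJ] by simp
  finally have inv: "?B * four_block_mat A (G * V * J) (J * (U * G)) (- J) = 1\<^sub>m (N + n)" by simp
  have "minv ?B = four_block_mat A (G * V * J) (J * (U * G)) (- J)"
    by (rule minv_eqI[OF B _ inv]) (use A J in auto)
  then show "\<exists>A\<in>carrier_mat N N. \<exists>B\<in>carrier_mat N n. \<exists>C\<in>carrier_mat n N.
      minv ?B = four_block_mat A B C (- minv P)"
    using A GVJ JUG unfolding J_def by blast
qed

text \<open>Bordering by v and u with a zero corner makes the value the negative of a Schur
  complement. The vectors w and x read off the corner of the inverse, and the entry -1 of w
  compensates the sign.\<close>

lemma bordered_pval:
  assumes Q: "tuple e Q" "u \<in> carrier_mat 1 e" "v \<in> carrier_mat e 1" and X: "tuple n X"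
    and d: "det (pencil n e Q X) \<noteq> 0"
  defines "S \<equiv> block_pencil e 1 v u Q (\<lambda>_. 0\<^sub>m 1 1)"
  defines "w \<equiv> row_pair e 1 (0\<^sub>m 1 e) (- 1\<^sub>m 1)" and "x \<equiv> col_pair e 1 (0\<^sub>m e 1) (1\<^sub>m 1)"
  shows "det (pencil n (e + 1) S X) \<noteq> 0 \<longleftrightarrow> det (pval n e u Q v X) \<noteq> 0"
    "det (pencil n (e + 1) S X) \<noteq> 0 \<Longrightarrow> pval n (e + 1) w S x X = minv (pval n e u Q v X)"
proof -
  have m1: "- 1\<^sub>m 1 \<in> carrier_mat 1 1" by simp
  have S: "tuple (e + 1) S" using Q unfolding S_def by (intro tuple_block_pencil) (auto simp: tuple_def)
  have w: "w \<in> carrier_mat 1 (e + 1)" and x: "x \<in> carrier_mat (e + 1) 1"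
    unfolding w_def x_def by (rule pair_carrier; simp)+
  define M where "M = swapped_pencil n e Q X"
  let ?k = "\<lambda>A. kron A (1\<^sub>m n) :: complex mat"
  have M: "M \<in> carrier_mat (e * n) (e * n)" "det M \<noteq> 0"
    using swapped_pencil_pval(1)[OF X Q] d by (auto simp: M_def)
  have kv: "?k v \<in> carrier_mat (e * n) n" and ku: "?k u \<in> carrier_mat n (e * n)"
    using kron_carrier[OF Q(2) one_carrier_mat[of n]] kron_carrier[OF Q(3) one_carrier_mat[of n]] by auto
  have z: "?k (0\<^sub>m p q) = 0\<^sub>m (p * n) (q * n)" for p q
    by (intro eq_matI) (auto simp: kron_index[of _ p q _ n n] div_less_of_less_mult)
  have aff: "aff_ext n X i \<in> carrier_mat n n" for i using X by simp
  have "kron (0\<^sub>m 1 1) (aff_ext n X i) = 0\<^sub>m n n" for i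
    using aff[of i] by (intro eq_matI) (auto simp: kron_index[of _ 1 1 _ n n])
  then have "swapped_pencil n 1 (\<lambda>_. 0\<^sub>m 1 1) X = 0\<^sub>m n n"
    unfolding swapped_pencil_def by (intro eq_matI) (auto simp: msum_index)
  then have sw: "swapped_pencil n (e + 1) S X = four_block_mat M (?k v) (?k u) (0\<^sub>m n n)"
    unfolding S_def M_def by (subst swapped_block_pencil) (use Q X in \<open>auto simp: tuple_def\<close>)
  define P where "P = pval n e u Q v X"
  have P: "P = ?k u * (minv M * ?k v)"
    unfolding P_def swapped_pencil_pval(2)[OF X Q d] M_def[symmetric]
    by (rule assoc_mult_mat[OF ku minv_carrier[OF M(1)] kv])
  have cP: "P \<in> carrier_mat n n" unfolding P_def by (rule pval_carrier[OF Q(2,3)])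
  note bi = bordered_inverse[OF M kv ku, folded P]
  show eq: "det (pencil n (e + 1) S X) \<noteq> 0 \<longleftrightarrow> det (pval n e u Q v X) \<noteq> 0"
    unfolding swapped_pencil_pval(1)[OF X S w x, symmetric] sw P_def[symmetric] by (rule bi(1))
  assume dS: "det (pencil n (e + 1) S X) \<noteq> 0"
  then have "det P \<noteq> 0" using eq by (simp add: P_def)
  from bi(2)[OF this] obtain A B C where ABC: "A \<in> carrier_mat (e * n) (e * n)" "B \<in> carrier_mat (e * n) n" "C \<in> carrier_mat n (e * n)"
    "minv (four_block_mat M (?k v) (?k u) (0\<^sub>m n n)) = four_block_mat A B C (- minv P)" by blast
  have mP: "- minv P \<in> carrier_mat n n" using cP by simp
  have m1': "- 1\<^sub>m n \<in> carrier_mat n n" by simp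
  have k1: "?k (- 1\<^sub>m 1) = - 1\<^sub>m n" by (intro eq_matI) (auto simp: kron_index[of _ 1 1 _ n n])
  have k2: "?k (1\<^sub>m 1) = 1\<^sub>m n" by (rule one_kron[OF one_carrier_mat])
  have kw: "?k w = row_pair (e * n) n (0\<^sub>m n (e * n)) (- 1\<^sub>m n)"
    unfolding w_def by (subst kron_pair(1)[of _ 1 _ _ _ "0\<^sub>m e 1" "1\<^sub>m 1"]) (simp_all add: z[of 1, simplified] k1[simplified])
  have kx: "?k x = col_pair (e * n) n (0\<^sub>m (e * n) n) (1\<^sub>m n)"
    unfolding x_def by (subst kron_pair(2)[of "0\<^sub>m 1 e" 1 _ "1\<^sub>m 1"]) (simp_all add: z[of _ 1, simplified] k2[simplified])
  have mC: "- 1\<^sub>m n * C \<in> carrier_mat n (e * n)" using mult_carrier_mat[OF m1' ABC(3)] .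
  have mm: "- 1\<^sub>m n * (- minv P) = minv P"
    using cP by (subst uminus_mult_left_mat) (auto intro!: eq_matI)
  have "pval n (e + 1) w S x X = ?k w * four_block_mat A B C (- minv P) * ?k x"
    unfolding swapped_pencil_pval(2)[OF X S w x dS] sw ABC(4) ..
  also have "?k w * four_block_mat A B C (- minv P) =
     row_pair (e * n) n (0\<^sub>m n (e * n) * A + - 1\<^sub>m n * C) (0\<^sub>m n (e * n) * B + - 1\<^sub>m n * (- minv P))"
    unfolding kw by (rule row_pair_mult_block[OF zero_carrier_mat m1' ABC(1-3) mP])
  also have "\<dots> = row_pair (e * n) n (- 1\<^sub>m n * C) (minv P)"
    unfolding mm left_mult_zero_mat[OF ABC(1)] left_mult_zero_mat[OF ABC(2)] left_add_zero_mat[OF mC]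
      left_add_zero_mat[OF minv_carrier[OF cP]] ..
  also have "\<dots> * ?k x = - 1\<^sub>m n * C * 0\<^sub>m (e * n) n + minv P * 1\<^sub>m n"
    unfolding kx by (rule row_pair_mult_col_pair[OF mC minv_carrier[OF cP] zero_carrier_mat one_carrier_mat])
  also have "\<dots> = minv P"
    unfolding right_mult_zero_mat[OF mC] right_mult_one_mat[OF minv_carrier[OF cP]] left_add_zero_mat[OF minv_carrier[OF cP]] ..
  finally show "pval n (e + 1) w S x X = minv (pval n e u Q v X)" by (simp add: P_def)
qed

section \<open>A realization for every expression\<close>

lemma mat_inverse_minv:
  assumes A: "A \<in> carrier_mat n n"
  shows "mat_inverse A = (if det A \<noteq> 0 then Some (minv A) else None)"
proof (cases "det A = 0")
  case True
  have "mat_inverse A \<noteq> Some B" for B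
    using mat_inverse_eq_Some_iff[OF A, of B] det_nonzeroI(1)[OF A, of B] True by auto
  then show ?thesis using True by (cases "mat_inverse A") auto
next
  case False
  then have "mat_inverse A = Some (minv A)"
    unfolding mat_inverse_eq_Some_iff[OF A] using minv_inverse[OF A] A by simp
  then show ?thesis using False by simp
qed

text \<open>Equality of partial functions: the pencil is singular exactly where the evaluation
  fails. This is stronger than \<open>pequiv\<close> and allows domains of expressions to be
  exchanged for domains of pencils.\<close>

definition represents where
  "represents e u Q v r \<longleftrightarrow> tuple e Q \<and> u \<in> carrier_mat 1 e \<and> v \<in> carrier_mat e 1 \<and>
    (\<forall>n X. tuple n X \<longrightarrow> eval_expr n X r =
       (if det (pencil n e Q X) \<noteq> 0 then Some (pval n e u Q v X) else None))"

lemma expr_representation: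
  fixes r :: "'d :: finite rat_expr"
  shows "\<exists>e u Q v. represents e u Q v r"
proof (induction r)
  case (Const c)
  define Q :: "'d option \<Rightarrow> complex mat" where "Q i = (if i = None then 1\<^sub>m 1 else 0\<^sub>m 1 1)" for i
  have Q: "tuple 1 Q" by (simp add: Q_def tuple_def)
  have "eval_expr n X (Const c) = (if det (pencil n 1 Q X) \<noteq> 0 then Some (pval n 1 (c \<cdot>\<^sub>m 1\<^sub>m 1) Q (1\<^sub>m 1) X) else None)"
    if X: "tuple n X" for n X
  proof -
    have aff: "aff_ext n X i \<in> carrier_mat n n" for i using X by simp
    have "kron (Q i) (aff_ext n X i) = (if i = None then 1\<^sub>m n else 0\<^sub>m n n)" for i
      using aff[of i] by (intro eq_matI) (auto simp: Q_def aff_ext_def kron_index[of _ 1 1 _ n n] one_kron)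
    then have "swapped_pencil n 1 Q X = 1\<^sub>m n"
      unfolding swapped_pencil_def
      by (intro eq_matI) (auto simp: msum_index if_distrib[of "\<lambda>x. x $$ _"] cong: if_cong)
    moreover have "minv (1\<^sub>m n) = (1\<^sub>m n :: complex mat)" by (rule minv_eqI) auto
    moreover have "kron (c \<cdot>\<^sub>m 1\<^sub>m 1) (1\<^sub>m n) = c \<cdot>\<^sub>m 1\<^sub>m n"
      unfolding kron_smult_left by (simp add: one_kron[of _ n n, simplified])
    moreover have "c \<cdot>\<^sub>m 1\<^sub>m n * 1\<^sub>m n * 1\<^sub>m n = c \<cdot>\<^sub>m 1\<^sub>m n" by simp
    ultimately show ?thesis
      using swapped_pencil_pval[OF X Q, of "c \<cdot>\<^sub>m 1\<^sub>m 1" "1\<^sub>m 1"] one_kron[OF one_carrier_mat[of n]] by simp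
  qed
  then show ?case using Q unfolding represents_def
    by (intro exI[of _ 1] exI[of _ "c \<cdot>\<^sub>m 1\<^sub>m 1"] exI[of _ Q] exI[of _ "1\<^sub>m 1"]) auto
next
  case (Var k)
  \<comment> \<open>E is nilpotent with E E = 0, so 1 - E \<otimes> x has the inverse 1 + E
    \<otimes> x at every point. The vectors u and v read its block in row 0 and column 1, which is
    x.\<close>
  define E where "E = mat 2 2 (\<lambda>(i, j). if i = 0 \<and> j = 1 then 1 else (0 :: complex))"
  define Q :: "'d option \<Rightarrow> complex mat" where
    "Q i = (case i of None \<Rightarrow> 1\<^sub>m 2 | Some j \<Rightarrow> if j = k then - E else 0\<^sub>m 2 2)" for i
  define u where "u = mat 1 2 (\<lambda>(_, j). if j = 0 then 1 else (0 :: complex))"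
  define v where "v = mat 2 1 (\<lambda>(i, _). if i = 1 then 1 else (0 :: complex))"
  have c: "E \<in> carrier_mat 2 2" "u \<in> carrier_mat 1 2" "v \<in> carrier_mat 2 1" by (auto simp: E_def u_def v_def)
  have Q: "tuple 2 Q" using c by (auto simp: Q_def tuple_def split: option.split)
  have two: "{0..<2} = {0, 1 :: nat}" by auto
  have EE: "E * E = 0\<^sub>m 2 2" by (intro eq_matI) (auto simp: E_def scalar_prod_def two)
  have uv: "u * v = 0\<^sub>m 1 1" by (intro eq_matI) (auto simp: u_def v_def scalar_prod_def two)
  have uE: "u * E = mat 1 2 (\<lambda>(_, j). if j = 1 then 1 else 0)"
    by (intro eq_matI) (auto simp: u_def E_def scalar_prod_def two)
  have uEv: "u * E * v = 1\<^sub>m 1" unfolding uE by (intro eq_matI) (auto simp: v_def scalar_prod_def two)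
  have "eval_expr n X (Var k) = (if det (pencil n 2 Q X) \<noteq> 0 then Some (pval n 2 u Q v X) else None)"
    if X: "tuple n X" for n X
  proof -
    have Xk: "X k \<in> carrier_mat n n" using X by simp
    define K where "K = kron E (X k)"
    have K: "K \<in> carrier_mat (2 * n) (2 * n)" unfolding K_def by (rule kron_carrier[OF c(1) Xk])
    have KK: "K * K = 0\<^sub>m (2 * n) (2 * n)" unfolding K_def kron_mult[OF c(1) c(1) Xk Xk] EE
      using Xk by (intro eq_matI) (auto simp: kron_index[of _ 2 2 _ n n] div_less_of_less_mult)
    have kron_eq: "kron (Q i) (aff_ext n X i) $$ (r, s) = (if i = None then 1\<^sub>m (2 * n) $$ (r, s) else 0)
        + (if i = Some k then - K $$ (r, s) else 0)" if "r < 2 * n" "s < 2 * n" for i r s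
    proof (cases i)
      case None
      then show ?thesis by (simp add: Q_def aff_ext_def)
    next
      case (Some j)
      have Xj: "X j \<in> carrier_mat n n" using X by simp
      show ?thesis using Some that Xj c
        by (auto simp: Q_def aff_ext_def K_def kron_index[of _ 2 2 _ n n] div_less_of_less_mult)
    qed
    have sw: "swapped_pencil n 2 Q X = 1\<^sub>m (2 * n) - K"
      unfolding swapped_pencil_def using K
      by (intro eq_matI) (auto simp: msum_index kron_eq sum.distrib)
    have "(1\<^sub>m (2 * n) - K) * (1\<^sub>m (2 * n) + K) = 1\<^sub>m (2 * n) * (1\<^sub>m (2 * n) + K) - K * (1\<^sub>m (2 * n) + K)"
      by (rule minus_mult_distrib_mat[OF one_carrier_mat K]) (use K in auto)
    also have "K * (1\<^sub>m (2 * n) + K) = K * 1\<^sub>m (2 * n) + K * K"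
      by (rule mult_add_distrib_mat[OF K one_carrier_mat K])
    also have "1\<^sub>m (2 * n) * (1\<^sub>m (2 * n) + K) - (K * 1\<^sub>m (2 * n) + K * K) = 1\<^sub>m (2 * n)"
      unfolding KK using K by (auto intro!: eq_matI)
    finally have inv: "(1\<^sub>m (2 * n) - K) * (1\<^sub>m (2 * n) + K) = 1\<^sub>m (2 * n)" .
    have cs: "1\<^sub>m (2 * n) - K \<in> carrier_mat (2 * n) (2 * n)" "1\<^sub>m (2 * n) + K \<in> carrier_mat (2 * n) (2 * n)"
      using K by auto
    have d: "det (swapped_pencil n 2 Q X) \<noteq> 0" unfolding sw by (rule det_nonzeroI(1)[OF cs inv])
    have m: "minv (swapped_pencil n 2 Q X) = 1\<^sub>m (2 * n) + K" unfolding sw by (rule minv_eqI[OF cs inv])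
    note p = swapped_pencil_pval[OF X Q c(2,3)]
    have ku: "kron u (1\<^sub>m n) \<in> carrier_mat n (2 * n)" and kv: "kron v (1\<^sub>m n) \<in> carrier_mat (2 * n) n"
      using kron_carrier[OF c(2) one_carrier_mat[of n]] kron_carrier[OF c(3) one_carrier_mat[of n]] by auto
    have "pval n 2 u Q v X = kron u (1\<^sub>m n) * (1\<^sub>m (2 * n) + K) * kron v (1\<^sub>m n)" using p d m by simp
    also have "\<dots> = kron u (1\<^sub>m n) * kron v (1\<^sub>m n) + kron u (1\<^sub>m n) * K * kron v (1\<^sub>m n)"
      unfolding mult_add_distrib_mat[OF ku one_carrier_mat K] right_mult_one_mat[OF ku]
      by (rule add_mult_distrib_mat[OF ku mult_carrier_mat[OF ku K] kv])
    also have "kron u (1\<^sub>m n) * kron v (1\<^sub>m n) = 0\<^sub>m n n"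
      unfolding kron_mult[OF c(2,3) one_carrier_mat one_carrier_mat] uv
      by (intro eq_matI) (auto simp: kron_index[of _ 1 1 _ n n])
    also have "kron u (1\<^sub>m n) * K * kron v (1\<^sub>m n) = X k"
      unfolding K_def kron_mult[OF c(2,1) one_carrier_mat Xk] left_mult_one_mat[OF Xk]
        kron_mult[OF mult_carrier_mat[OF c(2,1)] c(3) Xk one_carrier_mat] right_mult_one_mat[OF Xk] uEv
      by (rule one_kron[OF Xk])
    also have "0\<^sub>m n n + X k = X k" by (rule left_add_zero_mat[OF Xk])
    finally show ?thesis using d p(1) by simp
  qed
  then show ?case using Q c unfolding represents_def by blast
next
  case (Add r s)
  then obtain e u Q v f w R x where rr: "represents e u Q v r" and ss: "represents f w R x s" by blast
  then have Q: "tuple e Q" "u \<in> carrier_mat 1 e" "v \<in> carrier_mat e 1"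
    and R: "tuple f R" "w \<in> carrier_mat 1 f" "x \<in> carrier_mat f 1" by (auto simp: represents_def)
  define S where "S = block_pencil e f (0\<^sub>m e f) (0\<^sub>m f e) Q R"
  have "eval_expr n X (Add r s) = (if det (pencil n (e + f) S X) \<noteq> 0
     then Some (pval n (e + f) (row_pair e f u w) S (col_pair e f v x) X) else None)" if X: "tuple n X" for n X
  proof -
    note b = block_upper_pval[OF Q R zero_carrier_mat X, folded S_def]
    have cp: "pval n e u Q v X \<in> carrier_mat n n" "pval n f w R x X \<in> carrier_mat n n"
      using Q R by (auto intro: pval_carrier)
    have z: "kron (0\<^sub>m e f) (1\<^sub>m n) = (0\<^sub>m (e * n) (f * n) :: complex mat)"
      by (intro eq_matI) (auto simp: kron_index[of _ e f _ n n] div_less_of_less_mult)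
    have kx: "kron x (1\<^sub>m n) \<in> carrier_mat (f * n) n" and ku: "kron u (1\<^sub>m n) \<in> carrier_mat n (e * n)"
      using kron_carrier[OF R(3) one_carrier_mat[of n]] kron_carrier[OF Q(2) one_carrier_mat[of n]] by auto
    have "kron u (1\<^sub>m n) * (minv (swapped_pencil n e Q X) * (kron (0\<^sub>m e f) (1\<^sub>m n) *
       (minv (swapped_pencil n f R X) * kron x (1\<^sub>m n)))) = 0\<^sub>m n n"
      unfolding z left_mult_zero_mat[OF mult_carrier_mat[OF minv_carrier[OF swapped_pencil_carrier] kx]]
        right_mult_zero_mat[OF minv_carrier[OF swapped_pencil_carrier]] right_mult_zero_mat[OF ku] ..
    then show ?thesis
      using rr ss X b cp unfolding represents_def by (auto intro!: eq_matI)
  qed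
  moreover have "tuple (e + f) S" using Q R by (simp add: S_def)
  moreover have "row_pair e f u w \<in> carrier_mat 1 (e + f)" "col_pair e f v x \<in> carrier_mat (e + f) 1" using Q R by auto
  ultimately show ?case unfolding represents_def by blast
next
  case (Mult r s)
  then obtain e u Q v f w R x where rr: "represents e u Q v r" and ss: "represents f w R x s" by blast
  then have Q: "tuple e Q" "u \<in> carrier_mat 1 e" "v \<in> carrier_mat e 1"
    and R: "tuple f R" "w \<in> carrier_mat 1 f" "x \<in> carrier_mat f 1" by (auto simp: represents_def)
  \<comment> \<open>The minus sign cancels the one in the inverse of the block triangular
    matrix.\<close>
  define b where "b = - (v * w)"
  have vw: "v * w \<in> carrier_mat e f" by (rule mult_carrier_mat[OF Q(3) R(2)])
  have b: "b \<in> carrier_mat e f" using vw by (simp add: b_def)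
  define S where "S = block_pencil e f b (0\<^sub>m f e) Q R"
  have "eval_expr n X (Mult r s) = (if det (pencil n (e + f) S X) \<noteq> 0
     then Some (pval n (e + f) (row_pair e f u (0\<^sub>m 1 f)) S (col_pair e f (0\<^sub>m e 1) x) X) else None)" if X: "tuple n X" for n X
  proof -
    note bl = block_upper_pval[OF Q(1,2) zero_carrier_mat R(1) zero_carrier_mat R(3) b X, folded S_def]
    have cp: "pval n e u Q v X \<in> carrier_mat n n" "pval n f w R x X \<in> carrier_mat n n"
      using Q R by (auto intro: pval_carrier)
    have z: "pval n e u Q (0\<^sub>m e 1) X = 0\<^sub>m n n" "pval n f (0\<^sub>m 1 f) R x X = 0\<^sub>m n n"
      using kron_one_carrier Q R unfolding pval_def kron_one_zero
      by (auto simp: left_mult_zero_mat[of _ "n * f"] right_mult_zero_mat[of _ n "n * e"] intro!: mult_carrier_mat[where n = "n * e"])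
    let ?G = "minv (swapped_pencil n e Q X)" and ?H = "minv (swapped_pencil n f R X)"
    let ?k = "\<lambda>A. kron A (1\<^sub>m n) :: complex mat"
    have kb: "?k b = - (?k v * ?k w)"
      unfolding kron_mult[OF Q(3) R(2) one_carrier_mat one_carrier_mat] b_def kron_uminus_left by simp
    have val: "pval n (e + f) (row_pair e f u (0\<^sub>m 1 f)) S (col_pair e f (0\<^sub>m e 1) x) X = pval n e u Q v X * pval n f w R x X"
      if d: "det (pencil n (e + f) S X) \<noteq> 0"
    proof -
      have d2: "det (pencil n e Q X) \<noteq> 0" "det (pencil n f R X) \<noteq> 0" using bl(1) d by auto
      have "?k u * (?G * (?k b * (?H * ?k x))) = - (pval n e u Q v X * pval n f w R x X)"
        unfolding swapped_pencil_pval(2)[OF X Q d2(1)] swapped_pencil_pval(2)[OF X R d2(2)] kb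
        using Q R by (simp add: mat_mult_assoc)
      then show ?thesis using bl(2)[OF d] cp unfolding z by (auto intro!: eq_matI)
    qed
    then show ?thesis
      using rr ss X bl(1) unfolding represents_def by auto
  qed
  moreover have "tuple (e + f) S" using Q R by (simp add: S_def)
  moreover have "row_pair e f u (0\<^sub>m 1 f) \<in> carrier_mat 1 (e + f)" "col_pair e f (0\<^sub>m e 1) x \<in> carrier_mat (e + f) 1" using Q R by auto
  ultimately show ?case unfolding represents_def by blast
next
  case (Inv r)
  then obtain e u Q v where rr: "represents e u Q v r" by blast
  then have Q: "tuple e Q" "u \<in> carrier_mat 1 e" "v \<in> carrier_mat e 1" by (auto simp: represents_def)
  define f where "f = e + 1"
  define R where "R = block_pencil e 1 v u Q (\<lambda>_. 0\<^sub>m 1 1)"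
  define w where "w = row_pair e 1 (0\<^sub>m 1 e) (- 1\<^sub>m 1 :: complex mat)"
  define x where "x = col_pair e 1 (0\<^sub>m e 1) (1\<^sub>m 1 :: complex mat)"
  have R: "tuple f R" "w \<in> carrier_mat 1 f" "x \<in> carrier_mat f 1"
    unfolding f_def R_def w_def x_def using Q
    by (intro tuple_block_pencil, auto simp: tuple_def)[1] (rule pair_carrier; simp)+
  \<comment> \<open>The bordered pencil R may be invertible where Q is singular, for instance where
    Q is a vanishing 1 by 1 pencil while u and v are nonzero. The additional diagonal block Q forces
    the operand to be defined; paired with zero vectors, it leaves the value unchanged.\<close>
  define S where "S = block_pencil e f (0\<^sub>m e f) (0\<^sub>m f e) Q R"
  have "eval_expr n X (Inv r) = (if det (pencil n (e + f) S X) \<noteq> 0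
     then Some (pval n (e + f) (row_pair e f (0\<^sub>m 1 e) w) S (col_pair e f (0\<^sub>m e 1) x) X) else None)" if X: "tuple n X" for n X
  proof -
    note bl = block_upper_pval[OF Q(1) zero_carrier_mat zero_carrier_mat R zero_carrier_mat X, folded S_def]
    note bp = bordered_pval[OF Q X, folded R_def w_def x_def f_def]
    have cp: "pval n e u Q v X \<in> carrier_mat n n" "pval n f w R x X \<in> carrier_mat n n"
      using Q R by (auto intro: pval_carrier)
    have z: "pval n e (0\<^sub>m 1 e) Q (0\<^sub>m e 1) X = 0\<^sub>m n n"
      unfolding pval_def kron_one_zero by (simp add: right_mult_zero_mat[of _ n "n * e"])
    have kz: "kron (0\<^sub>m 1 e) (1\<^sub>m n) = (0\<^sub>m n (e * n) :: complex mat)"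
      by (intro eq_matI) (auto simp: kron_index[of _ 1 e _ n n] div_less_of_less_mult)
    have kx: "kron x (1\<^sub>m n) \<in> carrier_mat (f * n) n" using kron_carrier[OF R(3) one_carrier_mat[of n]] by auto
    have "minv (swapped_pencil n e Q X) * (kron (0\<^sub>m e f) (1\<^sub>m n) *
       (minv (swapped_pencil n f R X) * kron x (1\<^sub>m n))) \<in> carrier_mat (e * n) n"
      by (rule mult_carrier_mat[OF minv_carrier[OF swapped_pencil_carrier] mult_carrier_mat[OF kron_carrier[OF zero_carrier_mat one_carrier_mat]
         mult_carrier_mat[OF minv_carrier[OF swapped_pencil_carrier] kx]]])
    then have z2: "kron (0\<^sub>m 1 e) (1\<^sub>m n) * (minv (swapped_pencil n e Q X) * (kron (0\<^sub>m e f) (1\<^sub>m n) *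
       (minv (swapped_pencil n f R X) * kron x (1\<^sub>m n)))) = 0\<^sub>m n n"
      unfolding kz by (rule left_mult_zero_mat)
    have val: "pval n (e + f) (row_pair e f (0\<^sub>m 1 e) w) S (col_pair e f (0\<^sub>m e 1) x) X = minv (pval n e u Q v X)"
      if d: "det (pencil n (e + f) S X) \<noteq> 0"
    proof -
      have d2: "det (pencil n e Q X) \<noteq> 0" "det (pencil n f R X) \<noteq> 0" using bl(1) d by auto
      have "pval n (e + f) (row_pair e f (0\<^sub>m 1 e) w) S (col_pair e f (0\<^sub>m e 1) x) X = pval n f w R x X"
        unfolding bl(2)[OF d] z z2 using cp by (auto intro!: eq_matI)
      then show ?thesis using bp(2)[OF d2] by simp
    qed
    show ?thesis
      using rr X bl(1) bp(1) val cp unfolding represents_def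
      by (auto simp: mat_inverse_minv[OF cp(1)])
  qed
  moreover have "tuple (e + f) S" using Q R by (simp add: S_def)
  moreover have "row_pair e f (0\<^sub>m 1 e) w \<in> carrier_mat 1 (e + f)" "col_pair e f (0\<^sub>m e 1) x \<in> carrier_mat (e + f) 1" using R by auto
  ultimately show ?case unfolding represents_def by blast
qed

section \<open>Expressions for pencils at hermitian tuples\<close>

definition nsum :: "nat \<Rightarrow> nat \<Rightarrow> nat \<Rightarrow> (nat \<Rightarrow> complex mat) \<Rightarrow> complex mat" where
  "nsum n m e f = mat n m (\<lambda>ij. \<Sum>l<e. f l $$ ij)"

lemma nsum_carrier [simp, intro]: "nsum n m e f \<in> carrier_mat n m"
  by (simp add: nsum_def)

lemma nsum_dim [simp]: "dim_row (nsum n m e f) = n" "dim_col (nsum n m e f) = m"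
  by (simp_all add: nsum_def)

lemma nsum_index: "i < n \<Longrightarrow> j < m \<Longrightarrow> nsum n m e f $$ (i, j) = (\<Sum>l<e. f l $$ (i, j))"
  by (simp add: nsum_def)

lemma nsum_cong: "(\<And>l. l < e \<Longrightarrow> f l = g l) \<Longrightarrow> nsum n m e f = nsum n m e g"
  unfolding nsum_def by (intro arg_cong[of _ _ "mat n m"] ext sum.cong) auto

lemma nsum_Suc:
  assumes "f 0 \<in> carrier_mat n m"
  shows "nsum n m (Suc e) f = f 0 + nsum n m e (\<lambda>l. f (Suc l))"
  using assms by (intro eq_matI) (auto simp: nsum_index sum.lessThan_Suc_shift simp del: sum.lessThan_Suc)

lemma mult_nsum:
  assumes A: "A \<in> carrier_mat n' n" and f: "\<And>l. l < e \<Longrightarrow> f l \<in> carrier_mat n m"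
  shows "A * nsum n m e f = nsum n' m e (\<lambda>l. A * f l)"
proof (rule eq_matI)
  fix i j assume "i < dim_row (nsum n' m e (\<lambda>l. A * f l))" "j < dim_col (nsum n' m e (\<lambda>l. A * f l))"
  then have ij: "i < n'" "j < m" by auto
  have "(A * nsum n m e f) $$ (i, j) = (\<Sum>k = 0..<n. \<Sum>l<e. A $$ (i, k) * f l $$ (k, j))"
    unfolding index_mult_mat_sum[OF A nsum_carrier ij] using ij
    by (intro sum.cong refl) (simp add: nsum_index sum_distrib_left)
  also have "\<dots> = (\<Sum>l<e. \<Sum>k = 0..<n. A $$ (i, k) * f l $$ (k, j))" by (rule sum.swap)
  also have "\<dots> = nsum n' m e (\<lambda>l. A * f l) $$ (i, j)"
    unfolding nsum_index[OF ij] by (intro sum.cong refl) (simp only: index_mult_mat_sum[OF A f ij] lessThan_iff)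
  finally show "(A * nsum n m e f) $$ (i, j) = nsum n' m e (\<lambda>l. A * f l) $$ (i, j)" .
qed (use A in auto)

lemma nsum_mult:
  assumes A: "A \<in> carrier_mat m m'" and f: "\<And>l. l < e \<Longrightarrow> f l \<in> carrier_mat n m"
  shows "nsum n m e f * A = nsum n m' e (\<lambda>l. f l * A)"
proof (rule eq_matI)
  fix i j assume "i < dim_row (nsum n m' e (\<lambda>l. f l * A))" "j < dim_col (nsum n m' e (\<lambda>l. f l * A))"
  then have ij: "i < n" "j < m'" by auto
  have "(nsum n m e f * A) $$ (i, j) = (\<Sum>k = 0..<m. \<Sum>l<e. f l $$ (i, k) * A $$ (k, j))"
    unfolding index_mult_mat_sum[OF nsum_carrier A ij] using ij
    by (intro sum.cong refl) (simp add: nsum_index sum_distrib_right)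
  also have "\<dots> = (\<Sum>l<e. \<Sum>k = 0..<m. f l $$ (i, k) * A $$ (k, j))" by (rule sum.swap)
  also have "\<dots> = nsum n m' e (\<lambda>l. f l * A) $$ (i, j)"
    unfolding nsum_index[OF ij] by (intro sum.cong refl) (simp only: index_mult_mat_sum[OF f A ij] lessThan_iff)
  finally show "(nsum n m e f * A) $$ (i, j) = nsum n m' e (\<lambda>l. f l * A) $$ (i, j)" .
qed (use A in auto)

lemma nsum_swap: "nsum n m e (\<lambda>j. nsum n m f (\<lambda>k. F k j)) = nsum n m f (\<lambda>k. nsum n m e (\<lambda>j. F k j))"
  by (intro eq_matI) (auto simp: nsum_index intro: sum.swap)

lemma add_minus_cancel_mat:
  fixes A B :: "complex mat"
  assumes "A \<in> carrier_mat n m" "B \<in> carrier_mat n m"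
  shows "A + B - A = B"
  using assms by (auto intro!: eq_matI)

text \<open>The equation p y = b is solved for y 0 with the left inverse G of the pivot and
  substituted into q y. The row q is arbitrary: it will be another row of the system as well as the
  output row u.\<close>

lemma nsum_eliminate:
  assumes q: "\<And>j. j < Suc e \<Longrightarrow> q j \<in> carrier_mat n n" and p: "\<And>j. j < Suc e \<Longrightarrow> p j \<in> carrier_mat n n"
    and y: "\<And>j. j < Suc e \<Longrightarrow> y j \<in> carrier_mat n m" and G: "G \<in> carrier_mat n n" "G * p 0 = 1\<^sub>m n"
    and b: "nsum n m (Suc e) (\<lambda>j. p j * y j) = b"
  shows "nsum n m (Suc e) (\<lambda>j. q j * y j) =
    q 0 * (G * b) + nsum n m e (\<lambda>j. (q (Suc j) - q 0 * (G * p (Suc j))) * y (Suc j))"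
proof -
  have c0: "q 0 \<in> carrier_mat n n" "p 0 \<in> carrier_mat n n" "y 0 \<in> carrier_mat n m" using q p y by auto
  have c: "q (Suc j) \<in> carrier_mat n n" "p (Suc j) \<in> carrier_mat n n" "y (Suc j) \<in> carrier_mat n m" if "j < e" for j
    using q p y that by auto
  define T where "T = nsum n m e (\<lambda>j. p (Suc j) * y (Suc j))"
  define S where "S = nsum n m e (\<lambda>j. q (Suc j) * y (Suc j))"
  have T: "T \<in> carrier_mat n m" and S: "S \<in> carrier_mat n m" by (simp_all add: T_def S_def)
  have py: "p 0 * y 0 \<in> carrier_mat n m" and qy: "q 0 * y 0 \<in> carrier_mat n m" using c0 by auto
  have "b = p 0 * y 0 + T" unfolding b[symmetric] T_def by (rule nsum_Suc) (rule py)
  then have "G * b = y 0 + G * T"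
    using mult_add_distrib_mat[OF G(1) py T] assoc_mult_mat[OF G(1) c0(2,3)] G(2) c0(3) by simp
  then have 1: "q 0 * (G * b) = q 0 * y 0 + q 0 * (G * T)"
    using mult_add_distrib_mat[OF c0(1,3) mult_carrier_mat[OF G(1) T]] by simp
  have GT: "q 0 * (G * T) \<in> carrier_mat n m" using c0 G(1) T by auto
  have "G * T = nsum n m e (\<lambda>j. G * (p (Suc j) * y (Suc j)))"
    unfolding T_def by (rule mult_nsum[OF G(1)]) (rule mult_carrier_mat[OF c(2,3)])
  then have "q 0 * (G * T) = nsum n m e (\<lambda>j. q 0 * (G * (p (Suc j) * y (Suc j))))"
    by (simp only:, intro mult_nsum[OF c0(1)] mult_carrier_mat[OF G(1) mult_carrier_mat[OF c(2,3)]])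
  then have gt: "(q 0 * (G * T)) $$ (r, s) = (\<Sum>j<e. (q 0 * (G * (p (Suc j) * y (Suc j)))) $$ (r, s))" if "r < n" "s < m" for r s
    using that by (simp add: nsum_index del: index_mult_mat)
  have "(q (Suc j) - q 0 * (G * p (Suc j))) * y (Suc j) = q (Suc j) * y (Suc j) - q 0 * (G * (p (Suc j) * y (Suc j)))"
    if "j < e" for j
  proof -
    have "q 0 * (G * p (Suc j)) \<in> carrier_mat n n" using c[OF that] c0 G(1) by auto
    from minus_mult_distrib_mat[OF c(1)[OF that] this c(3)[OF that]] show ?thesis
      using c[OF that] c0 G(1) by (simp add: mat_mult_assoc)
  qed
  moreover have "(q (Suc j) * y (Suc j) - q 0 * (G * (p (Suc j) * y (Suc j)))) $$ (r, s) =
     (q (Suc j) * y (Suc j)) $$ (r, s) - (q 0 * (G * (p (Suc j) * y (Suc j)))) $$ (r, s)"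
    if "j < e" "r < n" "s < m" for j r s
    using c[OF that(1)] c0 G(1) that by (intro index_minus_mat) auto
  ultimately have rest: "nsum n m e (\<lambda>j. (q (Suc j) - q 0 * (G * p (Suc j))) * y (Suc j)) = S - q 0 * (G * T)"
    using GT S by (intro eq_matI) (auto simp: nsum_index gt S_def sum_subtractf simp del: index_mult_mat)
  have first: "nsum n m (Suc e) (\<lambda>j. q j * y j) = q 0 * y 0 + S"
    unfolding S_def by (rule nsum_Suc) (rule qy)
  have regroup: "A + C = A + B + (C - B)" if "A \<in> carrier_mat n m" "B \<in> carrier_mat n m" "C \<in> carrier_mat n m"
    for A B C :: "complex mat"
    using that by (auto intro!: eq_matI)
  show ?thesis unfolding 1 first rest by (rule regroup[OF qy GT S])
qed

definition sub_expr :: "'d rat_expr \<Rightarrow> 'd rat_expr \<Rightarrow> 'd rat_expr" where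
  "sub_expr r s = Add r (Mult (Const (- 1)) s)"

lemma eval_sub_expr:
  assumes "eval_expr n X r = Some A" "eval_expr n X s = Some B" "A \<in> carrier_mat n n" "B \<in> carrier_mat n n"
  shows "eval_expr n X (sub_expr r s) = Some (A - B)"
proof -
  have "(- 1) \<cdot>\<^sub>m 1\<^sub>m n * B = (- 1) \<cdot>\<^sub>m B"
    using mult_smult_assoc_mat[OF one_carrier_mat assms(4), of "- 1"] left_mult_one_mat[OF assms(4)] by simp
  then have "A + (- 1) \<cdot>\<^sub>m 1\<^sub>m n * B = A - B" using assms by (auto intro!: eq_matI)
  then show ?thesis using assms by (simp add: sub_expr_def)
qed

text \<open>Gaussian elimination for \<open>u P\<^sup>-\<^sup>1 w\<close>, which uses only the inverses of the diagonal pivots.\<close>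

fun schur_expr :: "nat \<Rightarrow> (nat \<Rightarrow> nat \<Rightarrow> 'd rat_expr) \<Rightarrow> (nat \<Rightarrow> 'd rat_expr) \<Rightarrow> (nat \<Rightarrow> 'd rat_expr) \<Rightarrow> 'd rat_expr" where
  "schur_expr 0 P u w = Const 0"
| "schur_expr (Suc e) P u w = Add (Mult (u 0) (Mult (Inv (P 0 0)) (w 0)))
    (schur_expr e (\<lambda>i j. sub_expr (P (Suc i) (Suc j)) (Mult (P (Suc i) 0) (Mult (Inv (P 0 0)) (P 0 (Suc j)))))
      (\<lambda>j. sub_expr (u (Suc j)) (Mult (u 0) (Mult (Inv (P 0 0)) (P 0 (Suc j)))))
      (\<lambda>i. sub_expr (w (Suc i)) (Mult (P (Suc i) 0) (Mult (Inv (P 0 0)) (w 0)))))"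

definition evals where
  "evals n X r A \<longleftrightarrow> eval_expr n X r = Some A \<and> A \<in> carrier_mat n n"

text \<open>One entry of a Schur complement, in the shape shared by the matrix, the row and the
  column in the recursion of \<open>schur_expr\<close>.\<close>

lemma evals_step:
  assumes "evals n X r A" "evals n X p B" "evals n X q C" "evals n X s D" "mat_inverse B = Some G"
  shows "evals n X (sub_expr r (Mult q (Mult (Inv p) s))) (A - C * (G * D))"
proof -
  have c: "A \<in> carrier_mat n n" "B \<in> carrier_mat n n" "C \<in> carrier_mat n n" "D \<in> carrier_mat n n"
    using assms by (auto simp: evals_def)
  have G: "G \<in> carrier_mat n n" using mat_inverse_eq_Some_iff[OF c(2)] assms(5) by auto
  have CGD: "C * (G * D) \<in> carrier_mat n n" using c G by auto
  have "eval_expr n X (Mult q (Mult (Inv p) s)) = Some (C * (G * D))"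
    using assms by (simp add: evals_def)
  then show ?thesis using eval_sub_expr[of n X r A _ "C * (G * D)"] assms(1) CGD
    by (auto simp: evals_def intro: minus_carrier_mat)
qed

text \<open>Elimination preserves a solution y of P y = w together with the output u y. So wherever
  the pivots happen to be invertible the value is u y, at hermitian and other tuples alike;
  equivalence of expressions demands equality at all of them.\<close>

lemma schur_expr_value:
  assumes "\<And>i j. i < e \<Longrightarrow> j < e \<Longrightarrow> evals n X (P i j) (Pm i j)"
    and "\<And>j. j < e \<Longrightarrow> evals n X (u j) (um j)" and "\<And>j. j < e \<Longrightarrow> evals n X (w j) (wm j)"
    and "\<And>j. j < e \<Longrightarrow> y j \<in> carrier_mat n n"
    and "\<And>i. i < e \<Longrightarrow> nsum n n e (\<lambda>j. Pm i j * y j) = wm i"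
    and "eval_expr n X (schur_expr e P u w) = Some s"
  shows "s = nsum n n e (\<lambda>j. um j * y j)"
  using assms
proof (induction e arbitrary: P u w Pm um wm y s)
  case 0
  then show ?case by (auto intro!: eq_matI simp: nsum_index)
next
  case (Suc e)
  note P = Suc.prems(1) and u = Suc.prems(2) and w = Suc.prems(3) and y = Suc.prems(4) and eq = Suc.prems(5)
  let ?P = "\<lambda>i j. sub_expr (P (Suc i) (Suc j)) (Mult (P (Suc i) 0) (Mult (Inv (P 0 0)) (P 0 (Suc j))))"
  let ?u = "\<lambda>j. sub_expr (u (Suc j)) (Mult (u 0) (Mult (Inv (P 0 0)) (P 0 (Suc j))))"
  let ?w = "\<lambda>i. sub_expr (w (Suc i)) (Mult (P (Suc i) 0) (Mult (Inv (P 0 0)) (w 0)))"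
  have c: "\<And>i j. i < Suc e \<Longrightarrow> j < Suc e \<Longrightarrow> Pm i j \<in> carrier_mat n n" "\<And>j. j < Suc e \<Longrightarrow> um j \<in> carrier_mat n n"
    "\<And>j. j < Suc e \<Longrightarrow> wm j \<in> carrier_mat n n"
    using P u w by (auto simp: evals_def)
  have e0: "eval_expr n X (P 0 0) = Some (Pm 0 0)" "eval_expr n X (u 0) = Some (um 0)" "eval_expr n X (w 0) = Some (wm 0)"
    using P u w by (auto simp: evals_def)
  obtain G s' where G: "mat_inverse (Pm 0 0) = Some G" and s': "eval_expr n X (schur_expr e ?P ?u ?w) = Some s'"
    and s: "s = um 0 * (G * wm 0) + s'"
    using Suc.prems(6) by (auto simp: e0 bind_eq_Some_conv)
  have Gi: "G \<in> carrier_mat n n" "G * Pm 0 0 = 1\<^sub>m n"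
    using mat_inverse_eq_Some_iff[of "Pm 0 0" n G] c(1)[of 0 0] G by auto
  have "s' = nsum n n e (\<lambda>j. (um (Suc j) - um 0 * (G * Pm 0 (Suc j))) * y (Suc j))"
  proof (rule Suc.IH[OF _ _ _ _ _ s'])
    show "evals n X (?P i j) (Pm (Suc i) (Suc j) - Pm (Suc i) 0 * (G * Pm 0 (Suc j)))" if "i < e" "j < e" for i j
      using that by (intro evals_step[where B = "Pm 0 0"] P G) auto
    show "evals n X (?u j) (um (Suc j) - um 0 * (G * Pm 0 (Suc j)))" if "j < e" for j
      using that by (intro evals_step[where B = "Pm 0 0"] P u G) auto
    show "evals n X (?w i) (wm (Suc i) - Pm (Suc i) 0 * (G * wm 0))" if "i < e" for i
      using that by (intro evals_step[where B = "Pm 0 0"] P w G) auto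
    show "y (Suc j) \<in> carrier_mat n n" if "j < e" for j using that y by simp
    show "nsum n n e (\<lambda>j. (Pm (Suc i) (Suc j) - Pm (Suc i) 0 * (G * Pm 0 (Suc j))) * y (Suc j)) =
      wm (Suc i) - Pm (Suc i) 0 * (G * wm 0)" if i: "i < e" for i
    proof -
      have "nsum n n (Suc e) (\<lambda>j. Pm (Suc i) j * y j) = Pm (Suc i) 0 * (G * wm 0) +
         nsum n n e (\<lambda>j. (Pm (Suc i) (Suc j) - Pm (Suc i) 0 * (G * Pm 0 (Suc j))) * y (Suc j))"
        by (rule nsum_eliminate[where p = "Pm 0"]) (use i c y Gi eq in auto)
      moreover have "Pm (Suc i) 0 * (G * wm 0) \<in> carrier_mat n n"
        using c(1)[of "Suc i" 0] c(3)[of 0] Gi i by auto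
      ultimately show ?thesis using eq[of "Suc i"] i add_minus_cancel_mat[OF _ nsum_carrier] by simp
    qed
  qed
  moreover have "nsum n n (Suc e) (\<lambda>j. um j * y j) = um 0 * (G * wm 0) +
         nsum n n e (\<lambda>j. (um (Suc j) - um 0 * (G * Pm 0 (Suc j))) * y (Suc j))"
    by (rule nsum_eliminate[where p = "Pm 0"]) (use c y Gi eq in auto)
  ultimately show ?case by (simp add: s)
qed

text \<open>Zero is not in the numerical range of the block matrix \<open>P\<close>; unlike positivity, this needs no order.\<close>

definition anisotropic :: "nat \<Rightarrow> nat \<Rightarrow> (nat \<Rightarrow> nat \<Rightarrow> complex mat) \<Rightarrow> bool" where
  "anisotropic n e P \<longleftrightarrow> (\<forall>x. (\<forall>j<e. x j \<in> carrier_mat n 1) \<longrightarrow>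
     (\<Sum>i<e. \<Sum>a<n. cnj (x i $$ (a, 0)) * nsum n 1 e (\<lambda>j. P i j * x j) $$ (a, 0)) = 0 \<longrightarrow>
     (\<forall>j<e. x j = 0\<^sub>m n 1))"

text \<open>A kernel vector of the pivot, padded by zeros, makes the form vanish, so it must be
  zero.\<close>

lemma anisotropic_pivot:
  assumes an: "anisotropic n (Suc e) P" and P: "\<And>i j. i < Suc e \<Longrightarrow> j < Suc e \<Longrightarrow> P i j \<in> carrier_mat n n"
  shows "det (P 0 0) \<noteq> 0"
proof
  have P0: "P 0 0 \<in> carrier_mat n n" using P by simp
  assume "det (P 0 0) = 0"
  then obtain v where v: "v \<in> carrier_vec n" "v \<noteq> 0\<^sub>v n" "P 0 0 *\<^sub>v v = 0\<^sub>v n"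
    using det_0_iff_vec_prod_zero[OF P0] by blast
  define x where "x j = (if j = 0 then mat n 1 (\<lambda>(a, _). v $ a) else 0\<^sub>m n 1)" for j :: nat
  have x: "x j \<in> carrier_mat n 1" for j by (simp add: x_def)
  have "(P 0 0 * x 0) $$ (a, 0) = 0" if "a < n" for a
  proof -
    have "(P 0 0 *\<^sub>v v) $ a = 0" using v(3) that by simp
    then show ?thesis using that v(1) P0 by (simp add: x_def scalar_prod_def)
  qed
  then have Px: "P 0 0 * x 0 = 0\<^sub>m n 1"
    using P0 x[of 0] by (intro eq_matI) (auto simp del: index_mult_mat(1))
  have "nsum n 1 (Suc e) (\<lambda>j. P 0 j * x j) $$ (a, 0) = 0" if "a < n" for a
  proof -
    have "(P 0 l * x l) $$ (a, 0) = 0" if "l < Suc e" for l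
    proof (cases "l = 0")
      case True
      then show ?thesis using Px \<open>a < n\<close> by simp
    next
      case False
      then have "P 0 l * x l = 0\<^sub>m n 1" using right_mult_zero_mat[OF P[of 0 l]] that by (simp add: x_def)
      then show ?thesis using \<open>a < n\<close> by simp
    qed
    then show ?thesis using that by (simp add: nsum_index del: index_mult_mat)
  qed
  then have "(\<Sum>i<Suc e. \<Sum>a<n. cnj (x i $$ (a, 0)) * nsum n 1 (Suc e) (\<lambda>j. P i j * x j) $$ (a, 0)) = 0"
    by (intro sum.neutral ballI) (auto simp: x_def)
  then have "x 0 = 0\<^sub>m n 1" using an x unfolding anisotropic_def by blast
  then have "x 0 $$ (a, 0) = 0" if "a < n" for a using that by simp
  then have "v $ a = 0" if "a < n" for a using that by (simp add: x_def)
  with v show False by (auto intro: eq_vecI)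
qed

text \<open>The form of the Schur complement at x is the form of P at an extension of x by a first
  block, chosen such that the first block of P z vanishes. The remaining blocks of P z then are
  those of the Schur complement applied to x.\<close>

lemma anisotropic_schur:
  assumes an: "anisotropic n (Suc e) P" and P: "\<And>i j. i < Suc e \<Longrightarrow> j < Suc e \<Longrightarrow> P i j \<in> carrier_mat n n"
    and G: "G \<in> carrier_mat n n" "G * P 0 0 = 1\<^sub>m n" "P 0 0 * G = 1\<^sub>m n"
  shows "anisotropic n e (\<lambda>i j. P (Suc i) (Suc j) - P (Suc i) 0 * (G * P 0 (Suc j)))" (is "anisotropic n e ?R")
  unfolding anisotropic_def
proof (intro allI impI)
  fix x j assume x: "\<forall>j<e. x j \<in> carrier_mat n 1"
    and form: "(\<Sum>i<e. \<Sum>a<n. cnj (x i $$ (a, 0)) * nsum n 1 e (\<lambda>j. ?R i j * x j) $$ (a, 0)) = 0"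
    and j: "j < e"
  define T where "T = nsum n 1 e (\<lambda>j. P 0 (Suc j) * x j)"
  have T: "T \<in> carrier_mat n 1" by (simp add: T_def)
  define z where "z i = (case i of 0 \<Rightarrow> - (G * T) | Suc j \<Rightarrow> x j)" for i
  have zS: "z (Suc i) = x i" for i by (simp add: z_def)
  have GT: "G * T \<in> carrier_mat n 1" by (rule mult_carrier_mat[OF G(1) T])
  have z: "z i \<in> carrier_mat n 1" if "i < Suc e" for i
    using that x GT by (auto simp: z_def split: nat.split)
  have P00: "P 0 0 \<in> carrier_mat n n" using P by simp
  have row0: "nsum n 1 (Suc e) (\<lambda>j. P 0 j * z j) = 0\<^sub>m n 1"
  proof -
    have "P 0 0 * (G * T) = T" using assoc_mult_mat[OF P00 G(1) T] G(3) T by simp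
    then have "P 0 0 * z 0 = - T" using P00 GT uminus_mult_right_mat[of "P 0 0" "G * T"] G by (simp add: z_def)
    moreover have "nsum n 1 (Suc e) (\<lambda>j. P 0 j * z j) = P 0 0 * z 0 + nsum n 1 e (\<lambda>l. P 0 (Suc l) * z (Suc l))"
      by (rule nsum_Suc) (rule mult_carrier_mat[OF P00 z], simp)
    ultimately have "nsum n 1 (Suc e) (\<lambda>j. P 0 j * z j) = - T + T" by (simp add: z_def T_def)
    then show ?thesis using T by simp
  qed
  have row: "nsum n 1 (Suc e) (\<lambda>j. P (Suc i) j * z j) = nsum n 1 e (\<lambda>j. ?R i j * x j)" if "i < e" for i
  proof -
    have "nsum n 1 (Suc e) (\<lambda>j. P (Suc i) j * z j) =
      P (Suc i) 0 * (G * 0\<^sub>m n 1) + nsum n 1 e (\<lambda>j. (P (Suc i) (Suc j) - P (Suc i) 0 * (G * P 0 (Suc j))) * z (Suc j))"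
      by (rule nsum_eliminate[where p = "P 0"]) (use that P z G row0 in auto)
    moreover have "P (Suc i) 0 * (G * 0\<^sub>m n 1) = 0\<^sub>m n 1"
      using right_mult_zero_mat[OF G(1)] right_mult_zero_mat[OF P[of "Suc i" 0]] that by simp
    ultimately show ?thesis by (simp add: z_def)
  qed
  have "(\<Sum>i<Suc e. \<Sum>a<n. cnj (z i $$ (a, 0)) * nsum n 1 (Suc e) (\<lambda>j. P i j * z j) $$ (a, 0)) =
     (\<Sum>i<e. \<Sum>a<n. cnj (z (Suc i) $$ (a, 0)) * nsum n 1 (Suc e) (\<lambda>j. P (Suc i) j * z j) $$ (a, 0))"
    unfolding sum.lessThan_Suc_shift row0 by simp
  also have "\<dots> = (\<Sum>i<e. \<Sum>a<n. cnj (x i $$ (a, 0)) * nsum n 1 e (\<lambda>j. ?R i j * x j) $$ (a, 0))"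
    by (intro sum.cong refl) (simp only: row zS lessThan_iff)
  finally have "\<forall>i<Suc e. z i = 0\<^sub>m n 1"
    using an z form unfolding anisotropic_def by auto
  then have "z (Suc j) = 0\<^sub>m n 1" using j by blast
  then show "x j = 0\<^sub>m n 1" by (simp add: z_def)
qed

lemma schur_expr_defined:
  assumes "\<And>i j. i < e \<Longrightarrow> j < e \<Longrightarrow> evals n X (P i j) (Pm i j)"
    and "\<And>j. j < e \<Longrightarrow> evals n X (u j) (um j)" and "\<And>j. j < e \<Longrightarrow> evals n X (w j) (wm j)"
    and "anisotropic n e Pm"
  shows "eval_expr n X (schur_expr e P u w) \<noteq> None"
  using assms
proof (induction e arbitrary: P u w Pm um wm)
  case 0
  then show ?case by simp
next
  case (Suc e)
  note P = Suc.prems(1) and u = Suc.prems(2) and w = Suc.prems(3) and an = Suc.prems(4)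
  have c: "\<And>i j. i < Suc e \<Longrightarrow> j < Suc e \<Longrightarrow> Pm i j \<in> carrier_mat n n"
    using P by (auto simp: evals_def)
  have e0: "eval_expr n X (P 0 0) = Some (Pm 0 0)" "eval_expr n X (u 0) = Some (um 0)" "eval_expr n X (w 0) = Some (wm 0)"
    using P u w by (auto simp: evals_def)
  define G where "G = minv (Pm 0 0)"
  have P0: "Pm 0 0 \<in> carrier_mat n n" using c by simp
  have d: "det (Pm 0 0) \<noteq> 0" by (rule anisotropic_pivot[OF an c])
  have Gi: "G \<in> carrier_mat n n" "G * Pm 0 0 = 1\<^sub>m n" "Pm 0 0 * G = 1\<^sub>m n"
    using minv_inverse[OF P0 d] P0 by (auto simp: G_def)
  have G: "mat_inverse (Pm 0 0) = Some G" unfolding mat_inverse_eq_Some_iff[OF P0] using Gi by simp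
  have "eval_expr n X (schur_expr e (\<lambda>i j. sub_expr (P (Suc i) (Suc j)) (Mult (P (Suc i) 0) (Mult (Inv (P 0 0)) (P 0 (Suc j)))))
      (\<lambda>j. sub_expr (u (Suc j)) (Mult (u 0) (Mult (Inv (P 0 0)) (P 0 (Suc j)))))
      (\<lambda>i. sub_expr (w (Suc i)) (Mult (P (Suc i) 0) (Mult (Inv (P 0 0)) (w 0))))) \<noteq> None"
  proof (rule Suc.IH[OF _ _ _ anisotropic_schur[OF an c Gi]])
    show "evals n X (sub_expr (P (Suc i) (Suc j)) (Mult (P (Suc i) 0) (Mult (Inv (P 0 0)) (P 0 (Suc j)))))
       (Pm (Suc i) (Suc j) - Pm (Suc i) 0 * (G * Pm 0 (Suc j)))" if "i < e" "j < e" for i j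
      using that by (intro evals_step[where B = "Pm 0 0"] P G) auto
    show "evals n X (sub_expr (u (Suc j)) (Mult (u 0) (Mult (Inv (P 0 0)) (P 0 (Suc j)))))
       (um (Suc j) - um 0 * (G * Pm 0 (Suc j)))" if "j < e" for j
      using that by (intro evals_step[where B = "Pm 0 0"] P u G) auto
    show "evals n X (sub_expr (w (Suc i)) (Mult (P (Suc i) 0) (Mult (Inv (P 0 0)) (w 0))))
       (wm (Suc i) - Pm (Suc i) 0 * (G * wm 0))" if "i < e" for i
      using that by (intro evals_step[where B = "Pm 0 0"] P w G) auto
  qed auto
  then show ?case using G by (auto simp: e0)
qed

primrec sum_expr :: "nat \<Rightarrow> (nat \<Rightarrow> 'd rat_expr) \<Rightarrow> 'd rat_expr" where
  "sum_expr 0 f = Const 0"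
| "sum_expr (Suc e) f = Add (sum_expr e f) (f e)"

lemma evals_sum_expr:
  assumes "\<And>i. i < e \<Longrightarrow> evals n X (f i) (A i)"
  shows "evals n X (sum_expr e f) (nsum n n e A)"
  using assms
proof (induction e)
  case 0
  then show ?case by (auto simp: evals_def nsum_index intro!: eq_matI)
next
  case (Suc e)
  then have "evals n X (sum_expr e f) (nsum n n e A)" "evals n X (f e) (A e)" by auto
  moreover from this have "nsum n n e A + A e = nsum n n (Suc e) A"
    by (auto simp: evals_def nsum_index intro!: eq_matI)
  ultimately show ?case by (auto simp: evals_def)
qed

section \<open>Pencil entries as expressions, and the Gram matrix of a pencil\<close>

definition var_list :: "'d :: finite list" where
  "var_list = (SOME xs. distinct xs \<and> set xs = UNIV)"

lemma var_list: "distinct (var_list :: 'd :: finite list)" "set (var_list :: 'd list) = UNIV"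
proof -
  have "\<exists>xs :: 'd list. distinct xs \<and> set xs = UNIV"
    using finite_distinct_list[OF finite[of "UNIV :: 'd set"]] by blast
  from someI_ex[OF this] show "distinct (var_list :: 'd list)" "set (var_list :: 'd list) = UNIV"
    unfolding var_list_def by auto
qed

definition lin_expr :: "('d :: finite option \<Rightarrow> complex) \<Rightarrow> 'd rat_expr" where
  "lin_expr q = foldr (\<lambda>k r. Add (Mult (Const (q (Some k))) (Var k)) r) var_list (Const (q None))"

text \<open>A single block of the swapped pencil, where q lists one fixed entry of all coefficients.
  It is an affine combination of the variables and hence an expression without inverses.\<close>

definition entry_pencil :: "nat \<Rightarrow> ('d :: finite \<Rightarrow> complex mat) \<Rightarrow> ('d option \<Rightarrow> complex) \<Rightarrow> complex mat" where
  "entry_pencil n X q = mat n n (\<lambda>ab. \<Sum>i\<in>UNIV. q i * aff_ext n X i $$ ab)"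

lemma evals_lin_expr:
  assumes X: "tuple n X"
  shows "evals n X (lin_expr q) (entry_pencil n X q)"
proof -
  have "evals n X (foldr (\<lambda>k r. Add (Mult (Const (q (Some k))) (Var k)) r) ks (Const (q None)))
    (mat n n (\<lambda>ab. q None * 1\<^sub>m n $$ ab + (\<Sum>k\<leftarrow>ks. q (Some k) * X k $$ ab)))" for ks
  proof (induction ks)
    case Nil
    then show ?case by (auto simp: evals_def intro!: eq_matI)
  next
    case (Cons k ks)
    have Xk: "X k \<in> carrier_mat n n" using X by simp
    have "q (Some k) \<cdot>\<^sub>m 1\<^sub>m n * X k = q (Some k) \<cdot>\<^sub>m X k"
      using mult_smult_assoc_mat[OF one_carrier_mat Xk] left_mult_one_mat[OF Xk] by simp
    moreover have "q (Some k) \<cdot>\<^sub>m X k + mat n n (\<lambda>ab. q None * 1\<^sub>m n $$ ab + (\<Sum>k\<leftarrow>ks. q (Some k) * X k $$ ab)) =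
       mat n n (\<lambda>ab. q None * 1\<^sub>m n $$ ab + (\<Sum>k\<leftarrow>k # ks. q (Some k) * X k $$ ab))"
      using Xk by (intro eq_matI) auto
    ultimately show ?case using Cons by (simp add: evals_def)
  qed
  from this[of var_list] show ?thesis
  proof -
    have "(\<Sum>i\<in>UNIV. q i * aff_ext n X i $$ ab) = q None * 1\<^sub>m n $$ ab + (\<Sum>k\<leftarrow>var_list. q (Some k) * X k $$ ab)" for ab
      by (simp add: UNIV_option_conv sum.reindex aff_ext_def sum_list_distinct_conv_sum_set var_list)
    with \<open>evals n X (foldr _ var_list _) _\<close> show ?thesis by (simp add: entry_pencil_def lin_expr_def)
  qed
qed

abbreviation block :: "nat \<Rightarrow> ('d :: finite option \<Rightarrow> complex mat) \<Rightarrow> ('d \<Rightarrow> complex mat) \<Rightarrow> nat \<Rightarrow> nat \<Rightarrow> complex mat" where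
  "block n Q X i j \<equiv> entry_pencil n X (\<lambda>m. Q m $$ (i, j))"

lemma block_carrier [simp, intro]: "entry_pencil n X q \<in> carrier_mat n n"
  by (simp add: entry_pencil_def)

text \<open>Translates an identity for the whole pencil into the system of block equations on which
  the elimination operates.\<close>

lemma swapped_pencil_mult_block:
  assumes Q: "tuple e Q" and X: "tuple n X" and Z: "Z \<in> carrier_mat (e * n) m" and i: "i < e"
  shows "nsum n m e (\<lambda>j. block n Q X i j * mat n m (\<lambda>(a, b). Z $$ (j * n + a, b))) =
    mat n m (\<lambda>(a, b). (swapped_pencil n e Q X * Z) $$ (i * n + a, b))"
proof (rule eq_matI)
  fix a c assume "a < dim_row (mat n m (\<lambda>(a, b). (swapped_pencil n e Q X * Z) $$ (i * n + a, b)))"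
    "c < dim_col (mat n m (\<lambda>(a, b). (swapped_pencil n e Q X * Z) $$ (i * n + a, b)))"
  then have ac: "a < n" "c < m" by auto
  have r: "i * n + a < e * n"
    using i ac by (metis add_less_cancel_left less_le_trans mult_Suc mult_le_mono1 Suc_leI add.commute)
  have aff: "aff_ext n X k \<in> carrier_mat n n" "Q k \<in> carrier_mat e e" for k using X Q by auto
  have "(swapped_pencil n e Q X * Z) $$ (i * n + a, c) =
     (\<Sum>s = 0..<e * n. swapped_pencil n e Q X $$ (i * n + a, s) * Z $$ (s, c))"
    by (rule index_mult_mat_sum[OF swapped_pencil_carrier Z r ac(2)])
  also have "\<dots> = (\<Sum>s = 0..<e * n. block n Q X i (s div n) $$ (a, s mod n) * Z $$ (s div n * n + s mod n, c))"
  proof (rule sum.cong[OF refl])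
    fix s assume "s \<in> {0..<e * n}"
    then have s: "s < e * n" by simp
    have "swapped_pencil n e Q X $$ (i * n + a, s) = block n Q X i (s div n) $$ (a, s mod n)"
      using s r ac unfolding swapped_pencil_def msum_index[OF r s]
      by (simp add: kron_index[OF aff(2,1) r s] entry_pencil_def mod_less_of_less_mult)
    then show "swapped_pencil n e Q X $$ (i * n + a, s) * Z $$ (s, c) =
      block n Q X i (s div n) $$ (a, s mod n) * Z $$ (s div n * n + s mod n, c)" by simp
  qed
  also have "\<dots> = (\<Sum>j = 0..<e. \<Sum>b = 0..<n. block n Q X i j $$ (a, b) * Z $$ (j * n + b, c))"
    by (rule sum_div_mod)
  also have "\<dots> = nsum n m e (\<lambda>j. block n Q X i j * mat n m (\<lambda>(a, b). Z $$ (j * n + a, b))) $$ (a, c)"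
    unfolding nsum_index[OF ac] lessThan_atLeast0
    by (intro sum.cong refl, subst index_mult_mat_sum[where n = n and m = n and p = m]) (use ac in auto)
  finally show "nsum n m e (\<lambda>j. block n Q X i j * mat n m (\<lambda>(a, b). Z $$ (j * n + a, b))) $$ (a, c) =
    mat n m (\<lambda>(a, b). (swapped_pencil n e Q X * Z) $$ (i * n + a, b)) $$ (a, c)"
    using ac by simp
qed auto

lemma index_mat_adjoint:
  "A \<in> carrier_mat n n \<Longrightarrow> a < n \<Longrightarrow> b < n \<Longrightarrow> mat_adjoint A $$ (a, b) = cnj (A $$ (b, a))"
  for A :: "complex mat"
  by (simp add: mat_adjoint_def mat_of_rows_def)

text \<open>The formal adjoint: coefficients are conjugate transposed while the variables stay, so
  the result is again a pencil in X. Its value is the adjoint of Q at the adjoint tuple, which is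
  the adjoint of Q(X) when X is hermitian.\<close>

definition adj_coeffs :: "nat \<Rightarrow> ('d option \<Rightarrow> complex mat) \<Rightarrow> 'd option \<Rightarrow> complex mat" where
  "adj_coeffs e Q m = mat e e (\<lambda>(i, j). cnj (Q m $$ (j, i)))"

lemma block_adj:
  assumes X: "X \<in> herm_tuples n" and ij: "i < e" "j < e" and ab: "a < n" "b < n"
  shows "block n (adj_coeffs e Q) X i j $$ (a, b) = cnj (block n Q X j i $$ (b, a))"
proof -
  have "X k \<in> carrier_mat n n" "mat_adjoint (X k) = X k" for k using X by (auto simp: herm_tuples_def)
  then have "cnj (X k $$ (b, a)) = X k $$ (a, b)" for k
    using index_mat_adjoint[of "X k" n a b] ab by metis
  then have "cnj (aff_ext n X k $$ (b, a)) = aff_ext n X k $$ (a, b)" for k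
    using ab by (auto simp: aff_ext_def split: option.split)
  then show ?thesis using ij ab by (simp add: entry_pencil_def adj_coeffs_def)
qed

text \<open>The expression for u (Q^H Q)^-1 Q^H v, where Q^H is the pencil of
  \<open>adj_coeffs\<close>. The matrix handed to the elimination is Q^H Q, the right-hand side is
  Q^H v.\<close>

definition gram_expr :: "nat \<Rightarrow> complex mat \<Rightarrow> ('d :: finite option \<Rightarrow> complex mat) \<Rightarrow> complex mat \<Rightarrow> 'd rat_expr" where
  "gram_expr e u Q v = schur_expr e
     (\<lambda>i j. sum_expr e (\<lambda>k. Mult (lin_expr (\<lambda>m. adj_coeffs e Q m $$ (i, k))) (lin_expr (\<lambda>m. Q m $$ (k, j)))))
     (\<lambda>j. Const (u $$ (0, j)))
     (\<lambda>i. sum_expr e (\<lambda>k. Mult (lin_expr (\<lambda>m. adj_coeffs e Q m $$ (i, k))) (Const (v $$ (k, 0)))))"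

lemma evals_Mult: "evals n X r A \<Longrightarrow> evals n X s B \<Longrightarrow> evals n X (Mult r s) (A * B)"
  by (auto simp: evals_def)

lemma evals_Const: "evals n X (Const c) (c \<cdot>\<^sub>m 1\<^sub>m n)"
  by (auto simp: evals_def)

text \<open>At hermitian X the form at x is the squared norm of Q(X) x. Its vanishing gives Q(X) x =
  0, and then x = 0 by invertibility.\<close>

lemma anisotropic_gram:
  assumes Q: "tuple e Q" and X: "X \<in> herm_tuples n" and d: "det (swapped_pencil n e Q X) \<noteq> 0"
  shows "anisotropic n e (\<lambda>i j. nsum n n e (\<lambda>k. block n (adj_coeffs e Q) X i k * block n Q X k j))"
  unfolding anisotropic_def
proof (rule allI, rule impI, rule impI)
  fix x assume x: "\<forall>j<e. x j \<in> carrier_mat n 1"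
    and form: "(\<Sum>i<e. \<Sum>a<n. cnj (x i $$ (a, 0)) *
      nsum n 1 e (\<lambda>j. nsum n n e (\<lambda>k. block n (adj_coeffs e Q) X i k * block n Q X k j) * x j) $$ (a, 0)) = 0"
  have tX: "tuple n X" using X by (auto simp: herm_tuples_def tuple_def)
  define z where "z k = nsum n 1 e (\<lambda>j. block n Q X k j * x j)" for k
  have z: "z k \<in> carrier_mat n 1" for k by (simp add: z_def)
  have bx: "block n Q X k j * x j \<in> carrier_mat n 1" if "j < e" for k j using x that by (auto intro!: mult_carrier_mat[where n = n])
  have "nsum n 1 e (\<lambda>j. nsum n n e (\<lambda>k. block n (adj_coeffs e Q) X i k * block n Q X k j) * x j) =
     nsum n 1 e (\<lambda>k. block n (adj_coeffs e Q) X i k * z k)" for i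
  proof -
    have "nsum n 1 e (\<lambda>j. nsum n n e (\<lambda>k. block n (adj_coeffs e Q) X i k * block n Q X k j) * x j) =
       nsum n 1 e (\<lambda>j. nsum n 1 e (\<lambda>k. block n (adj_coeffs e Q) X i k * (block n Q X k j * x j)))"
    proof (rule nsum_cong)
      fix j assume j: "j < e"
      have xj: "x j \<in> carrier_mat n 1" using x j by simp
      show "nsum n n e (\<lambda>k. block n (adj_coeffs e Q) X i k * block n Q X k j) * x j =
        nsum n 1 e (\<lambda>k. block n (adj_coeffs e Q) X i k * (block n Q X k j * x j))"
        by (subst nsum_mult[OF xj mult_carrier_mat[OF block_carrier block_carrier]])
          (simp only: assoc_mult_mat[OF block_carrier block_carrier xj])
    qed
    also have "\<dots> = nsum n 1 e (\<lambda>k. nsum n 1 e (\<lambda>j. block n (adj_coeffs e Q) X i k * (block n Q X k j * x j)))"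
      by (rule nsum_swap)
    also have "\<dots> = nsum n 1 e (\<lambda>k. block n (adj_coeffs e Q) X i k * z k)"
      unfolding z_def by (intro nsum_cong mult_nsum[symmetric, OF block_carrier] bx)
    finally show ?thesis .
  qed
  moreover have "nsum n 1 e (\<lambda>k. block n (adj_coeffs e Q) X i k * z k) $$ (a, 0) =
     (\<Sum>k<e. \<Sum>b<n. cnj (block n Q X k i $$ (b, a)) * z k $$ (b, 0))" if "i < e" "a < n" for i a
  proof -
    have z1: "(0 :: nat) < 1" by simp
    show ?thesis unfolding nsum_index[OF that(2) z1]
      by (intro sum.cong refl, subst index_mult_mat_sum[OF block_carrier z that(2) z1])
        (use that in \<open>auto simp: block_adj[OF X] lessThan_atLeast0\<close>)
  qed
  ultimately have "0 = (\<Sum>i<e. \<Sum>a<n. cnj (x i $$ (a, 0)) * (\<Sum>k<e. \<Sum>b<n. cnj (block n Q X k i $$ (b, a)) * z k $$ (b, 0)))"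
    using form by simp
  also have "\<dots> = (\<Sum>i<e. \<Sum>a<n. \<Sum>k<e. \<Sum>b<n. cnj (block n Q X k i $$ (b, a) * x i $$ (a, 0)) * z k $$ (b, 0))"
    by (simp add: sum_distrib_left mult_ac)
  \<comment> \<open>The following exchanges bring the sums over k and b to the outside; the sums
    over i and a then collect to the conjugate of \<open>z k\<close> at b.\<close>
  also have "\<dots> = (\<Sum>i<e. \<Sum>k<e. \<Sum>a<n. \<Sum>b<n. cnj (block n Q X k i $$ (b, a) * x i $$ (a, 0)) * z k $$ (b, 0))"
    by (intro sum.cong refl sum.swap)
  also have "\<dots> = (\<Sum>i<e. \<Sum>k<e. \<Sum>b<n. \<Sum>a<n. cnj (block n Q X k i $$ (b, a) * x i $$ (a, 0)) * z k $$ (b, 0))"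
    by (intro sum.cong refl sum.swap)
  also have "\<dots> = (\<Sum>k<e. \<Sum>i<e. \<Sum>b<n. \<Sum>a<n. cnj (block n Q X k i $$ (b, a) * x i $$ (a, 0)) * z k $$ (b, 0))"
    by (rule sum.swap)
  also have "\<dots> = (\<Sum>k<e. \<Sum>b<n. \<Sum>i<e. \<Sum>a<n. cnj (block n Q X k i $$ (b, a) * x i $$ (a, 0)) * z k $$ (b, 0))"
    by (intro sum.cong refl sum.swap)
  also have "\<dots> = (\<Sum>k<e. \<Sum>b<n. cnj (z k $$ (b, 0)) * z k $$ (b, 0))"
  proof (intro sum.cong refl)
    fix k b assume "k \<in> {..<e}" "b \<in> {..<n}"
    then have b: "b < n" by simp
    have z1: "(0 :: nat) < 1" by simp
    have "z k $$ (b, 0) = (\<Sum>i<e. \<Sum>a<n. block n Q X k i $$ (b, a) * x i $$ (a, 0))"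
      unfolding z_def nsum_index[OF b z1]
      by (intro sum.cong refl, subst index_mult_mat_sum[OF block_carrier _ b z1]) (use x in \<open>auto simp: lessThan_atLeast0\<close>)
    then show "(\<Sum>i<e. \<Sum>a<n. cnj (block n Q X k i $$ (b, a) * x i $$ (a, 0)) * z k $$ (b, 0)) = cnj (z k $$ (b, 0)) * z k $$ (b, 0)"
      by (simp add: sum_distrib_right)
  qed
  also have "\<dots> = of_real (\<Sum>k<e. \<Sum>b<n. (cmod (z k $$ (b, 0)))\<^sup>2)"
    unfolding of_real_sum complex_norm_square by (intro sum.cong refl mult.commute)
  finally have "complex_of_real (\<Sum>k<e. \<Sum>b<n. (cmod (z k $$ (b, 0)))\<^sup>2) = 0" by (rule sym)
  then have "(\<Sum>k<e. \<Sum>b<n. (cmod (z k $$ (b, 0)))\<^sup>2) = 0" by (simp only: of_real_eq_0_iff)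
  then have z0: "z k $$ (b, 0) = 0" if "k < e" "b < n" for k b
    using that by (simp add: sum_nonneg_eq_0_iff sum_nonneg)
  \<comment> \<open>The blocks of x stacked into one column, to which the inverse of the whole
    pencil can be applied.\<close>
  define Z where "Z = mat (e * n) 1 (\<lambda>(r, _). x (r div n) $$ (r mod n, 0))"
  have Z: "Z \<in> carrier_mat (e * n) 1" by (simp add: Z_def)
  have idx: "i * n + a < e * n" if "i < e" "a < n" for i a
    using that by (metis add_less_cancel_left less_le_trans mult_Suc mult_le_mono1 Suc_leI add.commute)
  have xZ: "mat n 1 (\<lambda>(a, b). Z $$ (j * n + a, b)) = x j" if "j < e" for j
    using x that idx[OF that] by (intro eq_matI) (auto simp: Z_def)
  let ?S = "swapped_pencil n e Q X"
  have "?S * Z = 0\<^sub>m (e * n) 1"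
  proof (rule eq_matI)
    fix r s assume "r < dim_row (0\<^sub>m (e * n) 1 :: complex mat)" "s < dim_col (0\<^sub>m (e * n) 1 :: complex mat)"
    then have rs: "r < e * n" "s = 0" by auto
    then have rr: "r div n < e" "r mod n < n" by (auto simp: div_less_of_less_mult mod_less_of_less_mult)
    have "mat n 1 (\<lambda>(a, b). (?S * Z) $$ (r div n * n + a, b)) = z (r div n)"
      unfolding swapped_pencil_mult_block[OF Q tX Z rr(1), symmetric] z_def by (intro nsum_cong) (simp add: xZ del: One_nat_def)
    from arg_cong[OF this, of "\<lambda>M. M $$ (r mod n, 0)"] show "(?S * Z) $$ (r, s) = 0\<^sub>m (e * n) 1 $$ (r, s)"
      using rs rr z0[OF rr] by (simp del: index_mult_mat)
  qed (use Z in auto)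
  then have "minv ?S * (?S * Z) = 0\<^sub>m (e * n) 1"
    using right_mult_zero_mat[OF minv_carrier[OF swapped_pencil_carrier]] by simp
  then have Z0: "Z = 0\<^sub>m (e * n) 1"
    using assoc_mult_mat[OF minv_carrier[OF swapped_pencil_carrier] swapped_pencil_carrier Z]
      minv_inverse(2)[OF swapped_pencil_carrier d] left_mult_one_mat[OF Z] by metis
  show "\<forall>j<e. x j = 0\<^sub>m n 1"
  proof (intro allI impI)
    fix j assume j: "j < e"
    have "mat n 1 (\<lambda>(a, b). Z $$ (j * n + a, b)) = 0\<^sub>m n 1"
      unfolding Z0 by (intro eq_matI) (auto simp: idx[OF j])
    then show "x j = 0\<^sub>m n 1" by (simp only: xZ[OF j])
  qed
qed

lemma gram_expr_defined:
  assumes Q: "tuple e Q" and u: "u \<in> carrier_mat 1 e" and v: "v \<in> carrier_mat e 1"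
    and X: "X \<in> pdom n e Q" "X \<in> herm_tuples n"
  shows "eval_expr n X (gram_expr e u Q v) \<noteq> None"
proof -
  have tX: "tuple n X" using X by (simp add: pdom_def)
  have d: "det (swapped_pencil n e Q X) \<noteq> 0" using swapped_pencil_pval(1)[OF tX Q u v] X by (simp add: pdom_def)
  show ?thesis unfolding gram_expr_def
  proof (rule schur_expr_defined[OF _ _ _ anisotropic_gram[OF Q X(2) d]])
    show "evals n X (sum_expr e (\<lambda>k. Mult (lin_expr (\<lambda>m. adj_coeffs e Q m $$ (i, k))) (lin_expr (\<lambda>m. Q m $$ (k, j)))))
      (nsum n n e (\<lambda>k. block n (adj_coeffs e Q) X i k * block n Q X k j))" for i j
      by (intro evals_sum_expr evals_Mult evals_lin_expr[OF tX])
    show "evals n X (Const (u $$ (0, j))) (u $$ (0, j) \<cdot>\<^sub>m 1\<^sub>m n)" for j by (rule evals_Const)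
    show "evals n X (sum_expr e (\<lambda>k. Mult (lin_expr (\<lambda>m. adj_coeffs e Q m $$ (i, k))) (Const (v $$ (k, 0)))))
      (nsum n n e (\<lambda>k. block n (adj_coeffs e Q) X i k * (v $$ (k, 0) \<cdot>\<^sub>m 1\<^sub>m n)))" for i
      by (intro evals_sum_expr evals_Mult evals_Const evals_lin_expr[OF tX])
  qed
qed

text \<open>The blocks y of Q(X)^-1 v solve Q y = v, hence also Q^H Q y = Q^H v, whatever matrix Q^H
  takes as its value at X. So the expression has the value u y wherever it and Q(X)^-1 are both
  defined.\<close>

lemma gram_expr_value:
  assumes Q: "tuple e Q" and u: "u \<in> carrier_mat 1 e" and v: "v \<in> carrier_mat e 1"
    and X: "X \<in> pdom n e Q" and s: "eval_expr n X (gram_expr e u Q v) = Some s"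
  shows "s = pval n e u Q v X"
proof -
  have tX: "tuple n X" using X by (simp add: pdom_def)
  have dp: "det (pencil n e Q X) \<noteq> 0" using X by (simp add: pdom_def)
  note p = swapped_pencil_pval[OF tX Q u v]
  have d: "det (swapped_pencil n e Q X) \<noteq> 0" using p dp by simp
  have kv: "kron v (1\<^sub>m n) \<in> carrier_mat (e * n) n" and ku: "kron u (1\<^sub>m n) \<in> carrier_mat n (e * n)"
    using kron_carrier[OF v one_carrier_mat[of n]] kron_carrier[OF u one_carrier_mat[of n]] by auto
  let ?S = "swapped_pencil n e Q X"
  \<comment> \<open>The matrix Q(X)^-1 v in swapped coordinates, cut into its blocks y
    below.\<close>
  define Z where "Z = minv ?S * kron v (1\<^sub>m n)"
  have Z: "Z \<in> carrier_mat (e * n) n" unfolding Z_def by (rule mult_carrier_mat[OF minv_carrier[OF swapped_pencil_carrier] kv])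
  have SZ: "?S * Z = kron v (1\<^sub>m n)"
    unfolding Z_def using assoc_mult_mat[OF swapped_pencil_carrier minv_carrier[OF swapped_pencil_carrier] kv]
      minv_inverse(1)[OF swapped_pencil_carrier d] left_mult_one_mat[OF kv] by metis
  define y where "y j = mat n n (\<lambda>(a, b). Z $$ (j * n + a, b))" for j
  have y: "y j \<in> carrier_mat n n" for j by (simp add: y_def)
  have idx: "i * n + a < e * n" if "i < e" "a < n" for i a
    using that by (metis add_less_cancel_left less_le_trans mult_Suc mult_le_mono1 Suc_leI add.commute)
  have Ey: "nsum n n e (\<lambda>j. block n Q X k j * y j) = v $$ (k, 0) \<cdot>\<^sub>m 1\<^sub>m n" if k: "k < e" for k
    unfolding y_def swapped_pencil_mult_block[OF Q tX Z k] SZ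
    using k idx[OF k] v by (intro eq_matI) (auto simp: kron_index[OF v one_carrier_mat])
  have "s = nsum n n e (\<lambda>j. u $$ (0, j) \<cdot>\<^sub>m 1\<^sub>m n * y j)"
  proof (rule schur_expr_value[OF _ _ _ y _ s[unfolded gram_expr_def]])
    show "evals n X (sum_expr e (\<lambda>k. Mult (lin_expr (\<lambda>m. adj_coeffs e Q m $$ (i, k))) (lin_expr (\<lambda>m. Q m $$ (k, j)))))
      (nsum n n e (\<lambda>k. block n (adj_coeffs e Q) X i k * block n Q X k j))" for i j
      by (intro evals_sum_expr evals_Mult evals_lin_expr[OF tX])
    show "evals n X (Const (u $$ (0, j))) (u $$ (0, j) \<cdot>\<^sub>m 1\<^sub>m n)" for j by (rule evals_Const)
    show "evals n X (sum_expr e (\<lambda>k. Mult (lin_expr (\<lambda>m. adj_coeffs e Q m $$ (i, k))) (Const (v $$ (k, 0)))))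
      (nsum n n e (\<lambda>k. block n (adj_coeffs e Q) X i k * (v $$ (k, 0) \<cdot>\<^sub>m 1\<^sub>m n)))" for i
      by (intro evals_sum_expr evals_Mult evals_Const evals_lin_expr[OF tX])
    show "nsum n n e (\<lambda>j. nsum n n e (\<lambda>k. block n (adj_coeffs e Q) X i k * block n Q X k j) * y j) =
      nsum n n e (\<lambda>k. block n (adj_coeffs e Q) X i k * (v $$ (k, 0) \<cdot>\<^sub>m 1\<^sub>m n))" for i
    proof -
      have "nsum n n e (\<lambda>j. nsum n n e (\<lambda>k. block n (adj_coeffs e Q) X i k * block n Q X k j) * y j) =
         nsum n n e (\<lambda>j. nsum n n e (\<lambda>k. block n (adj_coeffs e Q) X i k * (block n Q X k j * y j)))"
      proof (rule nsum_cong)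
        fix j
        show "nsum n n e (\<lambda>k. block n (adj_coeffs e Q) X i k * block n Q X k j) * y j =
          nsum n n e (\<lambda>k. block n (adj_coeffs e Q) X i k * (block n Q X k j * y j))"
          by (subst nsum_mult[OF y mult_carrier_mat[OF block_carrier block_carrier]])
            (simp only: assoc_mult_mat[OF block_carrier block_carrier y])
      qed
      also have "\<dots> = nsum n n e (\<lambda>k. nsum n n e (\<lambda>j. block n (adj_coeffs e Q) X i k * (block n Q X k j * y j)))"
        by (rule nsum_swap)
      also have "\<dots> = nsum n n e (\<lambda>k. block n (adj_coeffs e Q) X i k * nsum n n e (\<lambda>j. block n Q X k j * y j))"
        by (intro nsum_cong mult_nsum[symmetric, OF block_carrier] mult_carrier_mat[OF block_carrier y])
      also have "\<dots> = nsum n n e (\<lambda>k. block n (adj_coeffs e Q) X i k * (v $$ (k, 0) \<cdot>\<^sub>m 1\<^sub>m n))"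
        by (intro nsum_cong) (simp add: Ey)
      finally show ?thesis .
    qed
  qed
  also have "\<dots> = kron u (1\<^sub>m n) * Z"
  proof (rule eq_matI)
    fix a c assume "a < dim_row (kron u (1\<^sub>m n) * Z)" "c < dim_col (kron u (1\<^sub>m n) * Z)"
    then have ac: "a < n" "c < n" using u Z by auto
    have "(kron u (1\<^sub>m n) * Z) $$ (a, c) = (\<Sum>r = 0..<e * n. kron u (1\<^sub>m n) $$ (a, r) * Z $$ (r, c))"
      by (rule index_mult_mat_sum[OF ku Z ac])
    also have "\<dots> = (\<Sum>r = 0..<e * n. (if a = r mod n then u $$ (0, r div n) * Z $$ (r div n * n + r mod n, c) else 0))"
      using ac by (intro sum.cong refl) (simp add: kron_index[OF u one_carrier_mat] mod_less_of_less_mult)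
    also have "\<dots> = (\<Sum>j = 0..<e. \<Sum>b = 0..<n. (if a = b then u $$ (0, j) * Z $$ (j * n + b, c) else 0))"
      by (rule sum_div_mod)
    also have "\<dots> = (\<Sum>j<e. u $$ (0, j) * Z $$ (j * n + a, c))" using ac by (simp add: lessThan_atLeast0)
    also have "\<dots> = nsum n n e (\<lambda>j. u $$ (0, j) \<cdot>\<^sub>m 1\<^sub>m n * y j) $$ (a, c)"
      unfolding nsum_index[OF ac] mult_smult_assoc_mat[OF one_carrier_mat y] left_mult_one_mat[OF y]
      using ac by (intro sum.cong refl) (simp add: y_def)
    finally show "nsum n n e (\<lambda>j. u $$ (0, j) \<cdot>\<^sub>m 1\<^sub>m n * y j) $$ (a, c) = (kron u (1\<^sub>m n) * Z) $$ (a, c)" ..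
  qed (use u Z in auto)
  also have "\<dots> = pval n e u Q v X"
    unfolding p(2)[OF dp] Z_def by (rule assoc_mult_mat[symmetric, OF ku minv_carrier[OF swapped_pencil_carrier] kv])
  finally show ?thesis .
qed

text \<open>Write a point of the domain as \<open>A + \<i> B\<close> with hermitian \<open>A\<close>, \<open>B\<close> and vary \<open>A + t B\<close> over real \<open>t\<close>.\<close>

lemma hermitian_point_exists:
  assumes Q: "tuple e Q" and X: "X \<in> pdom n e Q"
  shows "\<exists>Y \<in> pdom n e Q. Y \<in> herm_tuples n"
proof -
  have tX: "tuple n X" using X by (simp add: pdom_def)
  define A where "A k = mat n n (\<lambda>(a, b). (X k $$ (a, b) + cnj (X k $$ (b, a))) / 2)" for k
  define B where "B k = mat n n (\<lambda>(a, b). (X k $$ (a, b) - cnj (X k $$ (b, a))) / (2 * \<i>))" for k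
  have tA: "tuple n A" and tB: "tuple n B" by (auto simp: tuple_def A_def B_def)
  have "(\<lambda>k. A k + \<i> \<cdot>\<^sub>m B k) = X"
    using tX by (intro ext eq_matI) (auto simp: A_def B_def field_simps)
  then have "\<forall>\<^sub>F t in at 0. (\<lambda>k. A k + t \<cdot>\<^sub>m B k) \<in> pdom n e Q"
    using eventually_pdom_line[OF tA tB Q, of \<i>] X by simp
  then obtain d where d: "d > 0" "\<And>t. t \<noteq> 0 \<Longrightarrow> dist t 0 < d \<Longrightarrow> (\<lambda>k. A k + t \<cdot>\<^sub>m B k) \<in> pdom n e Q"
    unfolding eventually_at by auto
  \<comment> \<open>Half the radius: real, nonzero and inside the punctured disk.\<close>
  define t where "t = complex_of_real (d / 2)"
  have "(\<lambda>k. A k + t \<cdot>\<^sub>m B k) \<in> pdom n e Q" by (rule d(2)) (use d(1) in \<open>auto simp: t_def\<close>)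
  moreover have "mat_adjoint (A k + t \<cdot>\<^sub>m B k) = A k + t \<cdot>\<^sub>m B k" for k
  proof (rule eq_matI)
    have c: "A k + t \<cdot>\<^sub>m B k \<in> carrier_mat n n" by (simp add: A_def B_def)
    fix a b assume "a < dim_row (A k + t \<cdot>\<^sub>m B k)" "b < dim_col (A k + t \<cdot>\<^sub>m B k)"
    then have ab: "a < n" "b < n" by (auto simp: B_def)
    show "mat_adjoint (A k + t \<cdot>\<^sub>m B k) $$ (a, b) = (A k + t \<cdot>\<^sub>m B k) $$ (a, b)"
      unfolding index_mat_adjoint[OF c ab] using ab
      by (simp add: A_def B_def t_def add_divide_distrib diff_divide_distrib algebra_simps)
  qed (auto simp: mat_adjoint_def A_def B_def)
  moreover have "A k + t \<cdot>\<^sub>m B k \<in> carrier_mat n n" for k by (simp add: A_def B_def)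
  ultimately show ?thesis
    unfolding herm_tuples_def by (intro bexI[of _ "\<lambda>k. A k + t \<cdot>\<^sub>m B k"]) auto
qed

section \<open>From expressions to pencils, and the choice of the representative\<close>

lemma represents_dom_n: "represents e u Q v r \<Longrightarrow> dom_n n r = pdom n e Q"
  by (auto simp: represents_def dom_n_def pdom_def tuple_def)

lemma represents_nondegenerate: "represents e u Q v r \<Longrightarrow> nondegenerate r \<longleftrightarrow> pnondeg e Q"
  by (auto simp: nondegenerate_def expr_dom_def pnondeg_def represents_dom_n)

lemma represents_eval: "represents e u Q v r \<Longrightarrow> X \<in> pdom n e Q \<Longrightarrow> eval_expr n X r = Some (pval n e u Q v X)"
  by (auto simp: represents_def pdom_def)

lemma rat_equiv_iff:
  assumes "represents e u Q v r" "represents e' u' Q' v' s"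
  shows "(r, s) \<in> rat_equiv \<longleftrightarrow> pnondeg e Q \<and> pnondeg e' Q' \<and> pequiv e u Q v e' u' Q' v'"
  using assms by (auto simp: rat_equiv_def represents_nondegenerate represents_dom_n pequiv_def represents_eval)

theorem proposition2p1:
  fixes R :: "'d::finite rat_expr set"
  assumes "R \<in> nc_rat_funs"
  shows "\<exists>r\<in>R. fun_hdom R = expr_hdom r"
proof -
  obtain r0 where r0: "nondegenerate r0" and R: "R = rat_equiv `` {r0}"
    using assms unfolding nc_rat_funs_def by (auto elim!: quotientE)
  obtain e0 u0 Q0 v0 where rep0: "represents e0 u0 Q0 v0 r0" using expr_representation by blast
  then have Q0: "tuple e0 Q0" "u0 \<in> carrier_mat 1 e0" "v0 \<in> carrier_mat e0 1" by (auto simp: represents_def)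
  have nd0: "pnondeg e0 Q0" using r0 rep0 by (simp add: represents_nondegenerate)
  define realizes where "realizes e u Q v \<longleftrightarrow> tuple e Q \<and> u \<in> carrier_mat 1 e \<and> v \<in> carrier_mat e 1 \<and> pnondeg e Q \<and>
    pequiv e0 u0 Q0 v0 e u Q v" for e u v and Q :: "'d option \<Rightarrow> complex mat"
  have "realizes e0 u0 Q0 v0" using Q0 nd0 by (simp add: realizes_def pequiv_def)
  then have ex: "\<exists>e u Q v. realizes e u Q v" by blast
  \<comment> \<open>The minimum is taken over all pencils equivalent to the one of r0, whether or
    not they were built from an expression.\<close>
  define e where "e = (LEAST e. \<exists>u Q v. realizes e u Q v)"
  have "\<exists>u Q v. realizes e u Q v" unfolding e_def by (rule LeastI_ex[OF ex])
  then obtain u Q v where "realizes e u Q v" by blast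
  then have Q: "tuple e Q" "u \<in> carrier_mat 1 e" "v \<in> carrier_mat e 1" and nd: "pnondeg e Q"
    and eq: "pequiv e0 u0 Q0 v0 e u Q v" by (auto simp: realizes_def)
  have min: "\<not> pequiv e u Q v e' u' Q' v'" if "e' < e" "tuple e' Q'" "u' \<in> carrier_mat 1 e'" "v' \<in> carrier_mat e' 1" "pnondeg e' Q'"
    for e' u' v' and Q' :: "'d option \<Rightarrow> complex mat"
  proof
    assume "pequiv e u Q v e' u' Q' v'"
    from pequiv_trans[OF Q0 that(2-4) Q(1) nd eq this] that have "realizes e' u' Q' v'" by (simp add: realizes_def)
    then show False using not_less_Least[of e' "\<lambda>e. \<exists>u Q v. realizes e u Q v"] \<open>e' < e\<close> unfolding e_def by blast
  qed
  \<comment> \<open>The whole domain of each member of R is covered, not only its hermitian part;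
    the non-hermitian points of the domain of r0 are needed below.\<close>
  have dom: "X \<in> pdom n e Q" if "r \<in> R" "n \<ge> 1" "X \<in> dom_n n r" for r n X
  proof -
    obtain f a T b where rep: "represents f a T b r" using expr_representation by blast
    then have T: "tuple f T" "a \<in> carrier_mat 1 f" "b \<in> carrier_mat f 1" by (auto simp: represents_def)
    have eqT: "pequiv e0 u0 Q0 v0 f a T b" using that(1) rat_equiv_iff[OF rep0 rep] by (simp add: R)
    show ?thesis
      by (rule minimal_pencil_domain[OF Q nd min T pequiv_trans[OF Q T Q0(1) nd0 pequiv_sym[OF eq] eqT] that(2)])
        (use that rep in \<open>auto simp: represents_dom_n\<close>)
  qed
  have r0R: "r0 \<in> R" using rat_equiv_iff[OF rep0 rep0] nd0 by (simp add: R pequiv_def)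
  define r where "r = gram_expr e u Q v"
  have herm: "X \<in> dom_n n r" if "X \<in> pdom n e Q" "X \<in> herm_tuples n" for n X
    using gram_expr_defined[OF Q that] that by (auto simp: dom_n_def r_def pdom_def tuple_def)
  \<comment> \<open>Membership in R presupposes nondegeneracy. A hermitian point in the domain of Q
    provides a point where the Gram expression is defined.\<close>
  have "nondegenerate r"
  proof -
    obtain n X where n: "n \<ge> 1" and "X \<in> pdom n e Q" using nd by (auto simp: pnondeg_def)
    then obtain Y where "Y \<in> pdom n e Q" "Y \<in> herm_tuples n" using hermitian_point_exists[OF Q(1)] by blast
    then have "Y \<in> dom_n n r" by (rule herm)
    then show ?thesis using n by (auto simp: nondegenerate_def expr_dom_def)
  qed
  \<comment> \<open>X need not be hermitian. It lies in the domain of the minimal pencil because r0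
    is defined at X, and there the value of the Gram expression is known.\<close>
  moreover have "eval_expr n X r0 = eval_expr n X r" if n: "n \<ge> 1" and X: "X \<in> dom_n n r0 \<inter> dom_n n r" for n X
  proof -
    have X0: "X \<in> pdom n e0 Q0" using X rep0 by (simp add: represents_dom_n)
    have XQ: "X \<in> pdom n e Q" using dom[OF r0R n] X by simp
    obtain s where s: "eval_expr n X r = Some s" using X by (auto simp: dom_n_def)
    have "s = pval n e u Q v X" by (rule gram_expr_value[OF Q XQ s[unfolded r_def]])
    also have "\<dots> = pval n e0 u0 Q0 v0 X" using eq n X0 XQ by (simp add: pequiv_def)
    finally show ?thesis using s represents_eval[OF rep0 X0] by simp
  qed
  ultimately have rR: "r \<in> R" using r0 by (auto simp: R rat_equiv_def)
  have "fun_hdom R = expr_hdom r"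
  proof
    show "expr_hdom r \<subseteq> fun_hdom R" using rR by (auto simp: fun_hdom_def)
    show "fun_hdom R \<subseteq> expr_hdom r"
      using dom herm by (fastforce simp: fun_hdom_def expr_hdom_def)
  qed
  with rR show ?thesis by blast
qed

end
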